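(* Let $1\le m\le n$ and let $Q$ be the type $A_n$ quiver $1\leftarrow 2\leftarrow\cdots\leftarrow n-1\leftarrow n$ with minuscule vertex $m$. Then for every $M\in\mathcal{C}_{Q,m}$, $\rho_{Q,m}(M)=HG(M)$, where $\mathsf P_{Q,m}$ is identified with the cells of the rectangular Young diagram with $n+1-m$ rows of length $m$ as described below.
   Context: Let $\Bbbk$ be an algebraically closed field. $\tau$ is the Auslander–Reiten translation. $\mathsf{P}_{Q,m}$ is the set of isomorphism classes of indecomposable representations $V$ of $Q$ with $V_m\neq0$, partially ordered by the transitive closure of $x<y$ whenever there is an arrow $x\to y$ in the Auslander–Reiten quiver of $Q$; $\lessdot$ denotes covers. $\mathcal{C}_{Q,m}$ is the category of finite direct sums of such indecomposables. Indecomposables of $Q$ are determined by their dimension vectors, which are the $0/1$ vectors supported on an interval of $\{1,\dots,n\}$. Identification with rim hooks and cells: let $\lambda$ be the Young diagram (English notation) with $n+1-m$ rows each of length $m$. Its southeast border consists of $n$ cells; number them $1,\dots,n$ reading from the southwest end to the northeast end. An indecomposable with dimension vector $d$ (supported at $m$) corresponds to the rim hook of $\lambda$ consisting of the border cells $i$ with $d_i=1$, and to the cell $u$ of $\lambda$ whose hook has the same two end cells as this rim hook. Thus $M\cong\bigoplus M_u^{c_u}\in\mathcal C_{Q,m}$ corresponds to the multiset of rim hooks (equivalently the array $(c_u)_{u\in\lambda}$ of nonnegative integers), and functions on $\mathsf P_{Q,m}$ are identified with fillings of $\lambda$. $HG(M)$ denotes the reverse plane partition of shape $\lambda$ assigned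 to this multiset of rim hooks (array) by the Hillman–Grassl correspondence of Hillman and Grassl (1976). Toggles: for $\rho:\mathsf P_{Q,m}\to[0,N]$ and $x\in\mathsf P_{Q,m}$, $t_x\rho$ agrees with $\rho$ except at $x$, where $t_x\rho(x)=\max_{x\lessdot y}\rho(y)+\min_{z\lessdot x}\rho(z)-\rho(x)$, with max over the empty set $=0$, min over the empty set $=N$. The map $\rho_{Q,m}$: fix a listing $M_1,\dots,M_s$ of all indecomposable representations of $Q$ up to isomorphism such that whenever there is an arrow $M_i\to M_j$ in the Auslander–Reiten quiver, $j<i$. For $M\cong\bigoplus_{j}M_j^{c_j}$, let $\rho_0\equiv0$ and for $k=1,\dots,s$, $x\in\mathsf P_{Q,m}$: $\rho_k(x)=\max_{x\lessdot y}\rho_{k-1}(y)+c_k$ if $x$ corresponds to $M_k$; $\rho_k(x)=(t_x\rho_{k-1})(x)$ if $x$ corresponds to $\tau^{\ell}(M_k)$ for some $\ell<0$; $\rho_k(x)=\rho_{k-1}(x)$ otherwise (independent of $N$). Set $\rho_{Q,m}(M)=\rho_s$.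
   Formalization: Values of ρ are read into the diagram with columns mirrored: the indecomposable supported on [a,b] fills cell (n+1−b, m+1−a), not the cell u=(n+1−b, a) of its rim hook (still used for the array c_u); unmirrored, the claim fails, e.g. for n=m=2. *)

theory Defs
  imports
    "HOL-Computational_Algebra.Computational_Algebra"
    "Graph_Theory.Digraph"
    "Jordan_Normal_Form.Matrix"
begin

section \<open>Representations of a quiver\<close>

text \<open>
  A quiver is a digraph (multiple arrows allowed). Representations are finite-dimensional and given
  in coordinates: the space at a vertex \<open>v\<close> is \<open>k^d\<close> with \<open>d = vdim X v\<close>, and the map along an
  arrow is a matrix acting on column vectors; every finite-dimensional representation is isomorphic
  to one of this form. The values of \<open>vdim\<close> and \<open>amap\<close> away from the vertices and arrows of the
  quiver are irrelevant, and \<open>iso_class\<close> does not see them.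
\<close>

record ('v, 'a, 'k) qrep =
  vdim :: "'v \<Rightarrow> nat"
  amap :: "'a \<Rightarrow> 'k mat"

definition is_rep :: "('v, 'a) pre_digraph \<Rightarrow> ('v, 'a, 'k::field) qrep \<Rightarrow> bool" where
  "is_rep Q X \<longleftrightarrow>
     (\<forall>e\<in>arcs Q. amap X e \<in> carrier_mat (vdim X (head Q e)) (vdim X (tail Q e)))"

definition rep_hom ::
  "('v, 'a) pre_digraph \<Rightarrow> ('v, 'a, 'k::field) qrep \<Rightarrow> ('v, 'a, 'k) qrep \<Rightarrow> ('v \<Rightarrow> 'k mat) set" where
  "rep_hom Q X Y = {f.
     (\<forall>v\<in>verts Q. f v \<in> carrier_mat (vdim Y v) (vdim X v)) \<and>
     (\<forall>e\<in>arcs Q. f (head Q e) * amap X e = amap Y e * f (tail Q e))}"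

definition split_mono ::
  "('v, 'a) pre_digraph \<Rightarrow> ('v, 'a, 'k::field) qrep \<Rightarrow> ('v, 'a, 'k) qrep \<Rightarrow> ('v \<Rightarrow> 'k mat) \<Rightarrow> bool" where
  "split_mono Q X Y f \<longleftrightarrow> f \<in> rep_hom Q X Y \<and>
     (\<exists>g\<in>rep_hom Q Y X. \<forall>v\<in>verts Q. g v * f v = 1\<^sub>m (vdim X v))"

definition split_epi ::
  "('v, 'a) pre_digraph \<Rightarrow> ('v, 'a, 'k::field) qrep \<Rightarrow> ('v, 'a, 'k) qrep \<Rightarrow> ('v \<Rightarrow> 'k mat) \<Rightarrow> bool" where
  "split_epi Q X Y f \<longleftrightarrow> f \<in> rep_hom Q X Y \<and>
     (\<exists>g\<in>rep_hom Q Y X. \<forall>v\<in>verts Q. f v * g v = 1\<^sub>m (vdim Y v))"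

definition rep_iso ::
  "('v, 'a) pre_digraph \<Rightarrow> ('v, 'a, 'k::field) qrep \<Rightarrow> ('v, 'a, 'k) qrep \<Rightarrow> bool" where
  "rep_iso Q X Y \<longleftrightarrow> (\<exists>f\<in>rep_hom Q X Y. \<exists>g\<in>rep_hom Q Y X. \<forall>v\<in>verts Q.
     g v * f v = 1\<^sub>m (vdim X v) \<and> f v * g v = 1\<^sub>m (vdim Y v))"

definition iso_class ::
  "('v, 'a) pre_digraph \<Rightarrow> ('v, 'a, 'k::field) qrep \<Rightarrow> ('v, 'a, 'k) qrep set" where
  "iso_class Q X = {Y. is_rep Q Y \<and> rep_iso Q X Y}"

definition direct_sum :: "('v, 'a, 'k::field) qrep list \<Rightarrow> ('v, 'a, 'k) qrep" where
  "direct_sum Xs =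
     \<lparr>vdim = (\<lambda>v. \<Sum>X\<leftarrow>Xs. vdim X v), amap = (\<lambda>e. diag_block_mat (map (\<lambda>X. amap X e) Xs))\<rparr>"

definition zero_rep :: "('v, 'a) pre_digraph \<Rightarrow> ('v, 'a, 'k::field) qrep \<Rightarrow> bool" where
  "zero_rep Q X \<longleftrightarrow> (\<forall>v\<in>verts Q. vdim X v = 0)"

definition indecomposable :: "('v, 'a) pre_digraph \<Rightarrow> ('v, 'a, 'k::field) qrep \<Rightarrow> bool" where
  "indecomposable Q X \<longleftrightarrow> is_rep Q X \<and> \<not> zero_rep Q X \<and>
     (\<forall>Y Z. is_rep Q Y \<longrightarrow> is_rep Q Z \<longrightarrow> rep_iso Q X (direct_sum [Y, Z]) \<longrightarrow>
        zero_rep Q Y \<or> zero_rep Q Z)"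

definition indec_classes :: "('v, 'a) pre_digraph \<Rightarrow> ('v, 'a, 'k::field) qrep set set" where
  "indec_classes Q = {iso_class Q X | X. indecomposable Q X}"

text \<open>Well defined by the Krull--Schmidt theorem.\<close>

definition multiplicity_in ::
  "('v, 'a) pre_digraph \<Rightarrow> ('v, 'a, 'k::field) qrep \<Rightarrow> ('v, 'a, 'k) qrep set \<Rightarrow> nat" where
  "multiplicity_in Q M = (THE c. \<exists>Xs. (\<forall>X\<in>set Xs. indecomposable Q X) \<and>
     rep_iso Q M (direct_sum Xs) \<and> c = count_list (map (iso_class Q) Xs))"


section \<open>The Auslander--Reiten quiver and translation\<close>

definition irreducible_hom ::
  "('v, 'a) pre_digraph \<Rightarrow> ('v, 'a, 'k::field) qrep \<Rightarrow> ('v, 'a, 'k) qrep \<Rightarrow> ('v \<Rightarrow> 'k mat) \<Rightarrow> bool" where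
  "irreducible_hom Q X Y f \<longleftrightarrow> f \<in> rep_hom Q X Y \<and> \<not> split_mono Q X Y f \<and> \<not> split_epi Q X Y f \<and>
     (\<forall>Z g h. is_rep Q Z \<longrightarrow> h \<in> rep_hom Q X Z \<longrightarrow> g \<in> rep_hom Q Z Y \<longrightarrow>
        (\<forall>v\<in>verts Q. f v = g v * h v) \<longrightarrow> split_mono Q X Z h \<or> split_epi Q Z Y g)"

definition ar_arrow ::
  "('v, 'a) pre_digraph \<Rightarrow> (('v, 'a, 'k::field) qrep set \<times> ('v, 'a, 'k) qrep set) set" where
  "ar_arrow Q = {(iso_class Q X, iso_class Q Y) | X Y.
     indecomposable Q X \<and> indecomposable Q Y \<and> (\<exists>f. irreducible_hom Q X Y f)}"

definition short_exact ::
  "('v, 'a) pre_digraph \<Rightarrow> ('v, 'a, 'k::field) qrep \<Rightarrow> ('v, 'a, 'k) qrep \<Rightarrow> ('v, 'a, 'k) qrep \<Rightarrow>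
     ('v \<Rightarrow> 'k mat) \<Rightarrow> ('v \<Rightarrow> 'k mat) \<Rightarrow> bool" where
  "short_exact Q A B C f g \<longleftrightarrow> f \<in> rep_hom Q A B \<and> g \<in> rep_hom Q B C \<and>
     (\<forall>v\<in>verts Q.
        (\<forall>x\<in>carrier_vec (vdim A v). f v *\<^sub>v x = 0\<^sub>v (vdim B v) \<longrightarrow> x = 0\<^sub>v (vdim A v)) \<and>
        (\<forall>y\<in>carrier_vec (vdim B v).
           g v *\<^sub>v y = 0\<^sub>v (vdim C v) \<longleftrightarrow> (\<exists>x\<in>carrier_vec (vdim A v). y = f v *\<^sub>v x)) \<and>
        (\<forall>z\<in>carrier_vec (vdim C v). \<exists>y\<in>carrier_vec (vdim B v). z = g v *\<^sub>v y))"

definition left_almost_split ::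
  "('v, 'a) pre_digraph \<Rightarrow> ('v, 'a, 'k::field) qrep \<Rightarrow> ('v, 'a, 'k) qrep \<Rightarrow> ('v \<Rightarrow> 'k mat) \<Rightarrow> bool" where
  "left_almost_split Q A B f \<longleftrightarrow> f \<in> rep_hom Q A B \<and> \<not> split_mono Q A B f \<and>
     (\<forall>Y h. is_rep Q Y \<longrightarrow> h \<in> rep_hom Q A Y \<longrightarrow> \<not> split_mono Q A Y h \<longrightarrow>
        (\<exists>h'\<in>rep_hom Q B Y. \<forall>v\<in>verts Q. h v = h' v * f v))"

definition right_almost_split ::
  "('v, 'a) pre_digraph \<Rightarrow> ('v, 'a, 'k::field) qrep \<Rightarrow> ('v, 'a, 'k) qrep \<Rightarrow> ('v \<Rightarrow> 'k mat) \<Rightarrow> bool" where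
  "right_almost_split Q B C g \<longleftrightarrow> g \<in> rep_hom Q B C \<and> \<not> split_epi Q B C g \<and>
     (\<forall>X h. is_rep Q X \<longrightarrow> h \<in> rep_hom Q X C \<longrightarrow> \<not> split_epi Q X C h \<longrightarrow>
        (\<exists>h'\<in>rep_hom Q X B. \<forall>v\<in>verts Q. h v = g v * h' v))"

text \<open>
  The graph of the Auslander--Reiten translation: \<open>(x, y) \<in> ar_translate Q\<close> means \<open>x = \<tau> y\<close>, that is,
  \<open>x\<close> is the left end of the almost split sequence ending in \<open>y\<close>. Projective \<open>y\<close> have no such \<open>x\<close>,
  which is the convention \<open>\<tau> y = 0\<close>.
\<close>

definition ar_translate ::
  "('v, 'a) pre_digraph \<Rightarrow> (('v, 'a, 'k::field) qrep set \<times> ('v, 'a, 'k) qrep set) set" where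
  "ar_translate Q = {(iso_class Q A, iso_class Q C) | A C.
     indecomposable Q A \<and> indecomposable Q C \<and>
     (\<exists>B f g. is_rep Q B \<and> short_exact Q A B C f g \<and>
        left_almost_split Q A B f \<and> right_almost_split Q B C g)}"


section \<open>The poset, toggles, and the map to reverse plane partitions\<close>

definition minuscule_poset ::
  "('v, 'a) pre_digraph \<Rightarrow> 'v \<Rightarrow> ('v, 'a, 'k::field) qrep set set" where
  "minuscule_poset Q m = {iso_class Q X | X. indecomposable Q X \<and> vdim X m \<noteq> 0}"

definition minuscule_category ::
  "('v, 'a) pre_digraph \<Rightarrow> 'v \<Rightarrow> ('v, 'a, 'k::field) qrep set" where
  "minuscule_category Q m = {M. is_rep Q M \<and>
     (\<exists>Xs. (\<forall>X\<in>set Xs. indecomposable Q X \<and> vdim X m \<noteq> 0) \<and> rep_iso Q M (direct_sum Xs))}"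

definition poset_less ::
  "('v, 'a) pre_digraph \<Rightarrow> 'v \<Rightarrow> (('v, 'a, 'k::field) qrep set \<times> ('v, 'a, 'k) qrep set) set" where
  "poset_less Q m = (ar_arrow Q \<inter> minuscule_poset Q m \<times> minuscule_poset Q m)\<^sup>+"

definition covered_by ::
  "('v, 'a) pre_digraph \<Rightarrow> 'v \<Rightarrow> ('v, 'a, 'k::field) qrep set \<Rightarrow> ('v, 'a, 'k) qrep set \<Rightarrow> bool" where
  "covered_by Q m x y \<longleftrightarrow> (x, y) \<in> poset_less Q m \<and>
     \<not> (\<exists>z. (x, z) \<in> poset_less Q m \<and> (z, y) \<in> poset_less Q m)"

definition max_above ::
  "('v, 'a) pre_digraph \<Rightarrow> 'v \<Rightarrow> (('v, 'a, 'k::field) qrep set \<Rightarrow> int) \<Rightarrow> ('v, 'a, 'k) qrep set \<Rightarrow> int" where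
  "max_above Q m \<rho> x = (if \<exists>y. covered_by Q m x y then Max {\<rho> y | y. covered_by Q m x y} else 0)"

definition min_below ::
  "('v, 'a) pre_digraph \<Rightarrow> 'v \<Rightarrow> nat \<Rightarrow> (('v, 'a, 'k::field) qrep set \<Rightarrow> int) \<Rightarrow>
     ('v, 'a, 'k) qrep set \<Rightarrow> int" where
  "min_below Q m N \<rho> x =
     (if \<exists>z. covered_by Q m z x then Min {\<rho> z | z. covered_by Q m z x} else int N)"

definition toggle ::
  "('v, 'a) pre_digraph \<Rightarrow> 'v \<Rightarrow> nat \<Rightarrow> ('v, 'a, 'k::field) qrep set \<Rightarrow>
     (('v, 'a, 'k) qrep set \<Rightarrow> int) \<Rightarrow> ('v, 'a, 'k) qrep set \<Rightarrow> int" where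
  "toggle Q m N x \<rho> = \<rho>(x := max_above Q m \<rho> x + min_below Q m N \<rho> x - \<rho> x)"

definition admissible_listing :: "('v, 'a) pre_digraph \<Rightarrow> ('v, 'a, 'k::field) qrep list \<Rightarrow> bool" where
  "admissible_listing Q Ms \<longleftrightarrow>
     (\<forall>X\<in>set Ms. indecomposable Q X) \<and>
     distinct (map (iso_class Q) Ms) \<and>
     set (map (iso_class Q) Ms) = indec_classes Q \<and>
     (\<forall>i<length Ms. \<forall>j<length Ms.
        (iso_class Q (Ms ! i), iso_class Q (Ms ! j)) \<in> ar_arrow Q \<longrightarrow> j < i)"

definition rho_step ::
  "('v, 'a) pre_digraph \<Rightarrow> 'v \<Rightarrow> nat \<Rightarrow> ('v, 'a, 'k::field) qrep \<Rightarrow> ('v, 'a, 'k) qrep \<Rightarrow>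
     (('v, 'a, 'k) qrep set \<Rightarrow> int) \<Rightarrow> ('v, 'a, 'k) qrep set \<Rightarrow> int" where
  "rho_step Q m N M X \<rho> x =
     (if x = iso_class Q X then max_above Q m \<rho> x + int (multiplicity_in Q M x)
      else if (iso_class Q X, x) \<in> (ar_translate Q)\<^sup>+ then toggle Q m N x \<rho> x
      else \<rho> x)"

text \<open>Only the values on \<open>minuscule_poset Q m\<close> are meaningful.\<close>

definition rho ::
  "('v, 'a) pre_digraph \<Rightarrow> 'v \<Rightarrow> nat \<Rightarrow> ('v, 'a, 'k::field) qrep list \<Rightarrow> ('v, 'a, 'k) qrep \<Rightarrow>
     ('v, 'a, 'k) qrep set \<Rightarrow> int" where
  "rho Q m N Ms M = fold (rho_step Q m N M) Ms (\<lambda>_. 0)"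


section \<open>The linear quiver of type A\<close>

text \<open>The arrow \<open>i\<close> goes from \<open>i + 1\<close> to \<open>i\<close>.\<close>

definition linear_quiver :: "nat \<Rightarrow> (nat, nat) pre_digraph" where
  "linear_quiver n = \<lparr>verts = {1..n}, arcs = {1..<n}, tail = Suc, head = (\<lambda>i. i)\<rparr>"


section \<open>Rectangular diagrams, hooks and rim hooks\<close>

text \<open>Cells are pairs (row, column), counted from 1, with row 1 at the top and column 1 at the left.\<close>

type_synonym cell = "nat \<times> nat"

definition rectangle :: "nat \<Rightarrow> nat \<Rightarrow> cell set" where
  "rectangle R m = {1..R} \<times> {1..m}"

definition hook :: "cell set \<Rightarrow> cell \<Rightarrow> cell set" where
  "hook D u = {v \<in> D. fst v = fst u \<and> snd u \<le> snd v \<or> snd v = snd u \<and> fst u \<le> fst v}"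

text \<open>
  The southeast border of the rectangle with \<open>n + 1 - m\<close> rows and \<open>m\<close> columns: first the bottom row
  from left to right, then the last column from bottom to top.
\<close>

definition border_cell :: "nat \<Rightarrow> nat \<Rightarrow> nat \<Rightarrow> cell" where
  "border_cell n m i = (if i \<le> m then (n + 1 - m, i) else (n + 1 - i, m))"

definition rim_hook :: "nat \<Rightarrow> nat \<Rightarrow> (nat \<Rightarrow> nat) \<Rightarrow> cell set" where
  "rim_hook n m d = {border_cell n m i | i. i \<in> {1..n} \<and> d i = 1}"

definition southwest_end :: "cell set \<Rightarrow> cell \<Rightarrow> bool" where
  "southwest_end S p \<longleftrightarrow> p \<in> S \<and> (\<forall>v\<in>S. fst v \<le> fst p \<and> snd p \<le> snd v)"

definition northeast_end :: "cell set \<Rightarrow> cell \<Rightarrow> bool" where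
  "northeast_end S p \<longleftrightarrow> p \<in> S \<and> (\<forall>v\<in>S. fst p \<le> fst v \<and> snd v \<le> snd p)"

definition same_ends :: "cell set \<Rightarrow> cell set \<Rightarrow> bool" where
  "same_ends S T \<longleftrightarrow> (\<exists>p q. southwest_end S p \<and> southwest_end T p \<and>
     northeast_end S q \<and> northeast_end T q)"

text \<open>The class of the indecomposable \<open>M_u\<close> attached to the cell \<open>u\<close>.\<close>

definition indec_at :: "nat \<Rightarrow> nat \<Rightarrow> cell \<Rightarrow> (nat, nat, 'k::field) qrep set" where
  "indec_at n m u = (THE x. x \<in> minuscule_poset (linear_quiver n) m \<and>
     (\<exists>X\<in>x. same_ends (rim_hook n m (vdim X)) (hook (rectangle (n + 1 - m) m) u)))"

text \<open>
  Going right or up in the diagram, \<open>indec_at\<close> goes up in the poset, so reading off an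
  order-reversing function \<open>\<rho>\<close> at \<open>indec_at\<close> itself gives rows that decrease. Fillings are
  therefore read off after mirroring the columns. This is the identification of the poset with the
  cells for which order-reversing functions become reverse plane partitions, and the
  \<open>\<tau>\<close>-orbit of the projective at vertex \<open>i\<close> becomes the diagonal ending in the border cell \<open>i\<close>.
\<close>

definition filling_of ::
  "nat \<Rightarrow> nat \<Rightarrow> ((nat, nat, 'k::field) qrep set \<Rightarrow> int) \<Rightarrow> cell \<Rightarrow> int" where
  "filling_of n m \<rho> = (\<lambda>(r, c). \<rho> (indec_at n m (r, m + 1 - c)))"


section \<open>The Hillman--Grassl correspondence for rectangles\<close>

text \<open>
  In the direction from arrays to reverse plane partitions. The path removed by the usual algorithm
  starts at the bottom of the leftmost nonzero column \<open>c\<close>, goes north if the entry there is equal and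
  east otherwise, and leaves the diagram at the end of some row \<open>r\<close>; it counts as the hook at \<open>(r, c)\<close>.
  Run backwards, the path of \<open>(r, c)\<close> starts at the end of row \<open>r\<close>, goes south if the entry there is
  equal and west otherwise, until it reaches the bottom of column \<open>c\<close>. Removal produces hooks by
  increasing column, and by decreasing row index within a column, so insertion proceeds in the
  opposite order.
\<close>

inductive_set hg_path :: "nat \<Rightarrow> nat \<Rightarrow> (cell \<Rightarrow> nat) \<Rightarrow> cell \<Rightarrow> cell set"
  for R m :: nat and \<pi> :: "cell \<Rightarrow> nat" and u :: cell where
  start: "(fst u, m) \<in> hg_path R m \<pi> u"
| south: "(i, j) \<in> hg_path R m \<pi> u \<Longrightarrow> i < R \<Longrightarrow> \<pi> (i + 1, j) = \<pi> (i, j) \<Longrightarrow>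
    (i + 1, j) \<in> hg_path R m \<pi> u"
| west: "(i, j) \<in> hg_path R m \<pi> u \<Longrightarrow> \<not> (i < R \<and> \<pi> (i + 1, j) = \<pi> (i, j)) \<Longrightarrow> snd u < j \<Longrightarrow>
    (i, j - 1) \<in> hg_path R m \<pi> u"

definition hg_insert :: "nat \<Rightarrow> nat \<Rightarrow> cell \<Rightarrow> (cell \<Rightarrow> nat) \<Rightarrow> cell \<Rightarrow> nat" where
  "hg_insert R m u \<pi> = (\<lambda>v. if v \<in> hg_path R m \<pi> u then \<pi> v + 1 else \<pi> v)"

definition hg_order :: "nat \<Rightarrow> nat \<Rightarrow> cell list" where
  "hg_order R m = [(r, c). c \<leftarrow> rev [1..<m + 1], r \<leftarrow> [1..<R + 1]]"

definition hillman_grassl :: "nat \<Rightarrow> nat \<Rightarrow> (cell \<Rightarrow> nat) \<Rightarrow> cell \<Rightarrow> nat" where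
  "hillman_grassl R m A = fold (\<lambda>u. hg_insert R m u ^^ A u) (hg_order R m) (\<lambda>_. 0)"

definition HG :: "nat \<Rightarrow> nat \<Rightarrow> (nat, nat, 'k::field) qrep \<Rightarrow> cell \<Rightarrow> nat" where
  "HG n m M = hillman_grassl (n + 1 - m) m
     (\<lambda>u. multiplicity_in (linear_quiver n) M (indec_at n m u))"

end

theory Submission
  imports Defs
begin

text \<open>
  The indecomposables of the linear quiver are the interval representations \<open>ivl a b\<close>, with
  Auslander--Reiten arrows to \<open>ivl (a + 1) b\<close> and \<open>ivl a (b + 1)\<close> and with
  \<open>\<tau> (ivl (a + 1) (b + 1)) = ivl a b\<close>. So the poset is a rectangle, and every admissible listing processes
  each diagonal \<open>b - a = const\<close> downwards in \<open>a\<close>. Multiplicities enter both sides in the same way and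
  need not be computed.

  On the Hillman--Grassl side let \<open>H\<^sub>j\<close> be the filling after inserting the hooks of all columns \<open>\<ge> j\<close>.
  Inserting the hooks of column \<open>j\<close> by increasing row, the paths enter each column of the
  diagram in weakly increasing rows. If \<open>x\<^sub>0\<close> and \<open>x\<close> are the old and the new column, and \<open>N r\<close> and \<open>N' r\<close>
  count the paths that enter and leave it in row \<open>r\<close>, then \<open>x r = max (x (r - 1)) (x\<^sub>0 r) + N r\<close> and
  \<open>N' r = min (x r) (x\<^sub>0 (r + 1)) - x\<^sub>0 r\<close>. Since \<open>N'\<close> is the \<open>N\<close> of the next column to the left, these two
  equations combine to the toggle rule, which therefore computes \<open>H\<^sub>j\<close> from \<open>H\<^bsub>j + 1\<^esub>\<close>.
\<close>

section \<open>Matrices\<close>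

text \<open>A poset element has no fixed cell. While only the columns from \<open>j\<close> on are
  inserted, \<open>(a, b)\<close> is read in row \<open>n + 1 - b\<close> and column
  \<open>m + j - a\<close>; each further column moves it one cell to the left, until at
  \<open>j = 1\<close> it reaches column \<open>m + 1 - a\<close>. This is why the recursion pairs
  \<open>hg_state R m A j (r, c)\<close> with \<open>hg_state R m A (j + 1) (r, c + 1)\<close>. A
  listing is an arbitrary linear extension, so at any time the diagonals are at different stages and
  no single \<open>j\<close> describes a prefix; the induction speaks of each diagonal by itself.
  Toggled elements have \<open>a > 1\<close> and hence a predecessor, so the default
  \<open>N\<close> never enters. The Auslander--Reiten data quantify over all representations. They
  become accessible because \<open>ivl a b\<close> is generated by a vector at \<open>b\<close>
  whose only relation is that it dies at \<open>a - 1\<close>, and dually; whether a map splits or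
  factors is then decided by one linear equation.\<close>

lemma mat_assoc:
  fixes A :: "'a::semiring_0 mat"
  shows "dim_col A = dim_row B \<Longrightarrow> dim_col B = dim_row C \<Longrightarrow> A * B * C = A * (B * C)"
  by (rule assoc_mult_mat[of A "dim_row A" "dim_col A" B "dim_col B" C "dim_col C"]) auto

text \<open>As in the other laws here, the side conditions are equations between dimensions. The
  simplifier discharges these from the dimension facts of morphisms, whereas carrier premises would
  leave parameters to instantiate.\<close>

lemma mat_distrib_right:
  fixes A :: "'a::semiring_0 mat"
  shows "dim_row A = dim_row B \<Longrightarrow> dim_col A = dim_col B \<Longrightarrow> dim_col B = dim_row C \<Longrightarrow>
    (A + B) * C = A * C + B * C"
  by (rule add_mult_distrib_mat[of A "dim_row A" "dim_col A" B C "dim_col C"]) auto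

lemma mat_distrib_left:
  fixes A :: "'a::semiring_0 mat"
  shows "dim_row B = dim_row C \<Longrightarrow> dim_col B = dim_col C \<Longrightarrow> dim_col A = dim_row C \<Longrightarrow>
    A * (B + C) = A * B + A * C"
  by (rule mult_add_distrib_mat[of A "dim_row A" "dim_col A" B "dim_col B" C]) auto

lemma mat_diff_distrib_right:
  fixes A :: "'a::ring mat"
  shows "dim_row A = dim_row B \<Longrightarrow> dim_col A = dim_col B \<Longrightarrow> dim_col B = dim_row C \<Longrightarrow>
    (A - B) * C = A * C - B * C"
  by (rule minus_mult_distrib_mat[of A "dim_row A" "dim_col A" B C "dim_col C"]) auto

lemma mat_diff_distrib_left:
  fixes A :: "'a::ring mat"
  shows "dim_row B = dim_row C \<Longrightarrow> dim_col B = dim_col C \<Longrightarrow> dim_col A = dim_row C \<Longrightarrow>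
    A * (B - C) = A * B - A * C"
  by (rule mult_minus_distrib_mat[of A "dim_row A" "dim_col A" B "dim_col B" C]) auto

text \<open>The product factors through the zero space. Vertices outside the support of an interval
  are handled by this throughout.\<close>

lemma mat_mult_inner_zero: "dim_col A = 0 \<Longrightarrow> dim_row B = 0 \<Longrightarrow> A * B = 0\<^sub>m (dim_row A) (dim_col B)"
  by (rule eq_matI) (auto simp: scalar_prod_def)

lemma mat_add_zero [simp]:
  fixes A :: "'a::monoid_add mat"
  shows "dim_row A = r \<Longrightarrow> dim_col A = c \<Longrightarrow> 0\<^sub>m r c + A = A"
    and "dim_row A = r \<Longrightarrow> dim_col A = c \<Longrightarrow> A + 0\<^sub>m r c = A"
  by (auto simp: mat_eq_iff)

lemma mat_no_rows: "dim_row A = 0 \<Longrightarrow> A = 0\<^sub>m 0 (dim_col A)"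
  by (rule eq_matI) auto

lemma mat_no_cols: "dim_col A = 0 \<Longrightarrow> A = 0\<^sub>m (dim_row A) 0"
  by (rule eq_matI) auto

lemma mat_diff_zero:
  fixes A :: "'a::group_add mat"
  shows "dim_row A = r \<Longrightarrow> dim_col A = c \<Longrightarrow> A - 0\<^sub>m r c = A"
    and "dim_row A = r \<Longrightarrow> dim_col A = c \<Longrightarrow> 0\<^sub>m r c - A = - A"
  by (auto simp: mat_eq_iff)

lemma mat_eq_no_cols: "dim_col A = 0 \<Longrightarrow> dim_col B = 0 \<Longrightarrow> dim_row A = dim_row B \<Longrightarrow> A = B"
  by (rule eq_matI) auto

lemma mat_eq_no_rows: "dim_row A = 0 \<Longrightarrow> dim_row B = 0 \<Longrightarrow> dim_col A = dim_col B \<Longrightarrow> A = B"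
  by (rule eq_matI) auto

lemma one_mat_neq_zero: "0 < n \<Longrightarrow> (1\<^sub>m n :: 'a::zero_neq_one mat) \<noteq> 0\<^sub>m n n"
  by (auto simp: mat_eq_iff)

lemma mult_one_by_one:
  assumes "A \<in> carrier_mat 1 1" "B \<in> carrier_mat 1 1"
  shows "(A * B) $$ (0, 0) = A $$ (0, 0) * (B $$ (0, 0) :: 'a::semiring_0)"
  using assms by (simp add: scalar_prod_def)

lemma eq_one_by_one:
  assumes "A \<in> carrier_mat 1 1" "B \<in> carrier_mat 1 1"
  shows "A = B \<longleftrightarrow> A $$ (0, 0) = B $$ (0, 0)"
  using assms by (auto simp: mat_eq_iff)

text \<open>Applied to a nonzero path map, this supplies the functional and the vector that cut an
  interval out of a representation.\<close>

lemma nonzero_mat_compress_to_one: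
  fixes M :: "'k::field mat"
  assumes M: "M \<in> carrier_mat d k" and nz: "M \<noteq> 0\<^sub>m d k"
  obtains \<phi> y where "\<phi> \<in> carrier_mat 1 d" "y \<in> carrier_mat k 1" "\<phi> * (M * y) = 1\<^sub>m 1"
proof -
  from M nz obtain i j where ij: "i < d" "j < k" "M $$ (i, j) \<noteq> 0"
    by (auto simp: mat_eq_iff)
  let ?\<phi> = "mat 1 d (\<lambda>(_, r). if r = i then 1 else 0) :: 'k mat"
  let ?y = "mat k 1 (\<lambda>(r, _). if r = j then inverse (M $$ (i, j)) else 0)"
  have "?\<phi> * (M * ?y) = 1\<^sub>m 1"
    using M ij by (auto simp: mat_eq_iff scalar_prod_def if_distrib[of "\<lambda>x. _ * x"] if_distrib[of "\<lambda>x. x * _"] cong: if_cong)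
  thus thesis using that[of ?\<phi> ?y] by simp
qed

text \<open>Stated for indexed families so that the induction on the number \<open>k\<close> of
  vectors does not resize matrices. If the functional found for \<open>k\<close> vectors does not
  kill the next one, the induction hypothesis is used a second time, for a corrected target.\<close>

lemma fredholm_alternative_fun:
  fixes d k :: nat and u :: "nat \<Rightarrow> 'k::field" and x :: "nat \<Rightarrow> nat \<Rightarrow> 'k"
  shows "(\<exists>w. \<forall>r<d. u r = (\<Sum>i<k. w i * x i r)) \<or>
    (\<exists>\<phi>. (\<forall>i<k. (\<Sum>r<d. \<phi> r * x i r) = 0) \<and> (\<Sum>r<d. \<phi> r * u r) = 1)"
proof (induction k arbitrary: u)
  case 0
  show ?case
  proof (cases "\<forall>r<d. u r = 0")
    case False
    then obtain r where r: "r < d" "u r \<noteq> 0" by blast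
    have "(\<Sum>s<d. (if s = r then inverse (u r) else 0) * u s) = (\<Sum>s<d. if s = r then inverse (u r) * u s else 0)"
      by (rule sum.cong) auto
    also have "\<dots> = 1" using r by simp
    finally show ?thesis by (intro disjI2 exI[of _ "\<lambda>s. if s = r then inverse (u r) else 0"]) simp
  qed simp
next
  case (Suc k)
  from Suc.IH[of u] show ?case
  proof (elim disjE exE conjE)
    fix w assume "\<forall>r<d. u r = (\<Sum>i<k. w i * x i r)"
    thus ?thesis by (intro disjI1 exI[of _ "w(k := 0)"]) simp
  next
    fix \<phi> assume \<phi>: "\<forall>i<k. (\<Sum>r<d. \<phi> r * x i r) = 0" "(\<Sum>r<d. \<phi> r * u r) = 1"
    define t where "t = (\<Sum>r<d. \<phi> r * x k r)"
    show ?thesis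
    proof (cases "t = 0")
      case True
      thus ?thesis using \<phi> by (intro disjI2 exI[of _ \<phi>]) (auto simp: less_Suc_eq t_def)
    next
      case t: False
      \<comment> \<open>Since \<open>\<phi>\<close> is \<open>1\<close> on \<open>u\<close> and
        \<open>t\<close> on the new vector, it vanishes on \<open>u - x k / t\<close>. A combination
        for this vector gives one for \<open>u\<close>, with coefficient \<open>1 / t\<close> at the
        new vector.\<close>
      from Suc.IH[of "\<lambda>r. u r - x k r / t"] show ?thesis
      proof (elim disjE exE conjE)
        fix w assume "\<forall>r<d. u r - x k r / t = (\<Sum>i<k. w i * x i r)"
        hence "\<forall>r<d. u r = (\<Sum>i<k. w i * x i r) + x k r / t" by (auto simp: diff_eq_eq)
        thus ?thesis by (intro disjI1 exI[of _ "w(k := 1 / t)"]) simp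
      next
        fix \<psi> assume \<psi>: "\<forall>i<k. (\<Sum>r<d. \<psi> r * x i r) = 0" "(\<Sum>r<d. \<psi> r * (u r - x k r / t)) = 1"
        \<comment> \<open>Subtracting \<open>c * \<phi>\<close> makes the functional vanish on the
          new vector and lowers its value on \<open>u\<close> from \<open>1 + c\<close> to
          \<open>1\<close>.\<close>
        define c where "c = (\<Sum>r<d. \<psi> r * x k r) / t"
        define \<chi> where "\<chi> r = \<psi> r - c * \<phi> r" for r
        have \<chi>: "(\<Sum>r<d. \<chi> r * y r) = (\<Sum>r<d. \<psi> r * y r) - c * (\<Sum>r<d. \<phi> r * y r)" for y
          by (simp add: \<chi>_def sum_subtractf left_diff_distrib sum_distrib_left mult.assoc)
        have "(\<Sum>r<d. \<psi> r * u r) - c = 1"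
          using \<psi>(2) by (simp add: c_def right_diff_distrib sum_subtractf sum_divide_distrib)
        hence "(\<Sum>r<d. \<chi> r * u r) = 1" by (simp add: \<chi> \<phi>)
        moreover have "(\<Sum>r<d. \<chi> r * x i r) = 0" if "i < Suc k" for i
          using that t \<phi> \<psi> by (auto simp: \<chi> less_Suc_eq c_def t_def[symmetric])
        ultimately show ?thesis by blast
      qed
    qed
  qed
qed

text \<open>With \<open>A\<close> a path map, a solution \<open>w\<close> lets a morphism factor
  through larger and smaller intervals, while a functional \<open>\<phi>\<close> splits the
  morphism.\<close>

lemma fredholm_alternative:
  fixes A :: "'k::field mat"
  assumes A: "A \<in> carrier_mat d k" and u: "u \<in> carrier_mat d 1"
  shows "(\<exists>w\<in>carrier_mat k 1. A * w = u) \<or> (\<exists>\<phi>\<in>carrier_mat 1 d. \<phi> * A = 0\<^sub>m 1 k \<and> \<phi> * u = 1\<^sub>m 1)"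
  using fredholm_alternative_fun[of d "\<lambda>r. u $$ (r, 0)" "\<lambda>i r. A $$ (r, i)" k]
proof (elim disjE exE conjE)
  fix w assume w: "\<forall>r<d. u $$ (r, 0) = (\<Sum>i<k. w i * A $$ (r, i))"
  have "A * mat k 1 (\<lambda>(i, _). w i) = u"
    using A u w by (auto simp: mat_eq_iff scalar_prod_def mult.commute atLeast0LessThan)
  thus ?thesis by (intro disjI1 bexI[of _ "mat k 1 (\<lambda>(i, _). w i)"]) auto
next
  fix \<phi> assume \<phi>: "\<forall>i<k. (\<Sum>r<d. \<phi> r * A $$ (r, i)) = 0" "(\<Sum>r<d. \<phi> r * u $$ (r, 0)) = 1"
  have "mat 1 d (\<lambda>(_, i). \<phi> i) * A = 0\<^sub>m 1 k" "mat 1 d (\<lambda>(_, i). \<phi> i) * u = 1\<^sub>m 1"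
    using A u \<phi> by (auto simp: mat_eq_iff scalar_prod_def atLeast0LessThan)
  thus ?thesis by (intro disjI2 bexI[of _ "mat 1 d (\<lambda>(_, i). \<phi> i)"]) auto
qed

lemma fredholm_alternative_rows:
  fixes A :: "'k::field mat"
  assumes A: "A \<in> carrier_mat k d" and u: "u \<in> carrier_mat 1 d"
  shows "(\<exists>w\<in>carrier_mat 1 k. w * A = u) \<or> (\<exists>y\<in>carrier_mat d 1. A * y = 0\<^sub>m k 1 \<and> u * y = 1\<^sub>m 1)"
proof -
  have "(\<exists>w\<in>carrier_mat k 1. A\<^sup>T * w = u\<^sup>T) \<or>
      (\<exists>\<phi>\<in>carrier_mat 1 d. \<phi> * A\<^sup>T = 0\<^sub>m 1 k \<and> \<phi> * u\<^sup>T = 1\<^sub>m 1)"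
    using A u by (intro fredholm_alternative) auto
  thus ?thesis
  proof (elim disjE bexE conjE)
    fix w assume w: "w \<in> carrier_mat k 1" "A\<^sup>T * w = u\<^sup>T"
    have "w\<^sup>T * A = u" using transpose_mult[of "A\<^sup>T" d k w 1] A w by simp
    thus ?thesis using w by (intro disjI1 bexI[of _ "w\<^sup>T"]) auto
  next
    fix \<phi> assume \<phi>: "\<phi> \<in> carrier_mat 1 d" "\<phi> * A\<^sup>T = 0\<^sub>m 1 k" "\<phi> * u\<^sup>T = 1\<^sub>m 1"
    have "A * \<phi>\<^sup>T = 0\<^sub>m k 1" using transpose_mult[of \<phi> 1 d "A\<^sup>T" k] A \<phi> by simp
    moreover have "u * \<phi>\<^sup>T = 1\<^sub>m 1" using transpose_mult[of \<phi> 1 d "u\<^sup>T" 1] u \<phi> by simp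
    ultimately show ?thesis using \<phi> by (intro disjI2 bexI[of _ "\<phi>\<^sup>T"]) auto
  qed
qed

text \<open>
  If \<open>P r \<noteq> 0\<close>, the kernel of the row \<open>P\<close> has the basis \<open>e\<^sub>i - (P i / P r) e\<^sub>r\<close> with \<open>i \<noteq> r\<close>; \<open>\<sigma>\<close> enumerates
  these \<open>i\<close>, and \<open>q\<close> is \<open>1 - s p\<close> followed by forgetting the coordinate \<open>r\<close>.
\<close>

lemma split_off_complement:
  fixes p s :: "'k::field mat"
  assumes p: "p \<in> carrier_mat e d" and s: "s \<in> carrier_mat d e" and ps: "p * s = 1\<^sub>m e" and e: "e \<le> 1"
  shows "\<exists>j\<in>carrier_mat d (d - e). \<exists>q\<in>carrier_mat (d - e) d.
    q * j = 1\<^sub>m (d - e) \<and> p * j = 0\<^sub>m e (d - e) \<and> q * s = 0\<^sub>m (d - e) e \<and> s * p + j * q = 1\<^sub>m d"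
proof (cases "e = 0")
  case True
  have "s * p = 0\<^sub>m d d" using mat_mult_inner_zero[of s p] p s True by auto
  thus ?thesis using p s True mat_no_rows[of p] mat_no_cols[of s]
    by (intro bexI[of _ "1\<^sub>m d"]) auto
next
  case False
  with e have [simp]: "e = 1" by simp
  define P where "P i = p $$ (0, i)" for i
  define S where "S i = s $$ (i, 0)" for i
  have PS: "(\<Sum>i<d. P i * S i) = 1"
    using arg_cong[OF ps, of "\<lambda>A. A $$ (0, 0)"] p s by (simp add: scalar_prod_def P_def S_def atLeast0LessThan)
  then obtain r where r: "r < d" "P r \<noteq> 0"
    by (metis (no_types, lifting) lessThan_iff mult_zero_left sum.neutral zero_neq_one)
  define \<sigma> where "\<sigma> k = (if k < r then k else k + 1)" for k
  have \<sigma>: "bij_betw \<sigma> {..<d - 1} ({..<d} - {r})"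
    by (rule bij_betw_byWitness[of _ "\<lambda>i. if i < r then i else i - 1"]) (use r in \<open>auto simp: \<sigma>_def\<close>)
  have sum\<sigma>: "(\<Sum>k<d - 1. f (\<sigma> k)) = (\<Sum>i<d. f i) - f r" for f :: "nat \<Rightarrow> 'k"
    using sum.reindex_bij_betw[OF \<sigma>, of f] r by (simp add: sum_diff1)
  have \<sigma>r: "\<sigma> k \<noteq> r" and \<sigma>d: "k < d - 1 \<Longrightarrow> \<sigma> k < d" for k by (auto simp: \<sigma>_def)
  have \<sigma>inj: "\<sigma> k = \<sigma> l \<longleftrightarrow> k = l" for k l by (auto simp: \<sigma>_def)
  define J where "J i i' = (if i = i' then 1 else if i = r then - P i' / P r else 0)" for i i'
  define K where "K i' i = (if i = i' then 1 else 0) - S i' * P i" for i' i :: nat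
  define j where "j = mat d (d - 1) (\<lambda>(i, k). J i (\<sigma> k))"
  define q where "q = mat (d - 1) d (\<lambda>(k, i). K (\<sigma> k) i)"
  have PJ: "(\<Sum>i<d. P i * J i k) = 0" if "k < d" "k \<noteq> r" for k
  proof -
    have "(\<Sum>i<d. P i * J i k) = (\<Sum>i<d. (if i = k then P k else 0) + (if i = r then - P k else 0))"
      by (rule sum.cong) (use r that in \<open>auto simp: J_def\<close>)
    thus ?thesis using r that by (simp add: sum.distrib)
  qed
  have pj: "p * j = 0\<^sub>m 1 (d - 1)"
    using p PJ[OF \<sigma>d \<sigma>r] by (auto simp: mat_eq_iff scalar_prod_def j_def P_def[symmetric] atLeast0LessThan)
  have "(\<Sum>i<d. K k i * S i) = 0" if "k < d" for k
  proof -
    have "(\<Sum>i<d. K k i * S i) = (\<Sum>i<d. (if i = k then S k else 0) - S k * (P i * S i))"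
      by (rule sum.cong) (auto simp: K_def algebra_simps)
    thus ?thesis using that by (simp add: sum_subtractf sum_distrib_left[symmetric] PS)
  qed
  hence qs: "q * s = 0\<^sub>m (d - 1) 1"
    using s \<sigma>d by (auto simp: mat_eq_iff scalar_prod_def q_def S_def[symmetric] atLeast0LessThan)
  have "(\<Sum>i<d. K (\<sigma> k) i * J i (\<sigma> l)) = (if k = l then 1 else 0)" if "k < d - 1" "l < d - 1" for k l
  proof -
    have "(\<Sum>i<d. K (\<sigma> k) i * J i (\<sigma> l)) =
        (\<Sum>i<d. (if i = \<sigma> k then J i (\<sigma> l) else 0) - S (\<sigma> k) * (P i * J i (\<sigma> l)))"
      by (rule sum.cong) (auto simp: K_def algebra_simps)
    also have "\<dots> = J (\<sigma> k) (\<sigma> l)"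
      using PJ[OF \<sigma>d \<sigma>r] \<sigma>d that by (simp add: sum_subtractf sum_distrib_left[symmetric])
    finally show ?thesis using \<sigma>r \<sigma>inj by (simp add: J_def)
  qed
  hence qj: "q * j = 1\<^sub>m (d - 1)"
    by (auto simp: mat_eq_iff scalar_prod_def q_def j_def atLeast0LessThan)
  have JK: "(\<Sum>k<d - 1. J i (\<sigma> k) * K (\<sigma> k) l) = (if i = l then 1 else 0) - S i * P l"
    if "i < d" "l < d" for i l
  proof -
    have "(\<Sum>k<d - 1. J i (\<sigma> k) * K (\<sigma> k) l) = (\<Sum>k<d. J i k * K k l) - J i r * K r l"
      by (rule sum\<sigma>)
    also have "\<dots> = (if i = l then 1 else 0) - S i * P l"
    proof (cases "i = r")
      case False
      have "(\<Sum>k<d. J i k * K k l) = (\<Sum>k<d. if k = i then K k l else 0)"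
        by (rule sum.cong) (use False in \<open>auto simp: J_def\<close>)
      thus ?thesis using False that by (simp add: J_def K_def)
    next
      case True
      \<comment> \<open>The coefficient \<open>- P k / P r\<close>, extended to
        \<open>k = r\<close>, contributes \<open>- K r l\<close> where the true term is
        \<open>K r l\<close>; the summand \<open>2 * K r l\<close> corrects this. The extended sum
        itself vanishes by \<open>PS\<close>.\<close>
      have "(\<Sum>k<d. J r k * K k l) = (\<Sum>k<d. (if k = r then 2 * K r l else 0) +
          ((if k = l then - P l / P r else 0) + P l / P r * (P k * S k)))"
        by (rule sum.cong) (use r in \<open>auto simp: J_def K_def field_simps\<close>)
      also have "\<dots> = 2 * K r l"
        using r that by (simp add: sum.distrib sum_distrib_left[symmetric] sum_divide_distrib[symmetric] PS)
      finally show ?thesis using True by (simp add: J_def K_def)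
    qed
    finally show ?thesis .
  qed
  have "s * p + j * q = 1\<^sub>m d"
    using p s JK by (auto simp: mat_eq_iff scalar_prod_def j_def q_def S_def[symmetric] P_def[symmetric] atLeast0LessThan)
  thus ?thesis using pj qs qj by (intro bexI[of _ j] bexI[of _ q]) (auto simp: j_def q_def)
qed

section \<open>Representations of a quiver\<close>

lemma rep_homD:
  assumes "f \<in> rep_hom Q X Y"
  shows "v \<in> verts Q \<Longrightarrow> f v \<in> carrier_mat (vdim Y v) (vdim X v)"
    and "v \<in> verts Q \<Longrightarrow> dim_row (f v) = vdim Y v"
    and "v \<in> verts Q \<Longrightarrow> dim_col (f v) = vdim X v"
    and "e \<in> arcs Q \<Longrightarrow> f (head Q e) * amap X e = amap Y e * f (tail Q e)"
  using assms unfolding rep_hom_def by auto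

lemma is_repD:
  assumes "is_rep Q X" and "e \<in> arcs Q"
  shows "amap X e \<in> carrier_mat (vdim X (head Q e)) (vdim X (tail Q e))"
    and "dim_row (amap X e) = vdim X (head Q e)" and "dim_col (amap X e) = vdim X (tail Q e)"
  using assms unfolding is_rep_def by auto

section \<open>The category of representations of a quiver\<close>

context wf_digraph
begin

lemma rep_hom_comp:
  assumes X: "is_rep G X" and Y: "is_rep G Y" and Z: "is_rep G Z"
    and f: "f \<in> rep_hom G X Y" and g: "g \<in> rep_hom G Y Z"
  shows "(\<lambda>v. g v * f v) \<in> rep_hom G X Z"
  unfolding rep_hom_def
proof (intro CollectI conjI ballI)
  fix v assume "v \<in> verts G"
  thus "g v * f v \<in> carrier_mat (vdim Z v) (vdim X v)" using rep_homD[OF f] rep_homD[OF g] by auto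
next
  fix e assume e: "e \<in> arcs G"
  note d = rep_homD(2,3)[OF f head_in_verts[OF e]] rep_homD(2,3)[OF g head_in_verts[OF e]]
    rep_homD(2,3)[OF f tail_in_verts[OF e]] rep_homD(2,3)[OF g tail_in_verts[OF e]]
    is_repD(2,3)[OF X e] is_repD(2,3)[OF Y e] is_repD(2,3)[OF Z e]
  have "g (head G e) * f (head G e) * amap X e = g (head G e) * (amap Y e * f (tail G e))"
    using d by (simp add: mat_assoc rep_homD(4)[OF f e])
  also have "\<dots> = (g (head G e) * amap Y e) * f (tail G e)" using d by (simp add: mat_assoc)
  also have "\<dots> = amap Z e * (g (tail G e) * f (tail G e))"
    using d by (simp add: rep_homD(4)[OF g e] mat_assoc)
  finally show "g (head G e) * f (head G e) * amap X e = amap Z e * (g (tail G e) * f (tail G e))" .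
qed

lemma rep_hom_one:
  assumes X: "is_rep G X"
  shows "(\<lambda>v. 1\<^sub>m (vdim X v)) \<in> rep_hom G X X"
  using is_repD(2,3)[OF X] by (auto simp: rep_hom_def)

lemma rep_hom_zero:
  assumes X: "is_rep G X" and Y: "is_rep G Y"
  shows "(\<lambda>v. 0\<^sub>m (vdim Y v) (vdim X v)) \<in> rep_hom G X Y"
  using is_repD(2,3)[OF X] is_repD(2,3)[OF Y] by (auto simp: rep_hom_def)

lemma rep_hom_add:
  assumes X: "is_rep G X" and Y: "is_rep G Y" and f: "f \<in> rep_hom G X Y" and g: "g \<in> rep_hom G X Y"
  shows "(\<lambda>v. f v + g v) \<in> rep_hom G X Y"
  unfolding rep_hom_def
proof (intro CollectI conjI ballI)
  fix v assume "v \<in> verts G"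
  thus "f v + g v \<in> carrier_mat (vdim Y v) (vdim X v)" using rep_homD[OF f] rep_homD[OF g] by auto
next
  fix e assume e: "e \<in> arcs G"
  note d = rep_homD(2,3)[OF f head_in_verts[OF e]] rep_homD(2,3)[OF g head_in_verts[OF e]]
    rep_homD(2,3)[OF f tail_in_verts[OF e]] rep_homD(2,3)[OF g tail_in_verts[OF e]]
    is_repD(2,3)[OF X e] is_repD(2,3)[OF Y e]
  show "(f (head G e) + g (head G e)) * amap X e = amap Y e * (f (tail G e) + g (tail G e))"
    using d rep_homD(4)[OF f e] rep_homD(4)[OF g e]
    by (simp add: mat_distrib_left mat_distrib_right)
qed

lemma rep_hom_diff:
  assumes X: "is_rep G X" and Y: "is_rep G Y" and f: "f \<in> rep_hom G X Y" and g: "g \<in> rep_hom G X Y"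
  shows "(\<lambda>v. f v - g v) \<in> rep_hom G X Y"
  unfolding rep_hom_def
proof (intro CollectI conjI ballI)
  fix v assume "v \<in> verts G"
  thus "f v - g v \<in> carrier_mat (vdim Y v) (vdim X v)" using rep_homD[OF f] rep_homD[OF g] by auto
next
  fix e assume e: "e \<in> arcs G"
  note d = rep_homD(2,3)[OF f head_in_verts[OF e]] rep_homD(2,3)[OF g head_in_verts[OF e]]
    rep_homD(2,3)[OF f tail_in_verts[OF e]] rep_homD(2,3)[OF g tail_in_verts[OF e]]
    is_repD(2,3)[OF X e] is_repD(2,3)[OF Y e]
  show "(f (head G e) - g (head G e)) * amap X e = amap Y e * (f (tail G e) - g (tail G e))"
    using d rep_homD(4)[OF f e] rep_homD(4)[OF g e]
    by (simp add: mat_diff_distrib_left mat_diff_distrib_right)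
qed


lemma rep_iso_refl:
  assumes "is_rep G X"
  shows "rep_iso G X X"
  unfolding rep_iso_def using rep_hom_one[OF assms]
  by (intro bexI[of _ "\<lambda>v. 1\<^sub>m (vdim X v)"]) auto

lemma rep_iso_sym: "rep_iso G X Y \<Longrightarrow> rep_iso G Y X"
  unfolding rep_iso_def by blast

lemma rep_iso_trans:
  assumes X: "is_rep G X" and Y: "is_rep G Y" and Z: "is_rep G Z"
    and XY: "rep_iso G X Y" and YZ: "rep_iso G Y Z"
  shows "rep_iso G X Z"
proof -
  from XY obtain f g where f: "f \<in> rep_hom G X Y" and g: "g \<in> rep_hom G Y X"
    and fg: "\<And>v. v \<in> verts G \<Longrightarrow> g v * f v = 1\<^sub>m (vdim X v) \<and> f v * g v = 1\<^sub>m (vdim Y v)"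
    unfolding rep_iso_def by blast
  from YZ obtain h k where h: "h \<in> rep_hom G Y Z" and k: "k \<in> rep_hom G Z Y"
    and hk: "\<And>v. v \<in> verts G \<Longrightarrow> k v * h v = 1\<^sub>m (vdim Y v) \<and> h v * k v = 1\<^sub>m (vdim Z v)"
    unfolding rep_iso_def by blast
  have "(g v * k v) * (h v * f v) = 1\<^sub>m (vdim X v) \<and> (h v * f v) * (g v * k v) = 1\<^sub>m (vdim Z v)"
    if v: "v \<in> verts G" for v
  proof -
    note d = rep_homD(2,3)[OF f v] rep_homD(2,3)[OF g v] rep_homD(2,3)[OF h v] rep_homD(2,3)[OF k v]
    have "(g v * k v) * (h v * f v) = g v * ((k v * h v) * f v)"
      "(h v * f v) * (g v * k v) = h v * ((f v * g v) * k v)"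
      using d by (simp_all add: mat_assoc)
    thus ?thesis using fg[OF v] hk[OF v] d by simp
  qed
  thus ?thesis unfolding rep_iso_def
    by (intro bexI[OF _ rep_hom_comp[OF X Y Z f h]] bexI[OF _ rep_hom_comp[OF Z Y X k g]]) simp
qed

lemma iso_class_eq_iff:
  assumes X: "is_rep G X" and Y: "is_rep G Y"
  shows "iso_class G X = iso_class G Y \<longleftrightarrow> rep_iso G X Y"
proof
  assume "iso_class G X = iso_class G Y"
  moreover have "Y \<in> iso_class G Y" using Y rep_iso_refl by (simp add: iso_class_def)
  ultimately have "Y \<in> iso_class G X" by simp
  thus "rep_iso G X Y" by (simp add: iso_class_def)
next
  assume "rep_iso G X Y"
  thus "iso_class G X = iso_class G Y"
    using rep_iso_trans[OF X Y] rep_iso_trans[OF Y X] rep_iso_sym by (fastforce simp: iso_class_def)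
qed

text \<open>If one of the spaces is zero, the identity of the other factors through it.\<close>

lemma rep_iso_zero_iff:
  assumes "rep_iso G X Y" and v: "v \<in> verts G"
  shows "vdim X v = 0 \<longleftrightarrow> vdim Y v = 0"
proof -
  from assms obtain f g where f: "f \<in> rep_hom G X Y" and g: "g \<in> rep_hom G Y X"
    and fg: "g v * f v = 1\<^sub>m (vdim X v) \<and> f v * g v = 1\<^sub>m (vdim Y v)"
    unfolding rep_iso_def by blast
  note d = rep_homD(2,3)[OF f v] rep_homD(2,3)[OF g v]
  show ?thesis
  proof
    assume "vdim X v = 0"
    hence "f v * g v = 0\<^sub>m (vdim Y v) (vdim Y v)" using d mat_mult_inner_zero[of "f v" "g v"] by simp
    thus "vdim Y v = 0" using fg one_mat_neq_zero by fastforce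
  next
    assume "vdim Y v = 0"
    hence "g v * f v = 0\<^sub>m (vdim X v) (vdim X v)" using d mat_mult_inner_zero[of "g v" "f v"] by simp
    thus "vdim X v = 0" using fg one_mat_neq_zero by fastforce
  qed
qed

section \<open>Biproducts and split-off summands\<close>

lemma direct_sum_pair:
  fixes Y Z :: "('a, 'b, 'k::field) qrep"
  assumes "is_rep G Y" "is_rep G Z"
  shows "vdim (direct_sum [Y, Z]) v = vdim Y v + vdim Z v"
    and "e \<in> arcs G \<Longrightarrow> amap (direct_sum [Y, Z]) e =
      four_block_mat (amap Y e) (0\<^sub>m (vdim Y (head G e)) (vdim Z (tail G e)))
        (0\<^sub>m (vdim Z (head G e)) (vdim Y (tail G e))) (amap Z e)"
    and "is_rep G (direct_sum [Y, Z])"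
proof -
  show *: "vdim (direct_sum [Y, Z]) v = vdim Y v + vdim Z v" for v by (simp add: direct_sum_def)
  show **: "amap (direct_sum [Y, Z]) e =
      four_block_mat (amap Y e) (0\<^sub>m (vdim Y (head G e)) (vdim Z (tail G e)))
        (0\<^sub>m (vdim Z (head G e)) (vdim Y (tail G e))) (amap Z e)" if "e \<in> arcs G" for e
    using is_repD[OF assms(1) that] is_repD[OF assms(2) that]
    by (auto simp: direct_sum_def Let_def mat_eq_iff)
  show "is_rep G (direct_sum [Y, Z])"
    using assms by (auto simp: is_rep_def * ** is_repD)
qed

text \<open>Later arguments about direct sums use only these maps and the dimensions; the block
  matrices do not come back.\<close>

lemma direct_sum_biproduct:
  fixes Y Z :: "('a, 'b, 'k::field) qrep"
  assumes Y: "is_rep G Y" and Z: "is_rep G Z"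
  obtains i1 i2 p1 p2 where "i1 \<in> rep_hom G Y (direct_sum [Y, Z])" "i2 \<in> rep_hom G Z (direct_sum [Y, Z])"
    "p1 \<in> rep_hom G (direct_sum [Y, Z]) Y" "p2 \<in> rep_hom G (direct_sum [Y, Z]) Z"
    "\<And>v. v \<in> verts G \<Longrightarrow> p1 v * i1 v = 1\<^sub>m (vdim Y v)"
    "\<And>v. v \<in> verts G \<Longrightarrow> p2 v * i2 v = 1\<^sub>m (vdim Z v)"
    "\<And>v. v \<in> verts G \<Longrightarrow> p1 v * i2 v = 0\<^sub>m (vdim Y v) (vdim Z v)"
    "\<And>v. v \<in> verts G \<Longrightarrow> p2 v * i1 v = 0\<^sub>m (vdim Z v) (vdim Y v)"
    "\<And>v. v \<in> verts G \<Longrightarrow> i1 v * p1 v + i2 v * p2 v = 1\<^sub>m (vdim Y v + vdim Z v)"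
proof -
  note ds = direct_sum_pair[OF Y Z]
  define i1 :: "'a \<Rightarrow> 'k mat" where "i1 v = mat (vdim Y v + vdim Z v) (vdim Y v) (\<lambda>(r, c). if r = c then 1 else 0)" for v
  define i2 :: "'a \<Rightarrow> 'k mat" where "i2 v = mat (vdim Y v + vdim Z v) (vdim Z v) (\<lambda>(r, c). if r = vdim Y v + c then 1 else 0)" for v
  define p1 :: "'a \<Rightarrow> 'k mat" where "p1 v = mat (vdim Y v) (vdim Y v + vdim Z v) (\<lambda>(r, c). if r = c then 1 else 0)" for v
  define p2 :: "'a \<Rightarrow> 'k mat" where "p2 v = mat (vdim Z v) (vdim Y v + vdim Z v) (\<lambda>(r, c). if c = vdim Y v + r then 1 else 0)" for v
  have delta: "(\<Sum>k = 0..<n. (if k = i then a else 0) * f k) = (if i < n then a * f i else 0)"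
    "(\<Sum>k = 0..<n. (if i = k then a else 0) * f k) = (if i < n then a * f i else 0)"
    "(\<Sum>k = 0..<n. f k * (if k = i then a else 0)) = (if i < n then f i * a else 0)"
    "(\<Sum>k = 0..<n. f k * (if i = k then a else 0)) = (if i < n then f i * a else 0)"
    for n i :: nat and a :: 'k and f :: "nat \<Rightarrow> 'k"
    by (simp_all add: if_distrib[of "\<lambda>x. x * _"] if_distrib[of "\<lambda>x. _ * x"] cong: if_cong)
  have delta2: "(\<Sum>k = 0..<n. (if i = s + k then a else 0) * f k) = (if s \<le> i \<and> i < s + n then a * f (i - s) else 0)"
    "(\<Sum>k = 0..<n. f k * (if i = s + k then a else 0)) = (if s \<le> i \<and> i < s + n then f (i - s) * a else 0)"
    for n i s :: nat and a :: 'k and f :: "nat \<Rightarrow> 'k"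
  proof -
    have eq: "i = s + k \<longleftrightarrow> s \<le> i \<and> k = i - s" for k by auto
    show "(\<Sum>k = 0..<n. (if i = s + k then a else 0) * f k) = (if s \<le> i \<and> i < s + n then a * f (i - s) else 0)"
      "(\<Sum>k = 0..<n. f k * (if i = s + k then a else 0)) = (if s \<le> i \<and> i < s + n then f (i - s) * a else 0)"
      unfolding eq by (cases "s \<le> i"; auto simp: delta)+
  qed
  note simps = mat_eq_iff scalar_prod_def i1_def i2_def p1_def p2_def delta delta2
  show thesis
  proof (rule that[of i1 i2 p1 p2])
    show "i1 \<in> rep_hom G Y (direct_sum [Y, Z])"
      using is_repD[OF Y] is_repD[OF Z] by (auto simp: rep_hom_def ds simps)
    show "i2 \<in> rep_hom G Z (direct_sum [Y, Z])"
      using is_repD[OF Y] is_repD[OF Z] by (auto simp: rep_hom_def ds simps)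
    show "p1 \<in> rep_hom G (direct_sum [Y, Z]) Y"
      using is_repD[OF Y] is_repD[OF Z] by (auto simp: rep_hom_def ds simps)
    show "p2 \<in> rep_hom G (direct_sum [Y, Z]) Z"
      using is_repD[OF Y] is_repD[OF Z] by (auto simp: rep_hom_def ds simps)
  qed (auto simp: simps)
qed

text \<open>The kernels of \<open>p\<close> form a subrepresentation \<open>Z\<close> complementary
  to the image of \<open>s\<close>, so \<open>X\<close> is isomorphic to
  \<open>direct_sum [I, Z]\<close>, and indecomposability makes \<open>Z\<close> zero. The bound on
  the dimensions of \<open>I\<close> is the one under which \<open>split_off_complement\<close>
  provides the coordinates.\<close>

lemma indecomposable_iso_retract:
  fixes X I :: "('a, 'b, 'k::field) qrep"
  assumes X: "indecomposable G X" and I: "is_rep G I" "\<not> zero_rep G I"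
    and dim: "\<And>v. v \<in> verts G \<Longrightarrow> vdim I v \<le> 1"
    and p: "p \<in> rep_hom G X I" and s: "s \<in> rep_hom G I X"
    and ps: "\<And>v. v \<in> verts G \<Longrightarrow> p v * s v = 1\<^sub>m (vdim I v)"
  shows "rep_iso G X I"
proof -
  have Xr: "is_rep G X" using X by (simp add: indecomposable_def)
  have "\<forall>v\<in>verts G. \<exists>j q. j \<in> carrier_mat (vdim X v) (vdim X v - vdim I v) \<and>
      q \<in> carrier_mat (vdim X v - vdim I v) (vdim X v) \<and> q * j = 1\<^sub>m (vdim X v - vdim I v) \<and>
      p v * j = 0\<^sub>m (vdim I v) (vdim X v - vdim I v) \<and>
      q * s v = 0\<^sub>m (vdim X v - vdim I v) (vdim I v) \<and> s v * p v + j * q = 1\<^sub>m (vdim X v)"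
    using split_off_complement[OF rep_homD(1)[OF p] rep_homD(1)[OF s] ps dim] by blast
  then obtain j q where jq: "\<And>v. v \<in> verts G \<Longrightarrow> j v \<in> carrier_mat (vdim X v) (vdim X v - vdim I v) \<and>
      q v \<in> carrier_mat (vdim X v - vdim I v) (vdim X v) \<and> q v * j v = 1\<^sub>m (vdim X v - vdim I v) \<and>
      p v * j v = 0\<^sub>m (vdim I v) (vdim X v - vdim I v) \<and>
      q v * s v = 0\<^sub>m (vdim X v - vdim I v) (vdim I v) \<and> s v * p v + j v * q v = 1\<^sub>m (vdim X v)"
    by metis
  \<comment> \<open>The kernel of \<open>p\<close> in the coordinates given by \<open>j\<close>: the
    structure map is that of \<open>X\<close>, restricted along \<open>j\<close> and read back by
    \<open>q\<close>.\<close>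
  define Z :: "('a, 'b, 'k) qrep" where "Z = \<lparr>vdim = (\<lambda>v. vdim X v - vdim I v),
     amap = (\<lambda>e. q (head G e) * (amap X e * j (tail G e)))\<rparr>"
  have Zv: "vdim Z v = vdim X v - vdim I v" for v by (simp add: Z_def)
  have Za: "amap Z e = q (head G e) * (amap X e * j (tail G e))" for e by (simp add: Z_def)
  have dj: "dim_row (j v) = vdim X v" "dim_col (j v) = vdim Z v"
    "dim_row (q v) = vdim Z v" "dim_col (q v) = vdim X v" if "v \<in> verts G" for v
    using jq[OF that] by (auto simp: Zv)
  have qj: "q v * j v = 1\<^sub>m (vdim Z v)" "p v * j v = 0\<^sub>m (vdim I v) (vdim Z v)"
    "q v * s v = 0\<^sub>m (vdim Z v) (vdim I v)" "s v * p v + j v * q v = 1\<^sub>m (vdim X v)" if "v \<in> verts G" for v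
    using jq[OF that] by (auto simp: Zv)
  have Zr: "is_rep G Z" unfolding is_rep_def
    using is_repD[OF Xr] dj head_in_verts tail_in_verts by (auto simp: Za intro!: carrier_matI)
  have q_hom: "q \<in> rep_hom G X Z" unfolding rep_hom_def
  proof (intro CollectI conjI ballI)
    fix v assume "v \<in> verts G"
    thus "q v \<in> carrier_mat (vdim Z v) (vdim X v)" using dj by auto
  next
    fix e assume e: "e \<in> arcs G"
    let ?h = "head G e" and ?t = "tail G e"
    note h = head_in_verts[OF e] and t = tail_in_verts[OF e]
    note d = dj[OF h] dj[OF t] is_repD(2,3)[OF Xr e] is_repD(2,3)[OF I(1) e]
      rep_homD(2,3)[OF p h] rep_homD(2,3)[OF s h] rep_homD(2,3)[OF p t] rep_homD(2,3)[OF s t]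
    \<comment> \<open>Insert the identity \<open>s p + j q\<close> at the tail; the part through
      \<open>s\<close> moves along the arrow and is then killed by \<open>q\<close>. For
      \<open>j\<close> the identity is inserted at the head instead.\<close>
    have "q ?h * amap X e = q ?h * (amap X e * (s ?t * p ?t + j ?t * q ?t))"
      using d qj(4)[OF t] by simp
    also have "\<dots> = q ?h * (amap X e * (s ?t * p ?t)) + amap Z e * q ?t"
      using d by (simp add: mat_distrib_left Za mat_assoc)
    also have "amap X e * (s ?t * p ?t) = s ?h * (amap I e * p ?t)"
      using d rep_homD(4)[OF s e] by (simp add: mat_assoc[symmetric])
    also have "q ?h * (s ?h * (amap I e * p ?t)) = 0\<^sub>m (vdim Z ?h) (vdim X ?t)"
      using d qj(3)[OF h] by (simp add: mat_assoc[symmetric])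
    finally show "q ?h * amap X e = amap Z e * q ?t" using d by (simp add: Za)
  qed
  have j_hom: "j \<in> rep_hom G Z X" unfolding rep_hom_def
  proof (intro CollectI conjI ballI)
    fix v assume "v \<in> verts G"
    thus "j v \<in> carrier_mat (vdim X v) (vdim Z v)" using dj by auto
  next
    fix e assume e: "e \<in> arcs G"
    let ?h = "head G e" and ?t = "tail G e"
    note h = head_in_verts[OF e] and t = tail_in_verts[OF e]
    note d = dj[OF h] dj[OF t] is_repD(2,3)[OF Xr e] is_repD(2,3)[OF I(1) e]
      rep_homD(2,3)[OF p h] rep_homD(2,3)[OF s h] rep_homD(2,3)[OF p t] rep_homD(2,3)[OF s t]
    have "amap X e * j ?t = (s ?h * p ?h + j ?h * q ?h) * (amap X e * j ?t)"
      using d qj(4)[OF h] by simp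
    also have "\<dots> = s ?h * (p ?h * amap X e * j ?t) + j ?h * amap Z e"
      using d by (simp add: mat_distrib_right Za mat_assoc)
    also have "p ?h * amap X e * j ?t = 0\<^sub>m (vdim I ?h) (vdim Z ?t)"
      using d rep_homD(4)[OF p e] qj(2)[OF t] by (simp add: mat_assoc)
    finally show "j ?h * amap Z e = amap X e * j ?t" using d by (simp add: Za)
  qed
  obtain i1 i2 p1 p2 where b: "i1 \<in> rep_hom G I (direct_sum [I, Z])" "i2 \<in> rep_hom G Z (direct_sum [I, Z])"
    "p1 \<in> rep_hom G (direct_sum [I, Z]) I" "p2 \<in> rep_hom G (direct_sum [I, Z]) Z"
    and b2: "\<And>v. v \<in> verts G \<Longrightarrow> p1 v * i1 v = 1\<^sub>m (vdim I v)"
    "\<And>v. v \<in> verts G \<Longrightarrow> p2 v * i2 v = 1\<^sub>m (vdim Z v)"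
    "\<And>v. v \<in> verts G \<Longrightarrow> p1 v * i2 v = 0\<^sub>m (vdim I v) (vdim Z v)"
    "\<And>v. v \<in> verts G \<Longrightarrow> p2 v * i1 v = 0\<^sub>m (vdim Z v) (vdim I v)"
    "\<And>v. v \<in> verts G \<Longrightarrow> i1 v * p1 v + i2 v * p2 v = 1\<^sub>m (vdim I v + vdim Z v)"
    by (rule direct_sum_biproduct[OF I(1) Zr]) blast
  let ?D = "direct_sum [I, Z]"
  have D: "is_rep G ?D" "\<And>v. vdim ?D v = vdim I v + vdim Z v" using direct_sum_pair[OF I(1) Zr] by auto
  let ?f = "\<lambda>v. i1 v * p v + i2 v * q v" and ?g = "\<lambda>v. s v * p1 v + j v * p2 v"
  have fh: "?f \<in> rep_hom G X ?D"
    by (rule rep_hom_add[OF Xr D(1) rep_hom_comp[OF Xr I(1) D(1) p b(1)] rep_hom_comp[OF Xr Zr D(1) q_hom b(2)]])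
  have gh: "?g \<in> rep_hom G ?D X"
    by (rule rep_hom_add[OF D(1) Xr rep_hom_comp[OF D(1) I(1) Xr b(3) s] rep_hom_comp[OF D(1) Zr Xr b(4) j_hom]])
  have "?g v * ?f v = 1\<^sub>m (vdim X v) \<and> ?f v * ?g v = 1\<^sub>m (vdim ?D v)" if v: "v \<in> verts G" for v
  proof -
    note d = dj[OF v] rep_homD(2,3)[OF p v] rep_homD(2,3)[OF s v] rep_homD(2,3)[OF b(1) v]
      rep_homD(2,3)[OF b(2) v] rep_homD(2,3)[OF b(3) v] rep_homD(2,3)[OF b(4) v] D(2)[of v]
    have c: "p1 v * (i1 v * A) = A" "p1 v * (i2 v * B) = 0\<^sub>m (vdim I v) (dim_col B)"
      "p2 v * (i1 v * A) = 0\<^sub>m (vdim Z v) (dim_col A)" "p2 v * (i2 v * B) = B"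
      "p v * (s v * A) = A" "p v * (j v * B) = 0\<^sub>m (vdim I v) (dim_col B)"
      "q v * (s v * A) = 0\<^sub>m (vdim Z v) (dim_col A)" "q v * (j v * B) = B"
      if "dim_row A = vdim I v" "dim_row B = vdim Z v" for A B :: "'k mat"
      using that d b2[OF v] ps[OF v] qj[OF v] by (simp_all add: mat_assoc[symmetric])
    have "?g v * ?f v = s v * p v + j v * q v"
      using d by (simp add: mat_distrib_left mat_distrib_right mat_assoc c)
    moreover have "?f v * ?g v = i1 v * p1 v + i2 v * p2 v"
      using d by (simp add: mat_distrib_left mat_distrib_right mat_assoc c)
    ultimately show ?thesis using qj(4)[OF v] b2(5)[OF v] D by simp
  qed
  hence "rep_iso G X ?D" unfolding rep_iso_def by (intro bexI[OF _ fh] bexI[OF _ gh]) simp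
  hence "zero_rep G Z" using X I Zr by (auto simp: indecomposable_def)
  hence "s v * p v = 1\<^sub>m (vdim X v)" if v: "v \<in> verts G" for v
  proof -
    have "j v * q v = 0\<^sub>m (vdim X v) (vdim X v)"
      using \<open>zero_rep G Z\<close> v dj[OF v] mat_mult_inner_zero[of "j v" "q v"] by (simp add: zero_rep_def)
    thus ?thesis using qj(4)[OF v] rep_homD(2,3)[OF p v] rep_homD(2,3)[OF s v] by simp
  qed
  thus ?thesis unfolding rep_iso_def using p s ps by blast
qed

end

section \<open>Explicit inverses and exactness vertex by vertex\<close>

definition rep_inverse ::
  "('v, 'a) pre_digraph \<Rightarrow> ('v, 'a, 'k::field) qrep \<Rightarrow> ('v, 'a, 'k) qrep \<Rightarrow> ('v \<Rightarrow> 'k mat) \<Rightarrow> ('v \<Rightarrow> 'k mat) \<Rightarrow> bool" where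
  "rep_inverse Q X Y f g \<longleftrightarrow> f \<in> rep_hom Q X Y \<and> g \<in> rep_hom Q Y X \<and>
     (\<forall>v\<in>verts Q. g v * f v = 1\<^sub>m (vdim X v) \<and> f v * g v = 1\<^sub>m (vdim Y v))"

lemma rep_iso_inverse: "rep_iso Q X Y \<longleftrightarrow> (\<exists>f g. rep_inverse Q X Y f g)"
  by (auto simp: rep_iso_def rep_inverse_def)

lemma rep_inverse_sym: "rep_inverse Q X Y f g \<longleftrightarrow> rep_inverse Q Y X g f"
  by (auto simp: rep_inverse_def)

lemma rep_inverseD:
  assumes "rep_inverse Q X Y f g"
  shows "f \<in> rep_hom Q X Y" "g \<in> rep_hom Q Y X"
    and "v \<in> verts Q \<Longrightarrow> g v * f v = 1\<^sub>m (vdim X v)"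
    and "v \<in> verts Q \<Longrightarrow> f v * g v = 1\<^sub>m (vdim Y v)"
    and "v \<in> verts Q \<Longrightarrow> dim_row M = vdim X v \<Longrightarrow> g v * (f v * M) = M"
    and "v \<in> verts Q \<Longrightarrow> dim_row M = vdim Y v \<Longrightarrow> f v * (g v * M) = M"
proof -
  show f: "f \<in> rep_hom Q X Y" and g: "g \<in> rep_hom Q Y X"
    and 1: "v \<in> verts Q \<Longrightarrow> g v * f v = 1\<^sub>m (vdim X v)"
    and 2: "v \<in> verts Q \<Longrightarrow> f v * g v = 1\<^sub>m (vdim Y v)"
    using assms by (auto simp: rep_inverse_def)
  show "g v * (f v * M) = M" if v: "v \<in> verts Q" and "dim_row M = vdim X v"
    using that 1[OF v] rep_homD(2,3)[OF f v] rep_homD(2,3)[OF g v] by (simp add: mat_assoc[symmetric])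
  show "f v * (g v * M) = M" if v: "v \<in> verts Q" and "dim_row M = vdim Y v"
    using that 2[OF v] rep_homD(2,3)[OF f v] rep_homD(2,3)[OF g v] by (simp add: mat_assoc[symmetric])
qed

text \<open>Exactness at one vertex, with one-column matrices in place of vectors, so that later
  arguments stay within one matrix calculus. That the image lies in the kernel is the equation
  \<open>g * f = 0\<^sub>m c a\<close>.\<close>

definition mat_exact :: "nat \<Rightarrow> nat \<Rightarrow> nat \<Rightarrow> 'k::field mat \<Rightarrow> 'k mat \<Rightarrow> bool" where
  "mat_exact a b c f g \<longleftrightarrow> f \<in> carrier_mat b a \<and> g \<in> carrier_mat c b \<and> g * f = 0\<^sub>m c a \<and>
     (\<forall>x\<in>carrier_mat a 1. f * x = 0\<^sub>m b 1 \<longrightarrow> x = 0\<^sub>m a 1) \<and>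
     (\<forall>y\<in>carrier_mat b 1. g * y = 0\<^sub>m c 1 \<longrightarrow> (\<exists>x\<in>carrier_mat a 1. y = f * x)) \<and>
     (\<forall>z\<in>carrier_mat c 1. \<exists>y\<in>carrier_mat b 1. g * y = z)"

lemma single_column_eqI:
  assumes "A \<in> carrier_mat d 1" "B \<in> carrier_mat d 1" "col A 0 = col B 0"
  shows "A = B"
  by (rule mat_col_eqI) (use assms in auto)

lemma short_exact_mat:
  fixes A B C :: "('v, 'a, 'k::field) qrep"
  assumes se: "short_exact Q A B C f g" and v: "v \<in> verts Q"
  shows "mat_exact (vdim A v) (vdim B v) (vdim C v) (f v) (g v)"
proof -
  have f: "f \<in> rep_hom Q A B" and g: "g \<in> rep_hom Q B C" using se by (auto simp: short_exact_def)
  note fc = rep_homD(1)[OF f v] and gc = rep_homD(1)[OF g v]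
  have e1: "\<And>x. x \<in> carrier_vec (vdim A v) \<Longrightarrow> f v *\<^sub>v x = 0\<^sub>v (vdim B v) \<Longrightarrow> x = 0\<^sub>v (vdim A v)"
    and e2: "\<And>y. y \<in> carrier_vec (vdim B v) \<Longrightarrow>
      g v *\<^sub>v y = 0\<^sub>v (vdim C v) \<longleftrightarrow> (\<exists>x\<in>carrier_vec (vdim A v). y = f v *\<^sub>v x)"
    and e3: "\<And>z. z \<in> carrier_vec (vdim C v) \<Longrightarrow> \<exists>y\<in>carrier_vec (vdim B v). z = g v *\<^sub>v y"
    using se v unfolding short_exact_def by blast+
  have col: "col (M * x) 0 = M *\<^sub>v col x 0" if "M \<in> carrier_mat c d" "x \<in> carrier_mat d 1" for M x :: "'k mat" and c d
    using that by (intro col_mult2[of _ _ _ _ 1]) auto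
  have colc: "col x 0 \<in> carrier_vec d" if "x \<in> carrier_mat d 1" for x :: "'k mat" and d
    by (rule carrier_vecI) (use that in simp)
  have colz: "col (0\<^sub>m d 1) 0 = (0\<^sub>v d :: 'k vec)" for d by auto
  have col1: "col (mat_of_cols d [x]) 0 = x" "mat_of_cols d [x] \<in> carrier_mat d 1" if "x \<in> carrier_vec d" for x :: "'k vec" and d
    using that by (auto intro!: col_mat_of_cols[of 0 "[x]" d, simplified] simp: mat_of_cols_def)
  show ?thesis unfolding mat_exact_def
  proof (intro conjI ballI impI)
    show "f v \<in> carrier_mat (vdim B v) (vdim A v)" "g v \<in> carrier_mat (vdim C v) (vdim B v)" by fact+
    show "g v * f v = 0\<^sub>m (vdim C v) (vdim A v)"
    proof (rule mat_col_eqI)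
      fix i assume i: "i < dim_col (0\<^sub>m (vdim C v) (vdim A v) :: 'k mat)"
      have "col (g v * f v) i = g v *\<^sub>v col (f v) i"
        using fc gc i by (intro col_mult2[of _ _ _ _ "vdim A v"]) auto
      \<comment> \<open>A column of \<open>f v\<close> is the image of a unit vector, so exactness
        says that \<open>g v\<close> kills it.\<close>
      moreover have "col (f v) i = f v *\<^sub>v unit_vec (vdim A v) i" using col_mult2[OF fc one_carrier_mat, of i] fc i by simp
      hence "g v *\<^sub>v col (f v) i = 0\<^sub>v (vdim C v)" using e2[of "col (f v) i"] fc i by fastforce
      ultimately show "col (g v * f v) i = col (0\<^sub>m (vdim C v) (vdim A v)) i" using i by auto
    qed (use fc gc in auto)
  next
    fix x assume x: "x \<in> carrier_mat (vdim A v) 1" "f v * x = 0\<^sub>m (vdim B v) 1"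
    hence "col x 0 = 0\<^sub>v (vdim A v)" using e1[OF colc[OF x(1)]] col[OF fc x(1)] colz x(2) by simp
    thus "x = 0\<^sub>m (vdim A v) 1" using x(1) colz by (intro single_column_eqI) auto
  next
    fix y assume y: "y \<in> carrier_mat (vdim B v) 1" "g v * y = 0\<^sub>m (vdim C v) 1"
    then obtain x where x: "x \<in> carrier_vec (vdim A v)" "col y 0 = f v *\<^sub>v x"
      using e2[OF colc[OF y(1)]] col[OF gc y(1)] colz y(2) by auto
    have "y = f v * mat_of_cols (vdim A v) [x]"
      using fc y(1) x col[OF fc col1(2)[OF x(1)]] col1[OF x(1)] by (intro single_column_eqI[OF y(1)]) auto
    thus "\<exists>x\<in>carrier_mat (vdim A v) 1. y = f v * x" using col1(2)[OF x(1)] by blast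
  next
    fix z :: "'k mat" assume z: "z \<in> carrier_mat (vdim C v) 1"
    then obtain y where y: "y \<in> carrier_vec (vdim B v)" "col z 0 = g v *\<^sub>v y" using e3[OF colc[OF z]] by auto
    have "g v * mat_of_cols (vdim B v) [y] = z"
      using gc z y col[OF gc col1(2)[OF y(1)]] col1[OF y(1)] by (intro single_column_eqI[OF _ z]) auto
    thus "\<exists>y\<in>carrier_mat (vdim B v) 1. g v * y = z" using col1(2)[OF y(1)] by blast
  qed
qed

lemma mat_exact_iso:
  fixes f g \<alpha> \<alpha>' \<gamma> \<gamma>' :: "'k::field mat"
  assumes ex: "mat_exact a b c f g"
    and \<alpha>: "\<alpha> \<in> carrier_mat a a'" "\<alpha>' \<in> carrier_mat a' a" "\<alpha>' * \<alpha> = 1\<^sub>m a'" "\<alpha> * \<alpha>' = 1\<^sub>m a"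
    and \<gamma>: "\<gamma> \<in> carrier_mat c' c" "\<gamma>' \<in> carrier_mat c c'" "\<gamma>' * \<gamma> = 1\<^sub>m c" "\<gamma> * \<gamma>' = 1\<^sub>m c'"
  shows "mat_exact a' b c' (f * \<alpha>) (\<gamma> * g)"
proof -
  have f: "f \<in> carrier_mat b a" and g: "g \<in> carrier_mat c b" and gf: "g * f = 0\<^sub>m c a"
    and e1: "\<And>x. x \<in> carrier_mat a 1 \<Longrightarrow> f * x = 0\<^sub>m b 1 \<Longrightarrow> x = 0\<^sub>m a 1"
    and e2: "\<And>y. y \<in> carrier_mat b 1 \<Longrightarrow> g * y = 0\<^sub>m c 1 \<Longrightarrow> \<exists>x\<in>carrier_mat a 1. y = f * x"
    and e3: "\<And>z. z \<in> carrier_mat c 1 \<Longrightarrow> \<exists>y\<in>carrier_mat b 1. g * y = z"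
    using ex unfolding mat_exact_def by blast+
  have c: "\<alpha> * (\<alpha>' * x) = x" "\<gamma>' * (\<gamma> * z) = z" if "dim_row x = a" "dim_row z = c" for x z :: "'k mat"
    using that \<alpha> \<gamma> by (simp_all add: mat_assoc[symmetric])
  have c': "\<alpha>' * (\<alpha> * x) = x" "\<gamma> * (\<gamma>' * z) = z" if "dim_row x = a'" "dim_row z = c'" for x z :: "'k mat"
    using that \<alpha> \<gamma> by (simp_all add: mat_assoc[symmetric])
  show ?thesis unfolding mat_exact_def
  proof (intro conjI ballI impI)
    show "f * \<alpha> \<in> carrier_mat b a'" "\<gamma> * g \<in> carrier_mat c' b" using f g \<alpha> \<gamma> by auto
    have "(\<gamma> * g) * (f * \<alpha>) = \<gamma> * ((g * f) * \<alpha>)" using f g \<alpha> \<gamma> by (simp add: mat_assoc)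
    thus "(\<gamma> * g) * (f * \<alpha>) = 0\<^sub>m c' a'" using gf \<alpha> \<gamma> by simp
  next
    fix x assume x: "x \<in> carrier_mat a' 1" "f * \<alpha> * x = 0\<^sub>m b 1"
    have "\<alpha> * x = 0\<^sub>m a 1" using x f \<alpha> by (intro e1) (auto simp: mat_assoc)
    hence "\<alpha>' * (\<alpha> * x) = 0\<^sub>m a' 1" using \<alpha> by simp
    thus "x = 0\<^sub>m a' 1" using c'(1)[of x "0\<^sub>m c' 1"] x by simp
  next
    fix y assume y: "y \<in> carrier_mat b 1" "\<gamma> * g * y = 0\<^sub>m c' 1"
    have "\<gamma> * (g * y) = 0\<^sub>m c' 1" using y g \<gamma> by (simp add: mat_assoc)
    hence "\<gamma>' * (\<gamma> * (g * y)) = 0\<^sub>m c 1" using \<gamma> by simp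
    hence "g * y = 0\<^sub>m c 1" using c(2)[of "0\<^sub>m a 1" "g * y"] g y by simp
    then obtain x where x: "x \<in> carrier_mat a 1" "y = f * x" using e2 y by blast
    have "y = f * \<alpha> * (\<alpha>' * x)" using x f \<alpha> c(1)[of x "0\<^sub>m c 1"] by (simp add: mat_assoc)
    thus "\<exists>x\<in>carrier_mat a' 1. y = f * \<alpha> * x" using x \<alpha> by (intro bexI[of _ "\<alpha>' * x"]) auto
  next
    fix z :: "'k mat" assume z: "z \<in> carrier_mat c' 1"
    then obtain y where y: "y \<in> carrier_mat b 1" "g * y = \<gamma>' * z" using e3[of "\<gamma>' * z"] \<gamma> by auto
    have "\<gamma> * g * y = z" using y g \<gamma> z c'(2)[of "0\<^sub>m a' 1" z] by (simp add: mat_assoc)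
    thus "\<exists>y\<in>carrier_mat b 1. \<gamma> * g * y = z" using y by blast
  qed
qed

text \<open>The families \<open>f'\<close> and \<open>g'\<close> need not commute with the arrows.
  Exactness is a condition at each vertex, so such families can exist even where the sequence of
  representations does not split.\<close>

lemma short_exact_if_split:
  fixes A B C :: "('v, 'a, 'k::field) qrep"
  assumes f: "f \<in> rep_hom Q A B" and g: "g \<in> rep_hom Q B C"
    and f': "\<And>v. v \<in> verts Q \<Longrightarrow> f' v \<in> carrier_mat (vdim A v) (vdim B v)"
    and g': "\<And>v. v \<in> verts Q \<Longrightarrow> g' v \<in> carrier_mat (vdim B v) (vdim C v)"
    and ff: "\<And>v. v \<in> verts Q \<Longrightarrow> f' v * f v = 1\<^sub>m (vdim A v)"
    and gg: "\<And>v. v \<in> verts Q \<Longrightarrow> g v * g' v = 1\<^sub>m (vdim C v)"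
    and gf: "\<And>v. v \<in> verts Q \<Longrightarrow> g v * f v = 0\<^sub>m (vdim C v) (vdim A v)"
    and split: "\<And>v. v \<in> verts Q \<Longrightarrow> f v * f' v + g' v * g v = 1\<^sub>m (vdim B v)"
  shows "short_exact Q A B C f g"
  unfolding short_exact_def
proof (intro conjI ballI impI f g)
  fix v assume v: "v \<in> verts Q"
  note c = rep_homD(1)[OF f v] rep_homD(1)[OF g v] f'[OF v] g'[OF v]
  {
    fix x :: "'k vec" assume x: "x \<in> carrier_vec (vdim A v)" "f v *\<^sub>v x = 0\<^sub>v (vdim B v)"
    have "x = (f' v * f v) *\<^sub>v x" using ff[OF v] x by simp
    also have "\<dots> = f' v *\<^sub>v (f v *\<^sub>v x)" using c x(1) by (intro assoc_mult_mat_vec) auto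
    also have "\<dots> = 0\<^sub>v (vdim A v)" using x c by auto
    finally show "x = 0\<^sub>v (vdim A v)" .
  next
    fix y :: "'k vec" assume y: "y \<in> carrier_vec (vdim B v)"
    show "g v *\<^sub>v y = 0\<^sub>v (vdim C v) \<longleftrightarrow> (\<exists>x\<in>carrier_vec (vdim A v). y = f v *\<^sub>v x)"
    proof
      assume 0: "g v *\<^sub>v y = 0\<^sub>v (vdim C v)"
      have "y = (f v * f' v + g' v * g v) *\<^sub>v y" using split[OF v] y by simp
      also have "\<dots> = (f v * f' v) *\<^sub>v y + (g' v * g v) *\<^sub>v y"
        using c y by (intro add_mult_distrib_mat_vec[of _ "vdim B v" "vdim B v"]) auto
      also have "(f v * f' v) *\<^sub>v y = f v *\<^sub>v (f' v *\<^sub>v y)" using c y by (intro assoc_mult_mat_vec) auto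
      also have "(g' v * g v) *\<^sub>v y = g' v *\<^sub>v (g v *\<^sub>v y)" using c y by (intro assoc_mult_mat_vec) auto
      also have "f v *\<^sub>v (f' v *\<^sub>v y) + g' v *\<^sub>v (g v *\<^sub>v y) = f v *\<^sub>v (f' v *\<^sub>v y)"
        using 0 c y by auto
      finally show "\<exists>x\<in>carrier_vec (vdim A v). y = f v *\<^sub>v x" using c y by (intro bexI[of _ "f' v *\<^sub>v y"]) auto
    next
      assume "\<exists>x\<in>carrier_vec (vdim A v). y = f v *\<^sub>v x"
      then obtain x where x: "x \<in> carrier_vec (vdim A v)" "y = f v *\<^sub>v x" by blast
      have "g v *\<^sub>v y = (g v * f v) *\<^sub>v x" unfolding x(2) using c x by (intro assoc_mult_mat_vec[symmetric]) auto
      thus "g v *\<^sub>v y = 0\<^sub>v (vdim C v)" using gf[OF v] x by auto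
    qed
  next
    fix z :: "'k vec" assume z: "z \<in> carrier_vec (vdim C v)"
    have "z = (g v * g' v) *\<^sub>v z" using gg[OF v] z by simp
    also have "\<dots> = g v *\<^sub>v (g' v *\<^sub>v z)" using c z by (intro assoc_mult_mat_vec) auto
    finally show "\<exists>y\<in>carrier_vec (vdim B v). z = g v *\<^sub>v y" using c z by (intro bexI[of _ "g' v *\<^sub>v z"]) auto
  }
qed

section \<open>Split, almost split and irreducible maps along isomorphisms\<close>

context wf_digraph
begin

lemma split_mono_iso:
  assumes X: "is_rep G X" and X': "is_rep G X'" and Y: "is_rep G Y"
    and \<alpha>: "rep_inverse G X' X \<alpha> \<alpha>'" and h: "h \<in> rep_hom G X' Y"
    and sm: "split_mono G X Y (\<lambda>v. h v * \<alpha>' v)"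
  shows "split_mono G X' Y h"
proof -
  note \<alpha>D = rep_inverseD[OF \<alpha>]
  from sm obtain g where g: "g \<in> rep_hom G Y X" and gh: "\<And>v. v \<in> verts G \<Longrightarrow> g v * (h v * \<alpha>' v) = 1\<^sub>m (vdim X v)"
    unfolding split_mono_def by blast
  have "(\<alpha>' v * g v) * h v = 1\<^sub>m (vdim X' v)" if v: "v \<in> verts G" for v
  proof -
    note d = rep_homD(2,3)[OF h v] rep_homD(2,3)[OF g v] rep_homD(2,3)[OF \<alpha>D(1) v] rep_homD(2,3)[OF \<alpha>D(2) v]
    have "(\<alpha>' v * g v) * h v = \<alpha>' v * ((g v * (h v * \<alpha>' v)) * \<alpha> v)"
      using d \<alpha>D(3)[OF v] by (simp add: mat_assoc)
    thus ?thesis using gh[OF v] d \<alpha>D(3)[OF v] by simp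
  qed
  thus ?thesis unfolding split_mono_def
    by (intro conjI h bexI[OF _ rep_hom_comp[OF Y X X' g \<alpha>D(2)]]) simp
qed

lemma split_epi_iso:
  assumes X: "is_rep G X" and Y: "is_rep G Y" and Y': "is_rep G Y'"
    and \<beta>: "rep_inverse G Y Y' \<beta> \<beta>'" and h: "h \<in> rep_hom G X Y'"
    and se: "split_epi G X Y (\<lambda>v. \<beta>' v * h v)"
  shows "split_epi G X Y' h"
proof -
  note \<beta>D = rep_inverseD[OF \<beta>]
  from se obtain g where g: "g \<in> rep_hom G Y X" and gh: "\<And>v. v \<in> verts G \<Longrightarrow> (\<beta>' v * h v) * g v = 1\<^sub>m (vdim Y v)"
    unfolding split_epi_def by blast
  have "h v * (g v * \<beta>' v) = 1\<^sub>m (vdim Y' v)" if v: "v \<in> verts G" for v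
  proof -
    note d = rep_homD(2,3)[OF h v] rep_homD(2,3)[OF g v] rep_homD(2,3)[OF \<beta>D(1) v] rep_homD(2,3)[OF \<beta>D(2) v]
    have "h v * (g v * \<beta>' v) = \<beta> v * (\<beta>' v * (h v * (g v * \<beta>' v)))"
      using d \<beta>D(6)[OF v] by simp
    also have "\<dots> = \<beta> v * (((\<beta>' v * h v) * g v) * \<beta>' v)"
      using d by (simp add: mat_assoc)
    finally show ?thesis using gh[OF v] d \<beta>D(4)[OF v] by simp
  qed
  thus ?thesis unfolding split_epi_def
    by (intro conjI h bexI[OF _ rep_hom_comp[OF Y' Y X \<beta>D(2) g]]) simp
qed


text \<open>Serves to move an almost split sequence to the interval representatives of its ends,
  while the middle term stays as it is.\<close>

lemma left_almost_split_iso: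
  assumes X: "is_rep G X" and X': "is_rep G X'" and B: "is_rep G B"
    and \<alpha>: "rep_inverse G X' X \<alpha> \<alpha>'" and f: "left_almost_split G X B f"
  shows "left_almost_split G X' B (\<lambda>v. f v * \<alpha> v)"
proof -
  note \<alpha>D = rep_inverseD[OF \<alpha>]
  have fh: "f \<in> rep_hom G X B" and ns: "\<not> split_mono G X B f"
    and fac: "\<And>Y h. is_rep G Y \<Longrightarrow> h \<in> rep_hom G X Y \<Longrightarrow> \<not> split_mono G X Y h \<Longrightarrow>
        (\<exists>h'\<in>rep_hom G B Y. \<forall>v\<in>verts G. h v = h' v * f v)"
    using f unfolding left_almost_split_def by blast+
  have dim: "dim_row (\<alpha>' v) = vdim X' v" "dim_col (\<alpha>' v) = vdim X v" "dim_row (\<alpha> v) = vdim X v" "dim_col (\<alpha> v) = vdim X' v"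
    "dim_col (f v) = vdim X v" "dim_row (f v) = vdim B v"
    if "v \<in> verts G" for v using rep_homD(2,3)[OF \<alpha>D(1) that] rep_homD(2,3)[OF \<alpha>D(2) that] rep_homD(2,3)[OF fh that] by auto
  show ?thesis unfolding left_almost_split_def
  proof (intro conjI allI impI)
    show hom: "(\<lambda>v. f v * \<alpha> v) \<in> rep_hom G X' B" by (rule rep_hom_comp[OF X' X B \<alpha>D(1) fh])
    show "\<not> split_mono G X' B (\<lambda>v. f v * \<alpha> v)"
    proof
      assume sm: "split_mono G X' B (\<lambda>v. f v * \<alpha> v)"
      have "split_mono G X B f"
        by (rule split_mono_iso[OF X' X B rep_inverse_sym[THEN iffD1, OF \<alpha>] fh sm])
      thus False using ns by simp
    qed
  next
    fix Y h assume Y: "is_rep G Y" and h: "h \<in> rep_hom G X' Y" and nsm: "\<not> split_mono G X' Y h"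
    have "(\<lambda>v. h v * \<alpha>' v) \<in> rep_hom G X Y" by (rule rep_hom_comp[OF X X' Y \<alpha>D(2) h])
    moreover have "\<not> split_mono G X Y (\<lambda>v. h v * \<alpha>' v)" using split_mono_iso[OF X X' Y \<alpha> h] nsm by blast
    ultimately obtain h' where h': "h' \<in> rep_hom G B Y" "\<And>v. v \<in> verts G \<Longrightarrow> h v * \<alpha>' v = h' v * f v"
      using fac[OF Y] by blast
    have "h v = h' v * (f v * \<alpha> v)" if v: "v \<in> verts G" for v
    proof -
      have "h' v * (f v * \<alpha> v) = (h v * \<alpha>' v) * \<alpha> v"
        using h'(2)[OF v] dim[OF v] rep_homD(2,3)[OF h'(1) v] by (simp add: mat_assoc)
      thus ?thesis using \<alpha>D(3)[OF v] dim[OF v] rep_homD(2,3)[OF h v] by (simp add: mat_assoc)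
    qed
    thus "\<exists>h'\<in>rep_hom G B Y. \<forall>v\<in>verts G. h v = h' v * (f v * \<alpha> v)" using h'(1) by blast
  qed
qed

lemma right_almost_split_iso:
  assumes C: "is_rep G C" and C': "is_rep G C'" and B: "is_rep G B"
    and \<gamma>: "rep_inverse G C C' \<gamma> \<gamma>'" and g: "right_almost_split G B C g"
  shows "right_almost_split G B C' (\<lambda>v. \<gamma> v * g v)"
proof -
  note \<gamma>D = rep_inverseD[OF \<gamma>]
  have gh: "g \<in> rep_hom G B C" and ns: "\<not> split_epi G B C g"
    and fac: "\<And>X h. is_rep G X \<Longrightarrow> h \<in> rep_hom G X C \<Longrightarrow> \<not> split_epi G X C h \<Longrightarrow>
        (\<exists>h'\<in>rep_hom G X B. \<forall>v\<in>verts G. h v = g v * h' v)"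
    using g unfolding right_almost_split_def by blast+
  have dim: "dim_row (\<gamma>' v) = vdim C v" "dim_col (\<gamma>' v) = vdim C' v" "dim_row (\<gamma> v) = vdim C' v" "dim_col (\<gamma> v) = vdim C v"
    "dim_col (g v) = vdim B v" "dim_row (g v) = vdim C v"
    if "v \<in> verts G" for v using rep_homD(2,3)[OF \<gamma>D(1) that] rep_homD(2,3)[OF \<gamma>D(2) that] rep_homD(2,3)[OF gh that] by auto
  show ?thesis unfolding right_almost_split_def
  proof (intro conjI allI impI)
    show hom: "(\<lambda>v. \<gamma> v * g v) \<in> rep_hom G B C'" by (rule rep_hom_comp[OF B C C' gh \<gamma>D(1)])
    show "\<not> split_epi G B C' (\<lambda>v. \<gamma> v * g v)"
    proof
      assume se: "split_epi G B C' (\<lambda>v. \<gamma> v * g v)"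
      have "split_epi G B C g"
        by (rule split_epi_iso[OF B C' C rep_inverse_sym[THEN iffD1, OF \<gamma>] gh se])
      thus False using ns by simp
    qed
  next
    fix X h assume X: "is_rep G X" and h: "h \<in> rep_hom G X C'" and nse: "\<not> split_epi G X C' h"
    have "(\<lambda>v. \<gamma>' v * h v) \<in> rep_hom G X C" by (rule rep_hom_comp[OF X C' C h \<gamma>D(2)])
    moreover have "\<not> split_epi G X C (\<lambda>v. \<gamma>' v * h v)" using split_epi_iso[OF X C C' \<gamma> h] nse by blast
    ultimately obtain h' where h': "h' \<in> rep_hom G X B" "\<And>v. v \<in> verts G \<Longrightarrow> \<gamma>' v * h v = g v * h' v"
      using fac[OF X] by blast
    have "h v = \<gamma> v * g v * h' v" if v: "v \<in> verts G" for v
    proof -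
      have "\<gamma> v * g v * h' v = \<gamma> v * (\<gamma>' v * h v)"
        using h'(2)[OF v] dim[OF v] rep_homD(2,3)[OF h'(1) v] by (simp add: mat_assoc)
      thus ?thesis using \<gamma>D(6)[OF v] dim[OF v] rep_homD(2,3)[OF h v] by simp
    qed
    thus "\<exists>h'\<in>rep_hom G X B. \<forall>v\<in>verts G. h v = \<gamma> v * g v * h' v" using h'(1) by blast
  qed
qed

text \<open>A factorisation of the transported map becomes one of \<open>f\<close> when the inverse
  isomorphisms are absorbed into the two factors.\<close>

lemma irreducible_hom_iso:
  assumes X: "is_rep G X" and X': "is_rep G X'" and Y: "is_rep G Y" and Y': "is_rep G Y'"
    and \<alpha>: "rep_inverse G X' X \<alpha> \<alpha>'" and \<beta>: "rep_inverse G Y Y' \<beta> \<beta>'"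
    and f: "irreducible_hom G X Y f"
  shows "irreducible_hom G X' Y' (\<lambda>v. \<beta> v * (f v * \<alpha> v))"
proof -
  note \<alpha>D = rep_inverseD[OF \<alpha>] and \<beta>D = rep_inverseD[OF \<beta>]
  have fh: "f \<in> rep_hom G X Y" and nm: "\<not> split_mono G X Y f" and ne: "\<not> split_epi G X Y f"
    and irr: "\<And>Z g h. is_rep G Z \<Longrightarrow> h \<in> rep_hom G X Z \<Longrightarrow> g \<in> rep_hom G Z Y \<Longrightarrow>
        (\<forall>v\<in>verts G. f v = g v * h v) \<Longrightarrow> split_mono G X Z h \<or> split_epi G Z Y g"
    using f unfolding irreducible_hom_def by blast+
  have dim: "dim_row (\<alpha>' v) = vdim X' v" "dim_col (\<alpha>' v) = vdim X v" "dim_row (\<alpha> v) = vdim X v" "dim_col (\<alpha> v) = vdim X' v"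
    "dim_row (\<beta>' v) = vdim Y v" "dim_col (\<beta>' v) = vdim Y' v" "dim_row (\<beta> v) = vdim Y' v" "dim_col (\<beta> v) = vdim Y v"
    "dim_col (f v) = vdim X v" "dim_row (f v) = vdim Y v"
    if "v \<in> verts G" for v
    using rep_homD(2,3)[OF \<alpha>D(1) that] rep_homD(2,3)[OF \<alpha>D(2) that] rep_homD(2,3)[OF fh that]
      rep_homD(2,3)[OF \<beta>D(1) that] rep_homD(2,3)[OF \<beta>D(2) that] by auto
  have hom1: "(\<lambda>v. f v * \<alpha> v) \<in> rep_hom G X' Y" by (rule rep_hom_comp[OF X' X Y \<alpha>D(1) fh])
  have hom: "(\<lambda>v. \<beta> v * (f v * \<alpha> v)) \<in> rep_hom G X' Y'" by (rule rep_hom_comp[OF X' Y Y' hom1 \<beta>D(1)])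
  have hom2: "(\<lambda>v. \<beta> v * f v) \<in> rep_hom G X Y'" by (rule rep_hom_comp[OF X Y Y' fh \<beta>D(1)])
  show ?thesis unfolding irreducible_hom_def
  proof (intro conjI allI impI hom)
    show "\<not> split_mono G X' Y' (\<lambda>v. \<beta> v * (f v * \<alpha> v))"
    proof
      assume "split_mono G X' Y' (\<lambda>v. \<beta> v * (f v * \<alpha> v))"
      then obtain g where g: "g \<in> rep_hom G Y' X'"
        and gf: "\<And>v. v \<in> verts G \<Longrightarrow> g v * (\<beta> v * (f v * \<alpha> v)) = 1\<^sub>m (vdim X' v)"
        unfolding split_mono_def by blast
      have "split_mono G X' Y (\<lambda>v. f v * \<alpha> v)" unfolding split_mono_def
      proof (intro conjI hom1 bexI[OF _ rep_hom_comp[OF Y Y' X' \<beta>D(1) g]] ballI)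
        fix v assume v: "v \<in> verts G"
        show "g v * \<beta> v * (f v * \<alpha> v) = 1\<^sub>m (vdim X' v)"
          using gf[OF v] dim[OF v] rep_homD(2,3)[OF g v] by (simp add: mat_assoc)
      qed
      from split_mono_iso[OF X' X Y rep_inverse_sym[THEN iffD1, OF \<alpha>] fh this] nm show False by simp
    qed
    show "\<not> split_epi G X' Y' (\<lambda>v. \<beta> v * (f v * \<alpha> v))"
    proof
      assume "split_epi G X' Y' (\<lambda>v. \<beta> v * (f v * \<alpha> v))"
      then obtain g where g: "g \<in> rep_hom G Y' X'"
        and gf: "\<And>v. v \<in> verts G \<Longrightarrow> \<beta> v * (f v * \<alpha> v) * g v = 1\<^sub>m (vdim Y' v)"
        unfolding split_epi_def by blast
      have "split_epi G X Y' (\<lambda>v. \<beta> v * f v)" unfolding split_epi_def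
      proof (intro conjI hom2 bexI[OF _ rep_hom_comp[OF Y' X' X g \<alpha>D(1)]] ballI)
        fix v assume v: "v \<in> verts G"
        show "\<beta> v * f v * (\<alpha> v * g v) = 1\<^sub>m (vdim Y' v)"
          using gf[OF v] dim[OF v] rep_homD(2,3)[OF g v] by (simp add: mat_assoc)
      qed
      from split_epi_iso[OF X Y' Y rep_inverse_sym[THEN iffD1, OF \<beta>] fh this] ne show False by simp
    qed
  next
    fix Z g h assume Z: "is_rep G Z" and h: "h \<in> rep_hom G X' Z" and g: "g \<in> rep_hom G Z Y'"
      and fac: "\<forall>v\<in>verts G. \<beta> v * (f v * \<alpha> v) = g v * h v"
    have "split_mono G X Z (\<lambda>v. h v * \<alpha>' v) \<or> split_epi G Z Y (\<lambda>v. \<beta>' v * g v)"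
    proof (rule irr[OF Z rep_hom_comp[OF X X' Z \<alpha>D(2) h] rep_hom_comp[OF Z Y' Y g \<beta>D(2)]], intro ballI)
      fix v assume v: "v \<in> verts G"
      note d = dim[OF v] rep_homD(2,3)[OF g v] rep_homD(2,3)[OF h v]
      have "\<beta>' v * g v * (h v * \<alpha>' v) = \<beta>' v * ((\<beta> v * (f v * \<alpha> v)) * \<alpha>' v)"
        using fac v d by (simp add: mat_assoc)
      also have "\<dots> = f v"
        using d \<beta>D(5)[OF v] \<alpha>D(4)[OF v] by (simp add: mat_assoc)
      finally show "f v = \<beta>' v * g v * (h v * \<alpha>' v)" by simp
    qed
    thus "split_mono G X' Z h \<or> split_epi G Z Y' g"
      using split_mono_iso[OF X X' Z \<alpha> h] split_epi_iso[OF Z Y Y' \<beta> g] by blast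
  qed
qed

end

section \<open>Interval representations of the linear quiver\<close>

lemma linear_quiver_simps [simp]:
  "verts (linear_quiver n) = {1..n}" "arcs (linear_quiver n) = {1..<n}"
  "tail (linear_quiver n) e = Suc e" "head (linear_quiver n) e = e"
  by (simp_all add: linear_quiver_def)

interpretation lq: wf_digraph "linear_quiver n" for n
  by unfold_locales auto

section \<open>Path maps of the linear quiver\<close>

lemma lq_rep_homD:
  assumes "f \<in> rep_hom (linear_quiver n) X Y"
  shows "1 \<le> v \<Longrightarrow> v \<le> n \<Longrightarrow> f v \<in> carrier_mat (vdim Y v) (vdim X v)"
    and "1 \<le> v \<Longrightarrow> v \<le> n \<Longrightarrow> dim_row (f v) = vdim Y v"
    and "1 \<le> v \<Longrightarrow> v \<le> n \<Longrightarrow> dim_col (f v) = vdim X v"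
    and "1 \<le> v \<Longrightarrow> v < n \<Longrightarrow> f v * amap X v = amap Y v * f (Suc v)"
  using assms unfolding rep_hom_def by auto

lemma lq_is_repD:
  assumes "is_rep (linear_quiver n) X" "1 \<le> v" "v < n"
  shows "amap X v \<in> carrier_mat (vdim X v) (vdim X (Suc v))"
    and "dim_row (amap X v) = vdim X v" and "dim_col (amap X v) = vdim X (Suc v)"
  using assms unfolding is_rep_def by auto

text \<open>The map goes from vertex \<open>j\<close> down to vertex \<open>i\<close> and is only meaningful for \<open>i \<le> j\<close>.\<close>

primrec path_map :: "(nat, nat, 'k::field) qrep \<Rightarrow> nat \<Rightarrow> nat \<Rightarrow> 'k mat" where
  "path_map X i 0 = 1\<^sub>m (vdim X i)"
| "path_map X i (Suc j) = (if i \<le> j then path_map X i j * amap X j else 1\<^sub>m (vdim X i))"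

lemma path_map_self [simp]: "path_map X i i = 1\<^sub>m (vdim X i)"
  by (cases i) auto

lemma path_map_carrier:
  assumes X: "is_rep (linear_quiver n) X" and "1 \<le> i" "i \<le> j" "j \<le> n"
  shows "path_map X i j \<in> carrier_mat (vdim X i) (vdim X j)"
  using assms(3,4)
proof (induction j rule: dec_induct)
  case (step j)
  thus ?case using lq_is_repD[OF X, of j] assms(2) by auto
qed simp

lemma path_map_dim:
  assumes "is_rep (linear_quiver n) X" "1 \<le> i" "i \<le> j" "j \<le> n"
  shows "dim_row (path_map X i j) = vdim X i" "dim_col (path_map X i j) = vdim X j"
  using path_map_carrier[OF assms] by auto

lemma path_map_trans:
  assumes X: "is_rep (linear_quiver n) X" and i: "1 \<le> i" "i \<le> j" and k: "j \<le> k" "k \<le> n"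
  shows "path_map X i j * path_map X j k = path_map X i k"
  using k
proof (induction k rule: dec_induct)
  case base
  thus ?case using path_map_dim[OF X i] k by simp
next
  case (step k)
  have "path_map X i j * path_map X j (Suc k) = (path_map X i j * path_map X j k) * amap X k"
    using step.hyps step.prems i path_map_dim[OF X i] path_map_dim[OF X, of j k] lq_is_repD[OF X, of k]
    by (simp add: mat_assoc)
  thus ?case using step i by simp
qed

text \<open>The recursion of \<open>path_map\<close> splits off the arrow at the upper vertex
  \<open>j\<close>; this is the counterpart at the lower vertex \<open>i\<close>.\<close>

lemma path_map_step:
  assumes X: "is_rep (linear_quiver n) X" and i: "1 \<le> i" "i < j" "j \<le> n"
  shows "path_map X i j = amap X i * path_map X (Suc i) j"
  using path_map_trans[OF X, of i "Suc i" j] lq_is_repD[OF X, of i] i by simp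

lemma path_map_hom:
  assumes X: "is_rep (linear_quiver n) X" and Y: "is_rep (linear_quiver n) Y"
    and f: "f \<in> rep_hom (linear_quiver n) X Y" and i: "1 \<le> i" "i \<le> j" "j \<le> n"
  shows "f i * path_map X i j = path_map Y i j * f j"
  using i(2,3)
proof (induction j rule: dec_induct)
  case base
  thus ?case using lq_rep_homD[OF f, of i] i by simp
next
  case (step j)
  note d = path_map_dim[OF X i(1), of j] path_map_dim[OF Y i(1), of j] lq_is_repD[OF X, of j] lq_is_repD[OF Y, of j]
    lq_rep_homD(2,3)[OF f, of i] lq_rep_homD(2,3)[OF f, of j] lq_rep_homD(2,3)[OF f, of "Suc j"]
  have "f i * path_map X i (Suc j) = (f i * path_map X i j) * amap X j"
    using step.hyps step.prems i d by (simp add: mat_assoc)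
  also have "f i * path_map X i j = path_map Y i j * f j" using step by simp
  also have "(path_map Y i j * f j) * amap X j = path_map Y i j * (f j * amap X j)"
    using step.hyps step.prems i d by (simp add: mat_assoc)
  also have "\<dots> = path_map Y i j * amap Y j * f (Suc j)"
    using step.hyps step.prems i d lq_rep_homD(4)[OF f, of j] by (simp add: mat_assoc)
  finally show ?case using step i by simp
qed

text \<open>In the dimensions \<open>0\<close> and \<open>1\<close> that occur here this is the
  identity of size one or an empty matrix, so one formula serves inside and outside the support of
  an interval.\<close>

definition ones_mat :: "nat \<Rightarrow> nat \<Rightarrow> 'k::field mat" where
  "ones_mat r c = mat r c (\<lambda>_. 1)"

lemma ones_mat_dim [simp]: "dim_row (ones_mat r c) = r" "dim_col (ones_mat r c) = c"
  "ones_mat r c \<in> carrier_mat r c"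
  by (simp_all add: ones_mat_def)

lemma ones_mat_one [simp]: "ones_mat 1 1 = 1\<^sub>m 1" "ones_mat (Suc 0) (Suc 0) = 1\<^sub>m (Suc 0)"
  by (auto simp: ones_mat_def mat_eq_iff)

text \<open>The zero representation if \<open>b < a\<close>.\<close>

definition ivl :: "nat \<Rightarrow> nat \<Rightarrow> (nat, nat, 'k::field) qrep" where
  "ivl a b = (let d = \<lambda>v. if a \<le> v \<and> v \<le> b then 1 else 0
     in \<lparr>vdim = d, amap = (\<lambda>e. ones_mat (d e) (d (Suc e)))\<rparr>)"

lemma vdim_ivl: "vdim (ivl a b :: (nat, nat, 'k::field) qrep) v = (if a \<le> v \<and> v \<le> b then 1 else 0)"
  by (simp add: ivl_def)

lemma amap_ivl:
  fixes a b :: nat and I :: "(nat, nat, 'k::field) qrep"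
  defines "I \<equiv> ivl a b"
  shows "amap I e = ones_mat (vdim I e) (vdim I (Suc e))"
  by (simp add: I_def ivl_def)

lemma is_rep_ivl: "is_rep (linear_quiver n) (ivl a b)"
  by (auto simp: is_rep_def amap_ivl)

lemma path_map_ivl:
  assumes "a \<le> i" "i \<le> j" "j \<le> b"
  shows "path_map (ivl a b) i j = 1\<^sub>m 1"
  using assms(2,3)
proof (induction j rule: dec_induct)
  case base
  thus ?case using assms by (simp add: vdim_ivl)
next
  case (step j)
  thus ?case using assms by (simp add: amap_ivl vdim_ivl)
qed

lemma path_map_ivl_dim:
  fixes a b :: nat and I :: "(nat, nat, 'k::field) qrep"
  defines "I \<equiv> ivl a b"
  assumes "1 \<le> i" "i \<le> j"
  shows "dim_row (path_map I i j) = vdim I i" "dim_col (path_map I i j) = vdim I j"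
  using path_map_dim[OF is_rep_ivl assms(2,3) order_refl, of a b] by (simp_all add: I_def)

text \<open>The canonical map: the identity on the common support and an empty matrix
  elsewhere.\<close>

definition ivl_hom :: "nat \<Rightarrow> nat \<Rightarrow> nat \<Rightarrow> nat \<Rightarrow> nat \<Rightarrow> 'k::field mat" where
  "ivl_hom a b a' b' v = ones_mat (vdim (ivl a' b' :: (nat, nat, 'k) qrep) v) (vdim (ivl a b :: (nat, nat, 'k) qrep) v)"

lemma ivl_hom_dim [simp]:
  "dim_row (ivl_hom a b a' b' v :: 'k::field mat) = vdim (ivl a' b' :: (nat, nat, 'k) qrep) v"
  "dim_col (ivl_hom a b a' b' v :: 'k::field mat) = vdim (ivl a b :: (nat, nat, 'k) qrep) v"
  by (simp_all add: ivl_hom_def)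

lemma ivl_hom_one: "a \<le> v \<Longrightarrow> a' \<le> v \<Longrightarrow> v \<le> b \<Longrightarrow> v \<le> b' \<Longrightarrow> ivl_hom a b a' b' v = 1\<^sub>m 1"
  by (simp add: ivl_hom_def vdim_ivl)


lemma ones_mat_zero [simp]: "ones_mat 0 c = 0\<^sub>m 0 c" "ones_mat r 0 = 0\<^sub>m r 0"
  by (auto simp: ones_mat_def mat_eq_iff)

text \<open>A square can fail to commute only if \<open>e\<close> lies in \<open>{a'..b'}\<close>
  and \<open>Suc e\<close> in \<open>{a..b}\<close>; the inequalities then put both vertices into
  both intervals.\<close>

lemma ivl_hom_in_rep_hom:
  assumes "a \<le> a'" "b \<le> b'"
  shows "ivl_hom a b a' b' \<in> rep_hom (linear_quiver n) (ivl a b) (ivl a' b')"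
  using assms by (auto simp: rep_hom_def ivl_hom_def amap_ivl vdim_ivl)

text \<open>The arrows lead downwards, so \<open>ivl a b\<close> is generated by its vector at
  \<open>b\<close>, and the only relation is that this vector dies at \<open>a - 1\<close>. Any
  \<open>y\<close> that obeys the relation may be the image of the generator.\<close>

lemma rep_hom_from_ivl:
  assumes Y: "is_rep (linear_quiver n) Y" and y: "y \<in> carrier_mat (vdim Y b) 1" and ab: "1 \<le> a" "b \<le> n"
    and kill: "1 < a \<Longrightarrow> a \<le> b \<Longrightarrow> path_map Y (a - 1) b * y = 0\<^sub>m (vdim Y (a - 1)) 1"
  shows "(\<lambda>v. if a \<le> v \<and> v \<le> b then path_map Y v b * y else 0\<^sub>m (vdim Y v) 0) \<in> rep_hom (linear_quiver n) (ivl a b) Y"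
    (is "?f \<in> _")
  unfolding rep_hom_def
proof (intro CollectI conjI ballI)
  fix v assume "v \<in> verts (linear_quiver n)"
  thus "?f v \<in> carrier_mat (vdim Y v) (vdim (ivl a b) v)"
    using path_map_carrier[OF Y, of v b] y ab by (auto simp: vdim_ivl)
next
  fix e assume "e \<in> arcs (linear_quiver n)"
  hence e: "1 \<le> e" "e < n" by auto
  note dY = lq_is_repD(2,3)[OF Y e]
  have "?f e * amap (ivl a b) e = amap Y e * ?f (Suc e)"
  proof -
    consider "a \<le> e" "Suc e \<le> b" | "Suc e = a" "a \<le> b" | "b < Suc e \<or> Suc e < a" by linarith
    thus ?thesis
    proof cases
      case 1
      have "path_map Y e b = amap Y e * path_map Y (Suc e) b"
        by (rule path_map_step[OF Y]) (use 1 e ab in auto)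
      thus ?thesis using 1 e ab y dY path_map_dim[OF Y, of "Suc e" b] path_map_dim[OF Y, of e b]
        by (simp add: amap_ivl vdim_ivl mat_assoc)
    next
      case 2
      \<comment> \<open>This arrow leaves the support: one side of the square is zero by dimensions,
        the other by \<open>kill\<close>.\<close>
      have "amap Y e * (path_map Y (Suc e) b * y) = path_map Y e b * y"
        using 2 e ab y dY path_map_dim[OF Y, of "Suc e" b] path_map_step[OF Y, of e b] by (simp add: mat_assoc)
      also have "\<dots> = 0\<^sub>m (vdim Y e) 1" using kill 2 e by auto
      finally show ?thesis using 2 y by (auto simp: amap_ivl vdim_ivl)
    next
      case 3
      thus ?thesis using dY y ab e path_map_dim[OF Y, of e b] by (auto simp: amap_ivl vdim_ivl)
    qed
  qed
  thus "?f (head (linear_quiver n) e) * amap (ivl a b) e = amap Y e * ?f (tail (linear_quiver n) e)" by (simp only: linear_quiver_simps)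
qed

text \<open>Dually, a functional at the lowest vertex \<open>a\<close> extends over the support by
  composition with path maps, and has to vanish on everything that comes from
  \<open>b + 1\<close>.\<close>

lemma rep_hom_to_ivl:
  assumes X: "is_rep (linear_quiver n) X" and y: "y \<in> carrier_mat 1 (vdim X a)" and ab: "1 \<le> a" "b \<le> n"
    and kill: "b < n \<Longrightarrow> a \<le> b \<Longrightarrow> y * path_map X a (b + 1) = 0\<^sub>m 1 (vdim X (b + 1))"
  shows "(\<lambda>v. if a \<le> v \<and> v \<le> b then y * path_map X a v else 0\<^sub>m 0 (vdim X v)) \<in> rep_hom (linear_quiver n) X (ivl a b)"
    (is "?f \<in> _")
  unfolding rep_hom_def
proof (intro CollectI conjI ballI)
  fix v assume "v \<in> verts (linear_quiver n)"
  thus "?f v \<in> carrier_mat (vdim (ivl a b) v) (vdim X v)"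
    using path_map_carrier[OF X, of a v] y ab by (auto simp: vdim_ivl)
next
  fix e assume "e \<in> arcs (linear_quiver n)"
  hence e: "1 \<le> e" "e < n" by auto
  note dX = lq_is_repD(2,3)[OF X e]
  have "?f e * amap X e = amap (ivl a b) e * ?f (Suc e)"
  proof -
    consider "a \<le> e" "Suc e \<le> b" | "a \<le> e" "e = b" | "e < a \<or> b < e" by linarith
    thus ?thesis
    proof cases
      case 1
      thus ?thesis using e ab y dX path_map_dim[OF X, of a e]
        by (simp add: amap_ivl vdim_ivl mat_assoc)
    next
      case 2
      have "y * path_map X a e * amap X e = y * path_map X a (b + 1)"
        using 2 e ab y dX path_map_dim[OF X, of a e] by (simp add: mat_assoc)
      also have "\<dots> = 0\<^sub>m 1 (vdim X (b + 1))" using kill 2 e by auto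
      finally show ?thesis using 2 y by (auto simp: amap_ivl vdim_ivl)
    next
      case 3
      thus ?thesis using dX y ab e path_map_dim[OF X, of a "Suc e"] by (auto simp: amap_ivl vdim_ivl)
    qed
  qed
  thus "?f (head (linear_quiver n) e) * amap X e = amap (ivl a b) e * ?f (tail (linear_quiver n) e)" by (simp only: linear_quiver_simps)
qed

text \<open>Naturality along the paths inside the support, where the path maps of the interval are
  identities, and along the path that leaves it at the bottom.\<close>

lemma rep_hom_from_ivlD:
  assumes Y: "is_rep (linear_quiver n) Y" and f: "f \<in> rep_hom (linear_quiver n) (ivl a b) Y"
    and ab: "1 \<le> a" "a \<le> b" "b \<le> n"
  shows "a \<le> v \<Longrightarrow> v \<le> b \<Longrightarrow> f v = path_map Y v b * f b"
    and "1 < a \<Longrightarrow> path_map Y (a - 1) b * f b = 0\<^sub>m (vdim Y (a - 1)) 1"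
proof -
  show "f v = path_map Y v b * f b" if "a \<le> v" "v \<le> b"
    using path_map_hom[OF is_rep_ivl Y f, of v b] that ab lq_rep_homD[OF f, of v]
    by (simp add: path_map_ivl vdim_ivl)
  show "path_map Y (a - 1) b * f b = 0\<^sub>m (vdim Y (a - 1)) 1" if a1: "1 < a"
  proof -
    obtain c where c: "a = Suc c" "1 \<le> c" using a1 by (cases a) auto
    have "f c * path_map (ivl a b) c b = 0\<^sub>m (vdim Y c) 1"
      using mat_mult_inner_zero[of "f c" "path_map (ivl a b) c b"] c ab
        lq_rep_homD(2,3)[OF f, of c] by (simp add: vdim_ivl path_map_ivl_dim)
    thus ?thesis using path_map_hom[OF is_rep_ivl Y f, of c b] c ab by simp
  qed
qed

lemma rep_hom_to_ivlD:
  assumes X: "is_rep (linear_quiver n) X" and f: "f \<in> rep_hom (linear_quiver n) X (ivl a b)"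
    and ab: "1 \<le> a" "a \<le> b" "b \<le> n"
  shows "a \<le> v \<Longrightarrow> v \<le> b \<Longrightarrow> f v = f a * path_map X a v"
    and "b < n \<Longrightarrow> f a * path_map X a (b + 1) = 0\<^sub>m 1 (vdim X (b + 1))"
proof -
  show "f v = f a * path_map X a v" if "a \<le> v" "v \<le> b"
    using path_map_hom[OF X is_rep_ivl f, of a v] that ab lq_rep_homD[OF f, of v]
    by (simp add: path_map_ivl vdim_ivl)
  show "f a * path_map X a (b + 1) = 0\<^sub>m 1 (vdim X (b + 1))" if "b < n"
  proof -
    have "path_map (ivl a b) a (b + 1) * f (b + 1) = 0\<^sub>m 1 (vdim X (b + 1))"
      using mat_mult_inner_zero[of "path_map (ivl a b) a (b + 1)" "f (b + 1)"] that ab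
        lq_rep_homD(2,3)[OF f, of "b + 1"] by (simp add: vdim_ivl path_map_ivl_dim del: path_map.simps)
    thus ?thesis using path_map_hom[OF X is_rep_ivl f, of a "b + 1"] that ab by simp
  qed
qed

text \<open>
  Take the least \<open>a\<close> with \<open>X\<^sub>a \<noteq> 0\<close> and then the greatest \<open>b\<close> with \<open>X\<^sub>b \<rightarrow> X\<^sub>a\<close> nonzero: a vector at \<open>b\<close> and
  a functional at \<open>a\<close> pairing to \<open>1\<close> along this map define the inclusion and the retraction.
\<close>

lemma ivl_retract:
  fixes X :: "(nat, nat, 'k::field) qrep"
  assumes X: "is_rep (linear_quiver n) X" and nz: "\<not> zero_rep (linear_quiver n) X"
  obtains a b p s where "1 \<le> a" "a \<le> b" "b \<le> n" "p \<in> rep_hom (linear_quiver n) X (ivl a b)"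
    "s \<in> rep_hom (linear_quiver n) (ivl a b) X"
    "\<And>v. v \<in> verts (linear_quiver n) \<Longrightarrow> p v * s v = 1\<^sub>m (vdim (ivl a b :: (nat, nat, 'k) qrep) v)"
proof -
  define a where "a = (LEAST v. 1 \<le> v \<and> v \<le> n \<and> vdim X v \<noteq> 0)"
  have ex: "\<exists>v. 1 \<le> v \<and> v \<le> n \<and> vdim X v \<noteq> 0" using nz by (auto simp: zero_rep_def)
  have a: "1 \<le> a" "a \<le> n" "vdim X a \<noteq> 0" using LeastI_ex[OF ex] by (auto simp: a_def)
  have amin: "vdim X v = 0" if "1 \<le> v" "v < a" for v
    using not_less_Least[of v "\<lambda>v. 1 \<le> v \<and> v \<le> n \<and> vdim X v \<noteq> 0"] that a by (auto simp: a_def)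
  define P where "P b \<longleftrightarrow> a \<le> b \<and> b \<le> n \<and> path_map X a b \<noteq> 0\<^sub>m (vdim X a) (vdim X b)" for b
  define b where "b = (GREATEST b. P b)"
  have Pa: "P a" using a one_mat_neq_zero[of "vdim X a"] by (simp add: P_def)
  have bnd: "\<And>k. P k \<Longrightarrow> k \<le> n" by (simp add: P_def)
  have Pb: "P b" unfolding b_def by (rule GreatestI_nat[of P, OF Pa bnd])
  have bmax: "k \<le> b" if "P k" for k unfolding b_def by (rule Greatest_le_nat[of P, OF that bnd])
  have ab: "a \<le> b" "b \<le> n" "path_map X a b \<noteq> 0\<^sub>m (vdim X a) (vdim X b)" using Pb by (auto simp: P_def)
  obtain \<phi> y where \<phi>: "\<phi> \<in> carrier_mat 1 (vdim X a)" and y: "y \<in> carrier_mat (vdim X b) 1"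
    and \<phi>y: "\<phi> * (path_map X a b * y) = 1\<^sub>m 1"
    using nonzero_mat_compress_to_one[OF path_map_carrier[OF X a(1) ab(1,2)] ab(3)] by blast
  let ?s = "\<lambda>v. if a \<le> v \<and> v \<le> b then path_map X v b * y else 0\<^sub>m (vdim X v) 0"
  let ?p = "\<lambda>v. if a \<le> v \<and> v \<le> b then \<phi> * path_map X a v else 0\<^sub>m 0 (vdim X v)"
  have s: "?s \<in> rep_hom (linear_quiver n) (ivl a b) X"
  proof (rule rep_hom_from_ivl[OF X y a(1) ab(2)])
    \<comment> \<open>By the choice of \<open>a\<close> the space at \<open>a - 1\<close> is
      zero.\<close>
    assume "1 < a"
    thus "path_map X (a - 1) b * y = 0\<^sub>m (vdim X (a - 1)) 1"
      using amin[of "a - 1"] path_map_dim[OF X, of "a - 1" b] ab y mat_no_rows[of "path_map X (a - 1) b * y"] by simp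
  qed
  have p: "?p \<in> rep_hom (linear_quiver n) X (ivl a b)"
  proof (rule rep_hom_to_ivl[OF X \<phi> a(1) ab(2)])
    \<comment> \<open>By the choice of \<open>b\<close> nothing reaches \<open>a\<close> from
      \<open>b + 1\<close>.\<close>
    assume "b < n"
    hence "path_map X a (b + 1) = 0\<^sub>m (vdim X a) (vdim X (b + 1))"
      using bmax[of "b + 1"] ab unfolding P_def by force
    thus "\<phi> * path_map X a (b + 1) = 0\<^sub>m 1 (vdim X (b + 1))" using \<phi> by simp
  qed
  have "?p v * ?s v = 1\<^sub>m (vdim (ivl a b :: (nat, nat, 'k) qrep) v)" if "v \<in> verts (linear_quiver n)" for v
  proof (cases "a \<le> v \<and> v \<le> b")
    case True
    have "\<phi> * path_map X a v * (path_map X v b * y) = \<phi> * ((path_map X a v * path_map X v b) * y)"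
      using True a ab \<phi> y path_map_dim[OF X, of a v] path_map_dim[OF X, of v b] by (simp add: mat_assoc)
    thus ?thesis using True a ab \<phi>y path_map_trans[OF X, of a v b] by (simp add: vdim_ivl)
  qed (auto simp: vdim_ivl)
  thus thesis using that[OF a(1) ab(1,2) p s] by blast
qed

text \<open>An endomorphism is determined by its value on the generator at \<open>b\<close>, and the
  path maps are identities.\<close>

lemma ivl_end_scalar:
  assumes f: "f \<in> rep_hom (linear_quiver n) (ivl a b) (ivl a b)" and ab: "1 \<le> a" "b \<le> n"
    and v: "a \<le> v" "v \<le> b"
  shows "f v = f b"
  using rep_hom_from_ivlD(1)[OF is_rep_ivl f, of v] ab v lq_rep_homD[OF f, of b]
  by (simp add: path_map_ivl vdim_ivl)

text \<open>A decomposition gives an idempotent endomorphism, which is a scalar, hence \<open>0\<close> or \<open>1\<close>.\<close>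

lemma indecomposable_ivl:
  assumes ab: "1 \<le> a" "a \<le> b" "b \<le> n"
  shows "indecomposable (linear_quiver n) (ivl a b :: (nat, nat, 'k::field) qrep)"
proof -
  let ?Q = "linear_quiver n" and ?I = "ivl a b :: (nat, nat, 'k) qrep"
  have "zero_rep ?Q Y \<or> zero_rep ?Q Z"
    if Y: "is_rep ?Q Y" and Z: "is_rep ?Q Z" and iso: "rep_iso ?Q ?I (direct_sum [Y, Z])" for Y Z :: "(nat, nat, 'k) qrep"
  proof -
    let ?D = "direct_sum [Y, Z]"
    have D: "is_rep ?Q ?D" "\<And>v. vdim ?D v = vdim Y v + vdim Z v" using lq.direct_sum_pair[OF Y Z] by auto
    obtain i1 i2 p1 p2 where b: "i1 \<in> rep_hom ?Q Y ?D" "i2 \<in> rep_hom ?Q Z ?D"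
      "p1 \<in> rep_hom ?Q ?D Y" "p2 \<in> rep_hom ?Q ?D Z"
      and b2: "\<And>v. v \<in> verts ?Q \<Longrightarrow> p1 v * i1 v = 1\<^sub>m (vdim Y v)"
      "\<And>v. v \<in> verts ?Q \<Longrightarrow> p2 v * i2 v = 1\<^sub>m (vdim Z v)"
      "\<And>v. v \<in> verts ?Q \<Longrightarrow> p1 v * i2 v = 0\<^sub>m (vdim Y v) (vdim Z v)"
      "\<And>v. v \<in> verts ?Q \<Longrightarrow> p2 v * i1 v = 0\<^sub>m (vdim Z v) (vdim Y v)"
      "\<And>v. v \<in> verts ?Q \<Longrightarrow> i1 v * p1 v + i2 v * p2 v = 1\<^sub>m (vdim Y v + vdim Z v)"
      by (rule lq.direct_sum_biproduct[OF Y Z]) blast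
    from iso obtain f g where fg: "rep_inverse ?Q ?I ?D f g" by (auto simp: rep_iso_inverse)
    note I = rep_inverseD[OF fg]
    \<comment> \<open>The projection to the summand \<open>Y\<close>, carried over to the
      interval.\<close>
    define h where "h v = g v * (i1 v * (p1 v * f v))" for v
    have h: "h \<in> rep_hom ?Q ?I ?I" unfolding h_def
      by (rule lq.rep_hom_comp[OF _ _ _ _ I(2)] lq.rep_hom_comp[OF _ _ _ _ b(1)] lq.rep_hom_comp[OF _ _ _ _ b(3)]
          is_rep_ivl D(1) Y I(1))+
    have dims: "dim_row (f v) = vdim ?D v" "dim_col (f v) = vdim ?I v" "dim_row (g v) = vdim ?I v" "dim_col (g v) = vdim ?D v"
      "dim_row (i1 v) = vdim ?D v" "dim_col (i1 v) = vdim Y v" "dim_row (i2 v) = vdim ?D v" "dim_col (i2 v) = vdim Z v"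
      "dim_row (p1 v) = vdim Y v" "dim_col (p1 v) = vdim ?D v" "dim_row (p2 v) = vdim Z v" "dim_col (p2 v) = vdim ?D v"
      if "v \<in> verts ?Q" for v
      using rep_homD(2,3)[OF I(1) that] rep_homD(2,3)[OF I(2) that] rep_homD(2,3)[OF b(1) that]
        rep_homD(2,3)[OF b(2) that] rep_homD(2,3)[OF b(3) that] rep_homD(2,3)[OF b(4) that] by auto
    have bv: "b \<in> verts ?Q" using ab by simp
    have hc: "h b \<in> carrier_mat 1 1" using rep_homD(1)[OF h bv] ab by (simp add: vdim_ivl)
    have "h b * h b = g b * (i1 b * (p1 b * (f b * (g b * (i1 b * (p1 b * f b))))))"
      unfolding h_def using dims[OF bv] by (simp add: mat_assoc)
    also have "\<dots> = g b * (i1 b * (p1 b * (i1 b * (p1 b * f b))))"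
      using dims[OF bv] I(6)[OF bv] by simp
    also have "p1 b * (i1 b * (p1 b * f b)) = p1 b * f b"
      using dims[OF bv] b2(1)[OF bv] by (simp add: mat_assoc[symmetric])
    finally have "h b * h b = h b" by (simp add: h_def)
    hence "h b $$ (0, 0) * h b $$ (0, 0) = h b $$ (0, 0)" using mult_one_by_one[OF hc hc] by simp
    hence "h b $$ (0, 0) = 0 \<or> h b $$ (0, 0) = 1" by simp
    hence hb: "h b = 0\<^sub>m 1 1 \<or> h b = 1\<^sub>m 1"
      using eq_one_by_one[OF hc, of "0\<^sub>m 1 1"] eq_one_by_one[OF hc, of "1\<^sub>m 1"] by auto
    \<comment> \<open>Conjugating back recovers the projection to \<open>Y\<close>. If
      \<open>h\<close> is zero, this makes \<open>Y\<close> zero; if \<open>h\<close> is the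
      identity, it makes \<open>Z\<close> zero.\<close>
    have key: "f v * (h v * g v) = i1 v * p1 v" if v: "v \<in> verts ?Q" for v
    proof -
      have "f v * (h v * g v) = f v * (g v * (i1 v * (p1 v * (f v * g v))))"
        using dims[OF v] by (simp add: h_def mat_assoc)
      thus ?thesis using dims[OF v] I(4,6)[OF v] by simp
    qed
    show ?thesis
    proof (cases "h b = 0\<^sub>m 1 1")
      case True
      have "vdim Y v = 0" if v: "v \<in> verts ?Q" for v
      proof -
        have "h v = 0\<^sub>m (vdim ?I v) (vdim ?I v)"
        proof (cases "a \<le> v \<and> v \<le> b")
          case True
          thus ?thesis using ivl_end_scalar[OF h ab(1,3), of v] \<open>h b = 0\<^sub>m 1 1\<close> by (simp add: vdim_ivl)
        next
          case False
          thus ?thesis using rep_homD(2,3)[OF h v] mat_no_rows[of "h v"] by (auto simp: vdim_ivl)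
        qed
        hence 0: "i1 v * p1 v = 0\<^sub>m (vdim ?D v) (vdim ?D v)" using key[OF v] dims[OF v] by simp
        have "1\<^sub>m (vdim Y v) = p1 v * ((i1 v * p1 v) * i1 v)"
          using b2(1)[OF v] dims[OF v] by (simp add: mat_assoc)
        also have "\<dots> = 0\<^sub>m (vdim Y v) (vdim Y v)" using 0 dims[OF v] by simp
        finally show ?thesis using one_mat_neq_zero by fastforce
      qed
      thus ?thesis by (simp add: zero_rep_def)
    next
      case False
      hence hb1: "h b = 1\<^sub>m 1" using hb by simp
      have "vdim Z v = 0" if v: "v \<in> verts ?Q" for v
      proof -
        have "h v = 1\<^sub>m (vdim ?I v)"
        proof (cases "a \<le> v \<and> v \<le> b")
          case True
          thus ?thesis using ivl_end_scalar[OF h ab(1,3), of v] hb1 by (simp add: vdim_ivl)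
        next
          case False
          thus ?thesis using rep_homD(2,3)[OF h v] mat_no_rows[of "h v"] by (auto simp: vdim_ivl)
        qed
        hence 1: "i1 v * p1 v = 1\<^sub>m (vdim ?D v)" using key[OF v] dims[OF v] I(4)[OF v] by simp
        have "1\<^sub>m (vdim Z v) = p2 v * ((i1 v * p1 v) * i2 v)"
          using b2(2)[OF v] dims[OF v] 1 by simp
        also have "\<dots> = p2 v * (i1 v * (p1 v * i2 v))" using dims[OF v] by (simp add: mat_assoc)
        also have "\<dots> = 0\<^sub>m (vdim Z v) (vdim Z v)" using b2(3)[OF v] dims[OF v] by simp
        finally show ?thesis using one_mat_neq_zero by fastforce
      qed
      thus ?thesis by (simp add: zero_rep_def)
    qed
  qed
  moreover have "\<not> zero_rep ?Q ?I" using ab by (auto simp: zero_rep_def vdim_ivl intro!: exI[of _ a])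
  ultimately show ?thesis using is_rep_ivl by (auto simp: indecomposable_def)
qed

text \<open>A nonzero representation has an interval as a retract, and an indecomposable one has no
  room for a complement.\<close>

lemma indecomposable_iso_ivl:
  assumes X: "indecomposable (linear_quiver n) X"
  obtains a b where "1 \<le> a" "a \<le> b" "b \<le> n" "rep_iso (linear_quiver n) X (ivl a b)"
proof -
  have Xr: "is_rep (linear_quiver n) X" "\<not> zero_rep (linear_quiver n) X" using X by (auto simp: indecomposable_def)
  obtain a b p s where ab: "1 \<le> a" "a \<le> b" "b \<le> n" and p: "p \<in> rep_hom (linear_quiver n) X (ivl a b)"
    and s: "s \<in> rep_hom (linear_quiver n) (ivl a b) X"
    and ps: "\<And>v. v \<in> verts (linear_quiver n) \<Longrightarrow> p v * s v = 1\<^sub>m (vdim (ivl a b :: (nat, nat, 'a) qrep) v)"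
    by (rule ivl_retract[OF Xr]) blast
  have "\<not> zero_rep (linear_quiver n) (ivl a b :: (nat, nat, 'a) qrep)"
    using indecomposable_ivl[OF ab] by (auto simp: indecomposable_def)
  from lq.indecomposable_iso_retract[OF X is_rep_ivl this _ p s ps]
  have "rep_iso (linear_quiver n) X (ivl a b)" by (simp add: vdim_ivl)
  thus thesis using that ab by blast
qed

text \<open>On the support the identity of the space of \<open>X\<close> would be a column times a
  row, which is impossible from dimension two on: nonzero diagonal entries force nonzero entries off
  the diagonal.\<close>

lemma rep_iso_ivl_vdim:
  assumes iso: "rep_iso (linear_quiver n) X (ivl a b :: (nat, nat, 'k::field) qrep)" and v: "1 \<le> v" "v \<le> n"
  shows "vdim X v = vdim (ivl a b :: (nat, nat, 'k) qrep) v"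
proof (cases "a \<le> v \<and> v \<le> b")
  case False
  thus ?thesis using lq.rep_iso_zero_iff[OF iso, of v] v by (auto simp: vdim_ivl)
next
  case True
  let ?d = "vdim X v"
  from iso obtain f g where fg: "rep_inverse (linear_quiver n) X (ivl a b) f g" by (auto simp: rep_iso_inverse)
  note I = rep_inverseD[OF fg]
  have c: "f v \<in> carrier_mat 1 ?d" "g v \<in> carrier_mat ?d 1" and gf: "g v * f v = 1\<^sub>m ?d"
    using lq_rep_homD(1)[OF I(1) v] lq_rep_homD(1)[OF I(2) v] I(3)[of v] v True by (auto simp: vdim_ivl)
  have d0: "?d \<noteq> 0" using lq.rep_iso_zero_iff[OF iso, of v] v True by (auto simp: vdim_ivl)
  have "\<not> 2 \<le> ?d"
  proof
    assume that: "2 \<le> ?d"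
    have e: "g v $$ (i, 0) * f v $$ (0, j) = (if i = j then 1 else 0)" if "i < ?d" "j < ?d" for i j
      using arg_cong[OF gf, of "\<lambda>A. A $$ (i, j)"] c that by (simp add: scalar_prod_def)
    show False using e[of 0 0] e[of 1 1] e[of 0 1] that by auto
  qed
  hence "?d = 1" using d0 by (metis One_nat_def less_2_cases not_le)
  thus ?thesis using True by (simp add: vdim_ivl)
qed

lemma rep_iso_ivl_eq:
  assumes "rep_iso (linear_quiver n) (ivl a b :: (nat, nat, 'k::field) qrep) (ivl a' b')"
    and "1 \<le> a" "a \<le> b" "b \<le> n" "1 \<le> a'" "a' \<le> b'" "b' \<le> n"
  shows "a = a' \<and> b = b'"
proof -
  have "a \<le> v \<and> v \<le> b \<longleftrightarrow> a' \<le> v \<and> v \<le> b'" if "1 \<le> v" "v \<le> n" for v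
    using rep_iso_ivl_vdim[OF assms(1) that] by (auto simp: vdim_ivl split: if_splits)
  from this[of a] this[of a'] this[of b] this[of b'] show ?thesis using assms by auto
qed

section \<open>Irreducible maps between interval representations\<close>

text \<open>The functional \<open>\<phi>\<close> defines the retraction, whose composite with
  \<open>h\<close> equals \<open>\<phi> * h a\<close> at every vertex of the support.\<close>

lemma split_mono_from_ivl:
  assumes Y: "is_rep (linear_quiver n) Y" and h: "h \<in> rep_hom (linear_quiver n) (ivl a b) Y"
    and ab: "1 \<le> a" "a \<le> b" "b \<le> n" and \<phi>: "\<phi> \<in> carrier_mat 1 (vdim Y a)"
    and kill: "b < n \<Longrightarrow> \<phi> * path_map Y a (b + 1) = 0\<^sub>m 1 (vdim Y (b + 1))"
    and one: "\<phi> * h a = 1\<^sub>m 1"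
  shows "split_mono (linear_quiver n) (ivl a b) Y h"
  unfolding split_mono_def
proof (intro conjI h bexI[OF _ rep_hom_to_ivl[OF Y \<phi> ab(1,3) kill]] ballI)
  fix v assume "v \<in> verts (linear_quiver n)"
  hence v: "1 \<le> v" "v \<le> n" by auto
  show "(if a \<le> v \<and> v \<le> b then \<phi> * path_map Y a v else 0\<^sub>m 0 (vdim Y v)) * h v = 1\<^sub>m (vdim (ivl a b) v)"
  proof (cases "a \<le> v \<and> v \<le> b")
    case True
    have "\<phi> * path_map Y a v * h v = \<phi> * ((path_map Y a v * path_map Y v b) * h b)"
      using True ab \<phi> path_map_dim[OF Y, of a v] path_map_dim[OF Y, of v b] lq_rep_homD(2,3)[OF h, of b]
        rep_hom_from_ivlD(1)[OF Y h ab, of v] by (simp add: mat_assoc)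
    also have "\<dots> = \<phi> * h a"
      using path_map_trans[OF Y, of a v b] rep_hom_from_ivlD(1)[OF Y h ab, of a] True ab by simp
    finally show ?thesis using True one by (simp add: vdim_ivl)
  next
    case False
    thus ?thesis using lq_rep_homD(2,3)[OF h v] by (auto simp: vdim_ivl mat_eq_iff)
  qed
qed

lemma split_epi_to_ivl:
  assumes X: "is_rep (linear_quiver n) X" and h: "h \<in> rep_hom (linear_quiver n) X (ivl a b)"
    and ab: "1 \<le> a" "a \<le> b" "b \<le> n" and y: "y \<in> carrier_mat (vdim X b) 1"
    and kill: "1 < a \<Longrightarrow> path_map X (a - 1) b * y = 0\<^sub>m (vdim X (a - 1)) 1"
    and one: "h b * y = 1\<^sub>m 1"
  shows "split_epi (linear_quiver n) X (ivl a b) h"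
  unfolding split_epi_def
proof (intro conjI h bexI[OF _ rep_hom_from_ivl[OF X y ab(1,3) kill]] ballI)
  fix v assume "v \<in> verts (linear_quiver n)"
  hence v: "1 \<le> v" "v \<le> n" by auto
  show "h v * (if a \<le> v \<and> v \<le> b then path_map X v b * y else 0\<^sub>m (vdim X v) 0) = 1\<^sub>m (vdim (ivl a b) v)"
  proof (cases "a \<le> v \<and> v \<le> b")
    case True
    have "h v * (path_map X v b * y) = (h v * path_map X v b) * y"
      using True ab y path_map_dim[OF X, of v b] lq_rep_homD(2,3)[OF h v] by (simp add: mat_assoc)
    also have "h v * path_map X v b = path_map (ivl a b) v b * h b"
      by (rule path_map_hom[OF X is_rep_ivl h]) (use True v ab in auto)
    also have "\<dots> = h b" using True ab lq_rep_homD(2,3)[OF h, of b] by (simp add: path_map_ivl vdim_ivl)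
    finally show ?thesis using True one by (simp add: vdim_ivl)
  next
    case False
    thus ?thesis using lq_rep_homD(2,3)[OF h v] by (auto simp: vdim_ivl mat_eq_iff)
  qed
qed

text \<open>
  A map from \<open>ivl a b\<close> to \<open>Y\<close> is given by a vector at \<open>b\<close>. If its image at \<open>a\<close> does not come from
  \<open>b + 1\<close>, a functional separates the two and splits the map; otherwise a preimage at \<open>b + 1\<close> gives
  the part factoring through \<open>ivl a (b + 1)\<close>, and the rest vanishes at \<open>a\<close>.
\<close>

lemma not_split_mono_from_ivl_factor:
  fixes Y :: "(nat, nat, 'k::field) qrep"
  assumes Y: "is_rep (linear_quiver n) Y" and h: "h \<in> rep_hom (linear_quiver n) (ivl a b) Y"
    and ab: "1 \<le> a" "a \<le> b" "b < n" and ns: "\<not> split_mono (linear_quiver n) (ivl a b) Y h"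
  obtains h1 h2 where "h1 \<in> rep_hom (linear_quiver n) (ivl a (b + 1)) Y"
    "h2 \<in> rep_hom (linear_quiver n) (ivl (a + 1) b) Y"
    "\<And>v. v \<in> verts (linear_quiver n) \<Longrightarrow> h v = h1 v * ivl_hom a b a (b + 1) v + h2 v * ivl_hom a b (a + 1) b v"
proof -
  have bn: "b \<le> n" using ab by simp
  have pc: "path_map Y a (b + 1) \<in> carrier_mat (vdim Y a) (vdim Y (b + 1))"
    by (rule path_map_carrier[OF Y]) (use ab in auto)
  have hc: "h v \<in> carrier_mat (vdim Y v) 1" if "a \<le> v" "v \<le> b" for v
    using lq_rep_homD(1)[OF h, of v] that ab by (simp add: vdim_ivl)
  note hv = rep_hom_from_ivlD(1)[OF Y h ab(1,2) bn]
  obtain w where w: "w \<in> carrier_mat (vdim Y (b + 1)) 1" "path_map Y a (b + 1) * w = h a"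
    using fredholm_alternative[OF pc hc[OF order_refl ab(2)]] split_mono_from_ivl[OF Y h ab(1,2) bn] ns by blast
  \<comment> \<open>What remains of the generator after the part from \<open>b + 1\<close> is
    removed; it dies at \<open>a\<close>, as a map out of \<open>ivl (a + 1) b\<close>
    requires.\<close>
  define y where "y = h b - path_map Y b (b + 1) * w"
  have yc: "y \<in> carrier_mat (vdim Y b) 1"
    using hc[of b] w path_map_carrier[OF Y, of b "b + 1"] ab unfolding y_def by (intro minus_carrier_mat) auto
  have tr: "path_map Y v b * (path_map Y b (b + 1) * w) = path_map Y v (b + 1) * w" if "1 \<le> v" "v \<le> b" for v
    using path_map_trans[OF Y, of v b "b + 1"] path_map_dim[OF Y, of v b] path_map_dim[OF Y, of b "b + 1"] that ab w
    by (simp add: mat_assoc[symmetric] del: path_map.simps)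
  have py: "path_map Y v b * y = h v - path_map Y v (b + 1) * w" if "a \<le> v" "v \<le> b" for v
    using tr[of v] hv[OF that] hc[of b] path_map_dim[OF Y, of v b] path_map_dim[OF Y, of b "b + 1"] that ab w
    unfolding y_def by (simp add: mat_diff_distrib_left del: path_map.simps)
  let ?h1 = "\<lambda>v. if a \<le> v \<and> v \<le> b + 1 then path_map Y v (b + 1) * w else 0\<^sub>m (vdim Y v) 0"
  let ?h2 = "\<lambda>v. if a + 1 \<le> v \<and> v \<le> b then path_map Y v b * y else 0\<^sub>m (vdim Y v) 0"
  have h1: "?h1 \<in> rep_hom (linear_quiver n) (ivl a (b + 1)) Y"
  proof (rule rep_hom_from_ivl[OF Y w(1)])
    \<comment> \<open>The vector \<open>w\<close> and the generator \<open>h b\<close> have the same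
      image at \<open>a\<close>, hence also at \<open>a - 1\<close>, where the generator
      dies.\<close>
    assume a1: "1 < a"
    define c where "c = a - 1"
    have c: "1 \<le> c" "c \<le> a" "a - 1 = c" using a1 by (auto simp: c_def)
    have e1: "path_map Y c (b + 1) = path_map Y c a * path_map Y a (b + 1)"
      by (rule path_map_trans[OF Y c(1,2), symmetric]) (use ab in auto)
    have e2: "path_map Y c b = path_map Y c a * path_map Y a b"
      by (rule path_map_trans[OF Y c(1,2), symmetric]) (use ab in auto)
    have dc: "dim_col (path_map Y c a) = vdim Y a" using path_map_dim[OF Y c(1,2)] ab by simp
    have "path_map Y c (b + 1) * w = path_map Y c a * (path_map Y a (b + 1) * w)"
      unfolding e1 by (rule mat_assoc) (use dc pc w(1) in auto)
    also have "\<dots> = path_map Y c a * (path_map Y a b * h b)" using w hv[of a] ab by simp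
    also have "\<dots> = path_map Y c b * h b"
      unfolding e2 by (rule mat_assoc[symmetric]) (use dc path_map_dim[OF Y, of a b] ab hc[of b] in auto)
    also have "\<dots> = 0\<^sub>m (vdim Y c) 1"
      using rep_hom_from_ivlD(2)[OF Y h ab(1,2) bn a1] c by simp
    finally show "path_map Y (a - 1) (b + 1) * w = 0\<^sub>m (vdim Y (a - 1)) 1" using c by simp
  qed (use ab in auto)
  have h2: "?h2 \<in> rep_hom (linear_quiver n) (ivl (a + 1) b) Y"
  proof (rule rep_hom_from_ivl[OF Y yc])
    show "path_map Y (a + 1 - 1) b * y = 0\<^sub>m (vdim Y (a + 1 - 1)) 1"
      using py[of a] w(2) hc[of a] ab by simp
  qed (use ab in auto)
  define k1 where "k1 = ?h1"
  define k2 where "k2 = ?h2"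
  have k1: "k1 \<in> rep_hom (linear_quiver n) (ivl a (b + 1)) Y" and k2: "k2 \<in> rep_hom (linear_quiver n) (ivl (a + 1) b) Y"
    using h1 h2 by (simp_all only: k1_def k2_def)
  have k1v: "k1 v = path_map Y v (b + 1) * w" if "a \<le> v" "v \<le> b" for v
    using that by (simp add: k1_def)
  have k2v: "k2 v = h v - path_map Y v (b + 1) * w" if "a + 1 \<le> v" "v \<le> b" for v
    using that py[of v] by (simp add: k2_def del: path_map.simps)
  have eq: "h v = k1 v * ivl_hom a b a (b + 1) v + k2 v * ivl_hom a b (a + 1) b v"
    if "v \<in> verts (linear_quiver n)" for v
  proof -
    have v: "1 \<le> v" "v \<le> n" using that by auto
    note d = lq_rep_homD(2,3)[OF h v] lq_rep_homD(2,3)[OF k1 v] lq_rep_homD(2,3)[OF k2 v]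
    consider "a + 1 \<le> v" "v \<le> b" | "v = a" | "\<not> (a \<le> v \<and> v \<le> b)" using ab by linarith
    thus ?thesis
    proof cases
      case 1
      hence "k1 v * ivl_hom a b a (b + 1) v = k1 v" "k2 v * ivl_hom a b (a + 1) b v = k2 v"
        using d by (simp_all add: ivl_hom_one vdim_ivl)
      moreover have "k1 v + k2 v = h v"
      proof -
        have "P + (M - P) = M" if "dim_row P = dim_row M" "dim_col P = dim_col M" for P M :: "'k mat"
          using that by (auto simp: mat_eq_iff)
        moreover have "k2 v = h v - k1 v" using k1v[of v] k2v[of v] 1 by simp
        ultimately show ?thesis using d 1 by (simp add: vdim_ivl)
      qed
      ultimately show ?thesis by simp
    next
      case 2
      hence A: "k1 v * ivl_hom a b a (b + 1) v = k1 v" using d ab by (simp add: ivl_hom_one vdim_ivl)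
      have B: "k2 v * ivl_hom a b (a + 1) b v = 0\<^sub>m (vdim Y v) 1"
        using 2 ab d by (simp add: ivl_hom_def vdim_ivl)
      have C: "k1 v = h v" using k1v[of v] w(2) 2 ab by simp
      show ?thesis unfolding A B using C d 2 ab by (simp add: vdim_ivl)
    next
      case 3
      hence z: "vdim (ivl a b :: (nat, nat, 'k) qrep) v = 0" by (auto simp: vdim_ivl)
      show ?thesis by (rule mat_eq_no_cols) (use d z in simp_all)
    qed
  qed
  show thesis by (rule that[OF k1 k2 eq])
qed

text \<open>Dual to the previous factorisation, with the lower end written \<open>a + 1\<close> so
  that the vertex \<open>a\<close> exists. If the functional \<open>h b\<close> does not factor
  through the path map to \<open>a\<close>, a vector at \<open>b\<close> that dies at
  \<open>a\<close> splits \<open>h\<close>. Otherwise the remainder vanishes at \<open>b\<close>,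
  and so lands in \<open>ivl (a + 1) (b - 1)\<close>, which is zero for
  \<open>b = a + 1\<close>.\<close>

lemma not_split_epi_to_ivl_factor:
  fixes X :: "(nat, nat, 'k::field) qrep"
  assumes X: "is_rep (linear_quiver n) X" and h: "h \<in> rep_hom (linear_quiver n) X (ivl (a + 1) b)"
    and ab: "1 \<le> a" "a + 1 \<le> b" "b \<le> n" and ns: "\<not> split_epi (linear_quiver n) X (ivl (a + 1) b) h"
  obtains h1 h2 where "h1 \<in> rep_hom (linear_quiver n) X (ivl a b)"
    "h2 \<in> rep_hom (linear_quiver n) X (ivl (a + 1) (b - 1))"
    "\<And>v. v \<in> verts (linear_quiver n) \<Longrightarrow> h v = ivl_hom a b (a + 1) b v * h1 v + ivl_hom (a + 1) (b - 1) (a + 1) b v * h2 v"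
proof -
  have a1: "1 \<le> a + 1" by simp
  have pc: "path_map X a b \<in> carrier_mat (vdim X a) (vdim X b)"
    by (rule path_map_carrier[OF X]) (use ab in auto)
  have hc: "h v \<in> carrier_mat 1 (vdim X v)" if "a + 1 \<le> v" "v \<le> b" for v
    using lq_rep_homD(1)[OF h, of v] that ab by (simp add: vdim_ivl)
  note hv = rep_hom_to_ivlD(1)[OF X h a1 ab(2,3)]
  have se: "split_epi (linear_quiver n) X (ivl (a + 1) b) h"
    if "y \<in> carrier_mat (vdim X b) 1" "path_map X a b * y = 0\<^sub>m (vdim X a) 1" "h b * y = 1\<^sub>m 1" for y
    by (rule split_epi_to_ivl[OF X h a1 ab(2,3) that(1) _ that(3)]) (use that(2) in simp)
  obtain w where w: "w \<in> carrier_mat 1 (vdim X a)" "w * path_map X a b = h b"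
    using fredholm_alternative_rows[OF pc hc[OF ab(2) order_refl]] se ns by blast
  define y where "y = h (a + 1) - w * path_map X a (a + 1)"
  have pa: "dim_row (path_map X a (a + 1)) = vdim X a" "dim_col (path_map X a (a + 1)) = vdim X (a + 1)"
    using path_map_dim[OF X, of a "a + 1"] ab by auto
  have yc: "y \<in> carrier_mat 1 (vdim X (a + 1))"
    using hc[of "a + 1"] w pa ab unfolding y_def by (intro minus_carrier_mat) auto
  have py: "y * path_map X (a + 1) v = h v - w * path_map X a v" if "a + 1 \<le> v" "v \<le> b" for v
  proof -
    have "y * path_map X (a + 1) v = h (a + 1) * path_map X (a + 1) v - w * (path_map X a (a + 1) * path_map X (a + 1) v)"
      using hc[of "a + 1"] w pa path_map_dim[OF X, of "a + 1" v] that ab unfolding y_def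
      by (simp add: mat_diff_distrib_right mat_assoc del: path_map.simps)
    thus ?thesis using path_map_trans[OF X, of a "a + 1" v] hv[OF that] that ab by (simp del: path_map.simps)
  qed
  let ?h1 = "\<lambda>v. if a \<le> v \<and> v \<le> b then w * path_map X a v else 0\<^sub>m 0 (vdim X v)"
  let ?h2 = "\<lambda>v. if a + 1 \<le> v \<and> v \<le> b - 1 then y * path_map X (a + 1) v else 0\<^sub>m 0 (vdim X v)"
  have h1: "?h1 \<in> rep_hom (linear_quiver n) X (ivl a b)"
  proof (rule rep_hom_to_ivl[OF X w(1) ab(1,3)])
    assume bn: "b < n"
    have pb: "dim_row (path_map X b (b + 1)) = vdim X b" "dim_col (path_map X b (b + 1)) = vdim X (b + 1)"
      using path_map_dim[OF X, of b "b + 1"] ab bn by auto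
    have "w * path_map X a (b + 1) = w * (path_map X a b * path_map X b (b + 1))"
      using path_map_trans[OF X, of a b "b + 1"] ab bn by (simp del: path_map.simps)
    also have "\<dots> = (w * path_map X a b) * path_map X b (b + 1)"
      using w(1) pc pb by (simp add: mat_assoc del: path_map.simps)
    also have "\<dots> = h (a + 1) * path_map X (a + 1) b * path_map X b (b + 1)" using w(2) hv[of b] ab by simp
    also have "\<dots> = h (a + 1) * (path_map X (a + 1) b * path_map X b (b + 1))"
      using pb hc[of "a + 1"] path_map_dim[OF X, of "a + 1" b] ab by (simp add: mat_assoc del: path_map.simps)
    also have "\<dots> = h (a + 1) * path_map X (a + 1) (b + 1)"
      using path_map_trans[OF X, of "a + 1" b "b + 1"] ab bn by (simp del: path_map.simps)
    also have "\<dots> = 0\<^sub>m 1 (vdim X (b + 1))" by (rule rep_hom_to_ivlD(2)[OF X h a1 ab(2,3) bn])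
    finally show "w * path_map X a (b + 1) = 0\<^sub>m 1 (vdim X (b + 1))" .
  qed
  have h2: "?h2 \<in> rep_hom (linear_quiver n) X (ivl (a + 1) (b - 1))"
  proof (rule rep_hom_to_ivl[OF X yc])
    have "y * path_map X (a + 1) b = 0\<^sub>m 1 (vdim X b)"
      using py[of b] w(2) hc[of b] ab by simp
    thus "y * path_map X (a + 1) (b - 1 + 1) = 0\<^sub>m 1 (vdim X (b - 1 + 1))" using ab by simp
  qed (use ab in auto)
  define k1 where "k1 = ?h1"
  define k2 where "k2 = ?h2"
  have k1: "k1 \<in> rep_hom (linear_quiver n) X (ivl a b)" and k2: "k2 \<in> rep_hom (linear_quiver n) X (ivl (a + 1) (b - 1))"
    using h1 h2 by (simp_all only: k1_def k2_def)
  have k1v: "k1 v = w * path_map X a v" if "a \<le> v" "v \<le> b" for v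
    using that by (simp add: k1_def)
  have k2v: "k2 v = h v - w * path_map X a v" if "a + 1 \<le> v" "v \<le> b - 1" "v \<le> b" for v
    using that py[of v] by (simp add: k2_def del: path_map.simps)
  have eq: "h v = ivl_hom a b (a + 1) b v * k1 v + ivl_hom (a + 1) (b - 1) (a + 1) b v * k2 v"
    if "v \<in> verts (linear_quiver n)" for v
  proof -
    have v: "1 \<le> v" "v \<le> n" using that by auto
    note d = lq_rep_homD(2,3)[OF h v] lq_rep_homD(2,3)[OF k1 v] lq_rep_homD(2,3)[OF k2 v]
    consider "a + 1 \<le> v" "v \<le> b - 1" "v \<le> b" | "v = b" "\<not> v \<le> b - 1" | "\<not> (a + 1 \<le> v \<and> v \<le> b)" using ab by linarith
    thus ?thesis
    proof cases
      case 1
      hence "ivl_hom a b (a + 1) b v * k1 v = k1 v" "ivl_hom (a + 1) (b - 1) (a + 1) b v * k2 v = k2 v"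
        using d by (simp_all add: ivl_hom_one vdim_ivl)
      moreover have "k1 v + k2 v = h v"
      proof -
        have "P + (M - P) = M" if "dim_row P = dim_row M" "dim_col P = dim_col M" for P M :: "'k mat"
          using that by (auto simp: mat_eq_iff)
        moreover have "k2 v = h v - k1 v" using k1v[of v] k2v[of v] 1 by simp
        ultimately show ?thesis using d 1 by (simp add: vdim_ivl)
      qed
      ultimately show ?thesis by simp
    next
      case 2
      hence A: "ivl_hom a b (a + 1) b v * k1 v = k1 v" using d ab by (simp add: ivl_hom_one vdim_ivl)
      have B: "ivl_hom (a + 1) (b - 1) (a + 1) b v * k2 v = 0\<^sub>m 1 (vdim X v)"
        using 2 ab d by (simp add: ivl_hom_def vdim_ivl)
      have C: "k1 v = h v" using k1v[of v] w(2) 2 ab by simp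
      show ?thesis unfolding A B using C d 2 ab by (simp add: vdim_ivl)
    next
      case 3
      hence z: "vdim (ivl (a + 1) b :: (nat, nat, 'k) qrep) v = 0" by (auto simp: vdim_ivl)
      show ?thesis by (rule mat_eq_no_rows) (use d z in simp_all)
    qed
  qed
  show thesis by (rule that[OF k1 k2 eq])
qed

text \<open>Compare \<open>f v\<close> along the path from \<open>v\<close> to \<open>a'\<close>,
  which leaves the source but not the target, or along the path from \<open>b\<close> to
  \<open>v\<close>, which starts in the source but outside the target. So a nonzero morphism moves
  both ends weakly upwards.\<close>

lemma ivl_hom_zero:
  fixes f :: "nat \<Rightarrow> 'k::field mat"
  assumes f: "f \<in> rep_hom (linear_quiver n) (ivl a b) (ivl a' b')"
    and ab: "1 \<le> a'" "b \<le> n" "a' < a \<or> b' < b" and v: "1 \<le> v" "v \<le> n"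
  shows "f v = 0\<^sub>m (vdim (ivl a' b' :: (nat, nat, 'k) qrep) v) (vdim (ivl a b :: (nat, nat, 'k) qrep) v)"
proof (cases "(a \<le> v \<and> v \<le> b) \<and> (a' \<le> v \<and> v \<le> b')")
  case False
  thus ?thesis using lq_rep_homD(2,3)[OF f v] by (auto simp: mat_eq_iff vdim_ivl)
next
  case True
  note d = lq_rep_homD(2,3)[OF f v]
  show ?thesis
  proof (cases "a' < a")
    case lt: True
    have "f a' * path_map (ivl a b) a' v = 0\<^sub>m 1 1"
      using mat_mult_inner_zero[of "f a'" "path_map (ivl a b) a' v"] lq_rep_homD(2,3)[OF f, of a'] lt True ab v
      by (simp add: vdim_ivl path_map_ivl_dim)
    moreover have "f a' * path_map (ivl a b) a' v = path_map (ivl a' b') a' v * f v"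
      by (rule path_map_hom[OF is_rep_ivl is_rep_ivl f]) (use lt True ab v in auto)
    ultimately show ?thesis using True d by (simp add: vdim_ivl path_map_ivl)
  next
    case False
    hence lt: "b' < b" using ab by simp
    have "path_map (ivl a' b') v b * f b = 0\<^sub>m 1 1"
      using mat_mult_inner_zero[of "path_map (ivl a' b') v b" "f b"] lq_rep_homD(2,3)[OF f, of b] lt True ab v
      by (simp add: vdim_ivl path_map_ivl_dim)
    moreover have "f v * path_map (ivl a b) v b = path_map (ivl a' b') v b * f b"
      by (rule path_map_hom[OF is_rep_ivl is_rep_ivl f]) (use lt True ab v in auto)
    ultimately show ?thesis using True d by (simp add: vdim_ivl path_map_ivl)
  qed
qed

text \<open>The map and its retraction are both nonzero at \<open>a\<close>, and nonzero morphisms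
  move the ends weakly upwards, so the ends agree.\<close>

lemma split_mono_ivl_hom_imp:
  assumes sm: "split_mono (linear_quiver n) (ivl a b) (ivl a' b' :: (nat, nat, 'k::field) qrep) f"
    and ab: "1 \<le> a" "a \<le> b" "b \<le> n" "1 \<le> a'" "b' \<le> n"
  shows "a = a' \<and> b = b'"
proof -
  from sm obtain g where f: "f \<in> rep_hom (linear_quiver n) (ivl a b) (ivl a' b')"
    and g: "g \<in> rep_hom (linear_quiver n) (ivl a' b') (ivl a b)"
    and gf: "\<And>v. 1 \<le> v \<Longrightarrow> v \<le> n \<Longrightarrow> g v * f v = 1\<^sub>m (vdim (ivl a b :: (nat, nat, 'k) qrep) v)"
    unfolding split_mono_def by auto
  have nz: "vdim (ivl a' b' :: (nat, nat, 'k) qrep) v \<noteq> 0 \<and> g v \<noteq> 0\<^sub>m 1 1 \<and> f v \<noteq> 0\<^sub>m 1 1" if "a \<le> v" "v \<le> b" for v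
  proof -
    have v: "1 \<le> v" "v \<le> n" using that ab by auto
    have 1: "g v * f v = 1\<^sub>m 1" using gf[OF v] that by (simp add: vdim_ivl)
    have "(1\<^sub>m 1 :: 'k mat) \<noteq> 0\<^sub>m 1 1" by (rule one_mat_neq_zero) simp
    thus ?thesis
      using 1 lq_rep_homD(2,3)[OF f v] lq_rep_homD(2,3)[OF g v] mat_mult_inner_zero[of "g v" "f v"] that
      by (auto simp: vdim_ivl split: if_splits)
  qed
  have av: "1 \<le> a" "a \<le> n" and d1: "vdim (ivl a b :: (nat, nat, 'k) qrep) a = 1" "vdim (ivl a' b' :: (nat, nat, 'k) qrep) a = 1"
    using nz[of a] ab by (auto simp: vdim_ivl split: if_splits)
  have "\<not> (a < a' \<or> b < b')" using ivl_hom_zero[OF g ab(1,5) _ av] nz[of a] ab unfolding d1 by blast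
  moreover have "\<not> (a' < a \<or> b' < b)" using ivl_hom_zero[OF f ab(4,3) _ av] nz[of a] ab unfolding d1 by blast
  ultimately show ?thesis by auto
qed

lemma split_epi_ivl_hom_imp:
  assumes se: "split_epi (linear_quiver n) (ivl a b) (ivl a' b' :: (nat, nat, 'k::field) qrep) f"
    and ab: "1 \<le> a" "b \<le> n" "1 \<le> a'" "a' \<le> b'" "b' \<le> n"
  shows "a = a' \<and> b = b'"
proof -
  from se obtain g where f: "f \<in> rep_hom (linear_quiver n) (ivl a b) (ivl a' b')"
    and g: "g \<in> rep_hom (linear_quiver n) (ivl a' b') (ivl a b)"
    and fg: "\<And>v. v \<in> verts (linear_quiver n) \<Longrightarrow> f v * g v = 1\<^sub>m (vdim (ivl a' b' :: (nat, nat, 'k) qrep) v)"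
    unfolding split_epi_def by auto
  have "split_mono (linear_quiver n) (ivl a' b') (ivl a b :: (nat, nat, 'k) qrep) g"
    unfolding split_mono_def using f g fg by blast
  from split_mono_ivl_hom_imp[OF this] ab show ?thesis by auto
qed

text \<open>If \<open>h\<close> does not split, it is a sum of a part through
  \<open>ivl a (b + 1)\<close> and a part through \<open>ivl (a + 1) b\<close>. At the vertex
  \<open>a\<close> only the first is left, so \<open>g\<close> after \<open>h1\<close> is an
  endomorphism that is the identity at \<open>a\<close>, hence everywhere.\<close>

lemma irreducible_ivl_incl:
  assumes ab: "1 \<le> a" "a \<le> b" "b < n"
  shows "irreducible_hom (linear_quiver n) (ivl a b) (ivl a (b + 1) :: (nat, nat, 'k::field) qrep) (ivl_hom a b a (b + 1))"
  unfolding irreducible_hom_def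
proof (intro conjI allI impI)
  let ?f = "ivl_hom a b a (b + 1) :: nat \<Rightarrow> 'k mat"
  show f: "?f \<in> rep_hom (linear_quiver n) (ivl a b) (ivl a (b + 1))" by (rule ivl_hom_in_rep_hom) auto
  show "\<not> split_mono (linear_quiver n) (ivl a b) (ivl a (b + 1)) ?f"
    using split_mono_ivl_hom_imp[of n a b a "b + 1" ?f] ab by auto
  show "\<not> split_epi (linear_quiver n) (ivl a b) (ivl a (b + 1)) ?f"
    using split_epi_ivl_hom_imp[of n a b a "b + 1" ?f] ab by auto
  fix Z g h assume Z: "is_rep (linear_quiver n) Z" and h: "h \<in> rep_hom (linear_quiver n) (ivl a b) Z"
    and g: "g \<in> rep_hom (linear_quiver n) Z (ivl a (b + 1))" and fac: "\<forall>v\<in>verts (linear_quiver n). ?f v = g v * h v"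
  show "split_mono (linear_quiver n) (ivl a b) Z h \<or> split_epi (linear_quiver n) Z (ivl a (b + 1)) g"
  proof (rule disj_imp[THEN iffD2], rule impI)
    assume "\<not> split_mono (linear_quiver n) (ivl a b) Z h"
    then obtain h1 h2 where h1: "h1 \<in> rep_hom (linear_quiver n) (ivl a (b + 1)) Z"
      and h2: "h2 \<in> rep_hom (linear_quiver n) (ivl (a + 1) b) Z"
      and hh: "\<And>v. v \<in> verts (linear_quiver n) \<Longrightarrow> h v = h1 v * ivl_hom a b a (b + 1) v + h2 v * ivl_hom a b (a + 1) b v"
      using not_split_mono_from_ivl_factor[OF Z h ab] by blast
    have k: "(\<lambda>v. g v * h1 v) \<in> rep_hom (linear_quiver n) (ivl a (b + 1)) (ivl a (b + 1))"
      by (rule lq.rep_hom_comp[OF is_rep_ivl Z is_rep_ivl h1 g])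
    have av: "1 \<le> a" "a \<le> n" using ab by auto
    have fa: "?f a = 1\<^sub>m 1" by (rule ivl_hom_one) (use ab in auto)
    have "h2 a * ivl_hom a b (a + 1) b a = 0\<^sub>m (vdim Z a) 1"
      using mat_mult_inner_zero[of "h2 a" "ivl_hom a b (a + 1) b a"] lq_rep_homD(2,3)[OF h2 av] ab by (simp add: vdim_ivl)
    hence "h a = h1 a" using hh[of a] lq_rep_homD(2,3)[OF h1 av] ab by (simp add: ivl_hom_one vdim_ivl)
    hence ga: "g a * h1 a = 1\<^sub>m 1" using fac[rule_format, of a] av ab fa by simp
    have "g v * h1 v = 1\<^sub>m (vdim (ivl a (b + 1) :: (nat, nat, 'k) qrep) v)" if "v \<in> verts (linear_quiver n)" for v
    proof (cases "a \<le> v \<and> v \<le> b + 1")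
      case True
      have "g v * h1 v = g (b + 1) * h1 (b + 1)" "g a * h1 a = g (b + 1) * h1 (b + 1)"
        using ivl_end_scalar[OF k, of v] ivl_end_scalar[OF k, of a] True ab by auto
      thus ?thesis using ga True by (simp add: vdim_ivl)
    next
      case False
      thus ?thesis using rep_homD(2,3)[OF k that] by (auto simp: vdim_ivl mat_eq_iff)
    qed
    thus "split_epi (linear_quiver n) Z (ivl a (b + 1)) g" unfolding split_epi_def using g h1 by blast
  qed
qed

text \<open>If \<open>g\<close> does not split, its second part passes through
  \<open>ivl (a + 1) (b - 1)\<close> and is invisible at \<open>b\<close>; so \<open>g1\<close>
  after \<open>h\<close> is the identity there, hence everywhere.\<close>

lemma irreducible_ivl_proj:
  assumes ab: "1 \<le> a" "a + 1 \<le> b" "b \<le> n"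
  shows "irreducible_hom (linear_quiver n) (ivl a b) (ivl (a + 1) b :: (nat, nat, 'k::field) qrep) (ivl_hom a b (a + 1) b)"
  unfolding irreducible_hom_def
proof (intro conjI allI impI)
  let ?f = "ivl_hom a b (a + 1) b :: nat \<Rightarrow> 'k mat"
  show f: "?f \<in> rep_hom (linear_quiver n) (ivl a b) (ivl (a + 1) b)" by (rule ivl_hom_in_rep_hom) auto
  show "\<not> split_mono (linear_quiver n) (ivl a b) (ivl (a + 1) b) ?f"
    using split_mono_ivl_hom_imp[of n a b "a + 1" b ?f] ab by auto
  show "\<not> split_epi (linear_quiver n) (ivl a b) (ivl (a + 1) b) ?f"
    using split_epi_ivl_hom_imp[of n a b "a + 1" b ?f] ab by auto
  fix Z g h assume Z: "is_rep (linear_quiver n) Z" and h: "h \<in> rep_hom (linear_quiver n) (ivl a b) Z"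
    and g: "g \<in> rep_hom (linear_quiver n) Z (ivl (a + 1) b)" and fac: "\<forall>v\<in>verts (linear_quiver n). ?f v = g v * h v"
  show "split_mono (linear_quiver n) (ivl a b) Z h \<or> split_epi (linear_quiver n) Z (ivl (a + 1) b) g"
  proof (rule disjCI)
    assume "\<not> split_epi (linear_quiver n) Z (ivl (a + 1) b) g"
    then obtain g1 g2 where g1: "g1 \<in> rep_hom (linear_quiver n) Z (ivl a b)"
      and g2: "g2 \<in> rep_hom (linear_quiver n) Z (ivl (a + 1) (b - 1))"
      and gg: "\<And>v. v \<in> verts (linear_quiver n) \<Longrightarrow>
        g v = ivl_hom a b (a + 1) b v * g1 v + ivl_hom (a + 1) (b - 1) (a + 1) b v * g2 v"
      using not_split_epi_to_ivl_factor[OF Z g ab] by blast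
    have k: "(\<lambda>v. g1 v * h v) \<in> rep_hom (linear_quiver n) (ivl a b) (ivl a b)"
      by (rule lq.rep_hom_comp[OF is_rep_ivl Z is_rep_ivl h g1])
    have bv: "1 \<le> b" "b \<le> n" using ab by auto
    have fb: "?f b = 1\<^sub>m 1" by (rule ivl_hom_one) (use ab in auto)
    have "ivl_hom (a + 1) (b - 1) (a + 1) b b * g2 b = 0\<^sub>m 1 (vdim Z b)"
      using mat_mult_inner_zero[of "ivl_hom (a + 1) (b - 1) (a + 1) b b" "g2 b"] lq_rep_homD(2,3)[OF g2 bv] ab by (simp add: vdim_ivl)
    hence "g b = g1 b" using gg[of b] lq_rep_homD(2,3)[OF g1 bv] bv ab by (simp add: ivl_hom_one vdim_ivl)
    hence gb: "g1 b * h b = 1\<^sub>m 1" using fac[rule_format, of b] bv ab fb by simp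
    have "g1 v * h v = 1\<^sub>m (vdim (ivl a b :: (nat, nat, 'k) qrep) v)" if "v \<in> verts (linear_quiver n)" for v
    proof (cases "a \<le> v \<and> v \<le> b")
      case True
      have "g1 v * h v = g1 b * h b" using ivl_end_scalar[OF k, of v] True ab by auto
      thus ?thesis using gb True by (simp add: vdim_ivl)
    next
      case False
      thus ?thesis using rep_homD(2,3)[OF k that] by (auto simp: vdim_ivl mat_eq_iff)
    qed
    thus "split_mono (linear_quiver n) (ivl a b) Z h" unfolding split_mono_def using h g1 by blast
  qed
qed

text \<open>A nonzero morphism with \<open>a < a'\<close> factors through
  \<open>ivl (a + 1) b\<close>, one with \<open>a = a'\<close> and \<open>b < b'\<close> through
  \<open>ivl a (b + 1)\<close>. Irreducibility makes a factor split, and split maps between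
  intervals join equal intervals. For equal ends the morphism is a nonzero scalar, which
  splits.\<close>

lemma irreducible_ivl_imp:
  fixes f :: "nat \<Rightarrow> 'k::field mat"
  assumes irr: "irreducible_hom (linear_quiver n) (ivl a b) (ivl a' b') f"
    and ab: "1 \<le> a" "a \<le> b" "b \<le> n" "1 \<le> a'" "a' \<le> b'" "b' \<le> n"
  shows "a' = a + 1 \<and> b' = b \<or> a' = a \<and> b' = b + 1"
proof -
  let ?Q = "linear_quiver n" and ?X = "ivl a b :: (nat, nat, 'k) qrep" and ?Y = "ivl a' b' :: (nat, nat, 'k) qrep"
  have f: "f \<in> rep_hom ?Q ?X ?Y" and nm: "\<not> split_mono ?Q ?X ?Y f"
    and irrD: "\<And>Z g h. is_rep ?Q Z \<Longrightarrow> h \<in> rep_hom ?Q ?X Z \<Longrightarrow> g \<in> rep_hom ?Q Z ?Y \<Longrightarrow>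
        (\<forall>v\<in>verts ?Q. f v = g v * h v) \<Longrightarrow> split_mono ?Q ?X Z h \<or> split_epi ?Q Z ?Y g"
    using irr unfolding irreducible_hom_def by blast+
  note fv = rep_hom_from_ivlD(1)[OF is_rep_ivl f ab(1-3)]
  have fb: "dim_row (f b) = vdim ?Y b" "dim_col (f b) = 1"
    using lq_rep_homD(2,3)[OF f, of b] ab by (auto simp: vdim_ivl)
  have nonzero: "\<exists>v. 1 \<le> v \<and> v \<le> n \<and> f v \<noteq> 0\<^sub>m (vdim ?Y v) (vdim ?X v)"
  proof (rule ccontr)
    assume "\<not> ?thesis"
    hence 0: "f v = 0\<^sub>m (vdim ?Y v) (vdim ?X v)" if "1 \<le> v" "v \<le> n" for v using that by blast
    \<comment> \<open>The zero representation: a zero map factors through it, and neither factor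
      splits.\<close>
    let ?Z = "ivl 1 0 :: (nat, nat, 'k) qrep"
    have "split_mono ?Q ?X ?Z (\<lambda>v. 0\<^sub>m (vdim ?Z v) (vdim ?X v)) \<or> split_epi ?Q ?Z ?Y (\<lambda>v. 0\<^sub>m (vdim ?Y v) (vdim ?Z v))"
      by (rule irrD[OF is_rep_ivl lq.rep_hom_zero[OF is_rep_ivl is_rep_ivl] lq.rep_hom_zero[OF is_rep_ivl is_rep_ivl]])
        (use 0 in auto)
    thus False
      using split_mono_ivl_hom_imp[of n a b 1 0] split_epi_ivl_hom_imp[of n 1 0 a' b'] ab by force
  qed
  have le: "a \<le> a'" "b \<le> b'"
    using nonzero ivl_hom_zero[OF f ab(4,3)] by (meson not_le)+
  consider "a < a'" | "a = a'" "b < b'" | "a = a'" "b = b'" using le by linarith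
  thus ?thesis
  proof cases
    case 1
    let ?Z = "ivl (a + 1) b :: (nat, nat, 'k) qrep"
    let ?g = "\<lambda>v. if a + 1 \<le> v \<and> v \<le> b then path_map ?Y v b * f b else 0\<^sub>m (vdim ?Y v) 0"
    have Ya: "vdim ?Y a = 0" using 1 by (simp add: vdim_ivl)
    have fbc: "f b \<in> carrier_mat (vdim ?Y b) 1" by (rule carrier_matI) (rule fb)+
    have g: "?g \<in> rep_hom ?Q ?Z ?Y"
    proof (rule rep_hom_from_ivl[OF is_rep_ivl])
      show "path_map ?Y (a + 1 - 1) b * f b = 0\<^sub>m (vdim ?Y (a + 1 - 1)) 1"
        using mat_no_rows[of "path_map ?Y a b * f b"] Ya ab fb by (simp add: path_map_ivl_dim)
    qed (use fbc ab in auto)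
    have "split_mono ?Q ?X ?Z (ivl_hom a b (a + 1) b) \<or> split_epi ?Q ?Z ?Y ?g"
    proof (rule irrD[OF is_rep_ivl ivl_hom_in_rep_hom g])
      show "\<forall>v\<in>verts ?Q. f v = ?g v * ivl_hom a b (a + 1) b v"
      proof
        fix v assume "v \<in> verts ?Q"
        hence v: "1 \<le> v" "v \<le> n" by auto
        show "f v = ?g v * ivl_hom a b (a + 1) b v"
        proof (cases "a + 1 \<le> v \<and> v \<le> b")
          case True
          hence o: "ivl_hom a b (a + 1) b v = (1\<^sub>m 1 :: 'k mat)" by (intro ivl_hom_one) auto
          have "f v = path_map ?Y v b * f b" by (rule fv) (use True in auto)
          thus ?thesis unfolding o using True fb by simp
        next
          case False
          thus ?thesis using lq_rep_homD(2,3)[OF f v] Ya by (cases "v = a") (auto simp: mat_eq_iff vdim_ivl)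
        qed
      qed
    qed auto
    thus ?thesis
      using split_mono_ivl_hom_imp[of n a b "a + 1" b] split_epi_ivl_hom_imp[of n "a + 1" b a' b' ?g] ab by auto
  next
    case 2
    let ?Z = "ivl a (b + 1) :: (nat, nat, 'k) qrep"
    let ?g = "\<lambda>v. if a \<le> v \<and> v \<le> b + 1 then path_map ?Y v (b + 1) * f b else 0\<^sub>m (vdim ?Y v) 0"
    have fb1: "f b \<in> carrier_mat (vdim ?Y (b + 1)) 1" 
      by (rule carrier_matI) (use fb 2 ab in \<open>simp_all add: vdim_ivl\<close>)
    have g: "?g \<in> rep_hom ?Q ?Z ?Y"
    proof (rule rep_hom_from_ivl[OF is_rep_ivl fb1])
      assume a1: "1 < a"
      hence "vdim ?Y (a - 1) = 0" using 2 by (auto simp: vdim_ivl)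
      thus "path_map ?Y (a - 1) (b + 1) * f b = 0\<^sub>m (vdim ?Y (a - 1)) 1"
        using mat_no_rows[of "path_map ?Y (a - 1) (b + 1) * f b"] a1 ab fb by (simp add: path_map_ivl_dim del: path_map.simps)
    qed (use ab 2 in auto)
    have "split_mono ?Q ?X ?Z (ivl_hom a b a (b + 1)) \<or> split_epi ?Q ?Z ?Y ?g"
    proof (rule irrD[OF is_rep_ivl ivl_hom_in_rep_hom g])
      show "\<forall>v\<in>verts ?Q. f v = ?g v * ivl_hom a b a (b + 1) v"
      proof
        fix v assume "v \<in> verts ?Q"
        hence v: "1 \<le> v" "v \<le> n" by auto
        show "f v = ?g v * ivl_hom a b a (b + 1) v"
        proof (cases "a \<le> v \<and> v \<le> b")
          case True
          hence o: "ivl_hom a b a (b + 1) v = (1\<^sub>m 1 :: 'k mat)" by (intro ivl_hom_one) auto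
          have "f v = path_map ?Y v b * f b" by (rule fv) (use True in auto)
          also have "path_map ?Y v b = 1\<^sub>m 1" by (rule path_map_ivl) (use True 2 in auto)
          finally have "f v = f b" using fb 2 ab by (simp add: vdim_ivl)
          moreover have "path_map ?Y v (b + 1) = 1\<^sub>m 1" by (rule path_map_ivl) (use True 2 in auto)
          ultimately show ?thesis unfolding o using True fb 2 ab by (simp add: vdim_ivl del: path_map.simps)
        next
          case False
          hence z: "vdim ?X v = 0" by (auto simp: vdim_ivl)
          show ?thesis by (rule mat_eq_no_cols) (use lq_rep_homD(2,3)[OF f v] lq_rep_homD(2)[OF g v] z in simp_all)
        qed
      qed
    qed auto
    thus ?thesis
      using split_mono_ivl_hom_imp[of n a b a "b + 1"] split_epi_ivl_hom_imp[of n a "b + 1" a' b' ?g] ab 2 by auto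
  next
    case 3
    define c where "c = f b $$ (0, 0)"
    have fbc: "f b \<in> carrier_mat 1 1" 
      by (rule carrier_matI) (use fb 3 ab in \<open>simp_all add: vdim_ivl\<close>)
    have fvb: "f v = f b" if "a \<le> v" "v \<le> b" for v
      using fv[OF that] 3 that fb by (simp add: path_map_ivl vdim_ivl)
    have "c \<noteq> 0"
    proof
      assume "c = 0"
      hence "f b = 0\<^sub>m 1 1" using eq_one_by_one[OF fbc, of "0\<^sub>m 1 1"] by (simp add: c_def)
      hence "f v = 0\<^sub>m (vdim ?Y v) (vdim ?X v)" if "1 \<le> v" "v \<le> n" for v
        using fvb[of v] lq_rep_homD(2,3)[OF f that] 3
        by (cases "a \<le> v \<and> v \<le> b") (auto simp: vdim_ivl mat_eq_iff)
      thus False using nonzero by blast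
    qed
    have "split_mono ?Q ?X ?Y f"
    proof (rule split_mono_from_ivl[OF is_rep_ivl f ab(1-3)])
      show "inverse c \<cdot>\<^sub>m 1\<^sub>m 1 \<in> carrier_mat 1 (vdim ?Y a)" using 3 ab by (simp add: vdim_ivl)
      show "inverse c \<cdot>\<^sub>m 1\<^sub>m 1 * f a = 1\<^sub>m 1"
        using fvb[of a] fbc ab \<open>c \<noteq> 0\<close> by (auto simp: mat_eq_iff scalar_prod_def c_def)
      show "inverse c \<cdot>\<^sub>m 1\<^sub>m 1 * path_map ?Y a (b + 1) = 0\<^sub>m 1 (vdim ?Y (b + 1))"
        using 3 ab path_map_ivl_dim[of a "b + 1" a' b'] by (auto simp: mat_eq_iff vdim_ivl simp del: path_map.simps)
    qed
    thus ?thesis using nm by simp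
  qed
qed

section \<open>Almost split sequences\<close>

definition ivl_class :: "nat \<Rightarrow> nat \<Rightarrow> nat \<Rightarrow> (nat, nat, 'k::field) qrep set" where
  "ivl_class n a b = iso_class (linear_quiver n) (ivl a b)"

text \<open>The commuting square of canonical maps, read as an exact sequence whose middle term is
  the sum of the two other corners. Its almost split properties are the two factorisation
  results.\<close>

lemma ivl_ar_sequence:
  assumes ab: "1 \<le> a" "a \<le> b" "b < n"
  shows "(ivl_class n a b, ivl_class n (a + 1) (b + 1) :: (nat, nat, 'k::field) qrep set) \<in> ar_translate (linear_quiver n)"
proof -
  let ?Q = "linear_quiver n"
  let ?A = "ivl a b :: (nat, nat, 'k) qrep" and ?C = "ivl (a + 1) (b + 1) :: (nat, nat, 'k) qrep"
  let ?Y = "ivl a (b + 1) :: (nat, nat, 'k) qrep" and ?Z = "ivl (a + 1) b :: (nat, nat, 'k) qrep"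
  \<comment> \<open>For \<open>a = b\<close> the second summand is zero.\<close>
  let ?B = "direct_sum [?Y, ?Z]"
  note Y = is_rep_ivl[of n a "b + 1", where ?'a = 'k] and Z = is_rep_ivl[of n "a + 1" b, where ?'a = 'k]
  have B: "is_rep ?Q ?B" and Bd: "vdim ?B v = vdim ?Y v + vdim ?Z v" for v using lq.direct_sum_pair[OF Y Z] by auto
  obtain i1 i2 p1 p2 where b: "i1 \<in> rep_hom ?Q ?Y ?B" "i2 \<in> rep_hom ?Q ?Z ?B"
    "p1 \<in> rep_hom ?Q ?B ?Y" "p2 \<in> rep_hom ?Q ?B ?Z"
    and b2: "\<And>v. v \<in> verts ?Q \<Longrightarrow> p1 v * i1 v = 1\<^sub>m (vdim ?Y v)"
    "\<And>v. v \<in> verts ?Q \<Longrightarrow> p2 v * i2 v = 1\<^sub>m (vdim ?Z v)"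
    "\<And>v. v \<in> verts ?Q \<Longrightarrow> p1 v * i2 v = 0\<^sub>m (vdim ?Y v) (vdim ?Z v)"
    "\<And>v. v \<in> verts ?Q \<Longrightarrow> p2 v * i1 v = 0\<^sub>m (vdim ?Z v) (vdim ?Y v)"
    "\<And>v. v \<in> verts ?Q \<Longrightarrow> i1 v * p1 v + i2 v * p2 v = 1\<^sub>m (vdim ?Y v + vdim ?Z v)"
    by (rule lq.direct_sum_biproduct[OF Y Z]) blast
  have dims: "dim_row (i1 v) = vdim ?Y v + vdim ?Z v" "dim_col (i1 v) = vdim ?Y v"
    "dim_row (i2 v) = vdim ?Y v + vdim ?Z v" "dim_col (i2 v) = vdim ?Z v"
    "dim_row (p1 v) = vdim ?Y v" "dim_col (p1 v) = vdim ?Y v + vdim ?Z v"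
    "dim_row (p2 v) = vdim ?Z v" "dim_col (p2 v) = vdim ?Y v + vdim ?Z v" if "v \<in> verts ?Q" for v
    using rep_homD(2,3)[OF b(1) that] rep_homD(2,3)[OF b(2) that] rep_homD(2,3)[OF b(3) that] rep_homD(2,3)[OF b(4) that] Bd by auto
  have c: "p1 v * (i1 v * M) = M" "p1 v * (i2 v * M') = 0\<^sub>m (vdim ?Y v) (dim_col M')"
    "p2 v * (i1 v * M) = 0\<^sub>m (vdim ?Z v) (dim_col M)" "p2 v * (i2 v * M') = M'"
    if "v \<in> verts ?Q" "dim_row M = vdim ?Y v" "dim_row M' = vdim ?Z v" for v and M M' :: "'k mat"
    using that dims[OF that(1)] b2[OF that(1)] by (simp_all add: mat_assoc[symmetric])
  define aY where "aY = (ivl_hom a b a (b + 1) :: nat \<Rightarrow> 'k mat)"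
  define aZ where "aZ = (ivl_hom a b (a + 1) b :: nat \<Rightarrow> 'k mat)"
  define cY where "cY = (ivl_hom a (b + 1) (a + 1) (b + 1) :: nat \<Rightarrow> 'k mat)"
  define cZ where "cZ = (ivl_hom (a + 1) b (a + 1) (b + 1) :: nat \<Rightarrow> 'k mat)"
  have hY: "aY \<in> rep_hom ?Q ?A ?Y" and hZ: "aZ \<in> rep_hom ?Q ?A ?Z"
    and gY: "cY \<in> rep_hom ?Q ?Y ?C" and gZ: "cZ \<in> rep_hom ?Q ?Z ?C"
    unfolding aY_def aZ_def cY_def cZ_def by (rule ivl_hom_in_rep_hom; simp)+
  have adims: "dim_row (aY v) = vdim ?Y v" "dim_col (aY v) = vdim ?A v" "dim_row (aZ v) = vdim ?Z v" "dim_col (aZ v) = vdim ?A v"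
    "dim_row (cY v) = vdim ?C v" "dim_col (cY v) = vdim ?Y v" "dim_row (cZ v) = vdim ?C v" "dim_col (cZ v) = vdim ?Z v" for v
    by (simp_all add: aY_def aZ_def cY_def cZ_def)
  define f where "f v = i1 v * aY v + i2 v * aZ v" for v
  \<comment> \<open>The sign turns the commuting square into a complex.\<close>
  define g where "g v = cY v * p1 v - cZ v * p2 v" for v
  have fh: "f \<in> rep_hom ?Q ?A ?B" unfolding f_def
    by (rule lq.rep_hom_add[OF is_rep_ivl B lq.rep_hom_comp[OF is_rep_ivl Y B hY b(1)] lq.rep_hom_comp[OF is_rep_ivl Z B hZ b(2)]])
  have gh: "g \<in> rep_hom ?Q ?B ?C" unfolding g_def
    by (rule lq.rep_hom_diff[OF B is_rep_ivl lq.rep_hom_comp[OF B Y is_rep_ivl b(3) gY] lq.rep_hom_comp[OF B Z is_rep_ivl b(4) gZ]])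
  have p1f: "p1 v * f v = aY v" and p2f: "p2 v * f v = aZ v" if "v \<in> verts ?Q" for v
    using dims[OF that] adims[of v] c[OF that, of "aY v" "aZ v"] by (simp_all add: f_def mat_distrib_left)
  have gi1: "g v * (i1 v * M) = cY v * M" and gi2: "g v * (i2 v * M') = - (cZ v * M')"
    if "v \<in> verts ?Q" "dim_row M = vdim ?Y v" "dim_row M' = vdim ?Z v" for v and M M' :: "'k mat"
  proof -
    have "g v * (i1 v * M) = cY v * (p1 v * (i1 v * M)) - cZ v * (p2 v * (i1 v * M))"
      using dims[OF that(1)] adims[of v] that by (simp add: g_def mat_diff_distrib_right mat_assoc)
    also have "\<dots> = cY v * M" using c[OF that] adims[of v] by (simp add: mat_diff_zero)
    finally show "g v * (i1 v * M) = cY v * M" .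
    have "g v * (i2 v * M') = cY v * (p1 v * (i2 v * M')) - cZ v * (p2 v * (i2 v * M'))"
      using dims[OF that(1)] adims[of v] that by (simp add: g_def mat_diff_distrib_right mat_assoc)
    also have "\<dots> = - (cZ v * M')" using c[OF that] adims[of v] by (simp add: mat_diff_zero)
    finally show "g v * (i2 v * M') = - (cZ v * M')" .
  qed
  \<comment> \<open>Splittings vertex by vertex. At \<open>a\<close> only the first summand is
    present; where both are present, the second projection for \<open>f'\<close> and the first
    inclusion for \<open>g'\<close> make the mixed terms \<open>i1 v * p2 v\<close> cancel.\<close>
  define f' where "f' v = (if v = a then ivl_hom a (b + 1) a b v * p1 v else ivl_hom (a + 1) b a b v * p2 v)" for v
  define g' where "g' v = i1 v * ivl_hom (a + 1) (b + 1) a (b + 1) v" for v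
  have short: "short_exact ?Q ?A ?B ?C f g"
  proof (rule short_exact_if_split[OF fh gh, of f' g'])
    fix v assume v: "v \<in> verts ?Q"
    show "f' v \<in> carrier_mat (vdim ?A v) (vdim ?B v)"
      using dims[OF v] Bd by (auto simp: f'_def intro!: carrier_matI)
    show "g' v \<in> carrier_mat (vdim ?B v) (vdim ?C v)"
      using dims[OF v] Bd by (auto simp: g'_def intro!: carrier_matI)
    note d = dims[OF v] adims[of v]
    have gf: "g v * f v = cY v * aY v - cZ v * aZ v"
    proof -
      have "g v * f v = g v * (i1 v * aY v) + g v * (i2 v * aZ v)"
        using d rep_homD(2,3)[OF gh v] Bd by (simp add: f_def mat_distrib_left)
      also have "\<dots> = cY v * aY v + - (cZ v * aZ v)" using gi1[OF v] gi2[OF v] d by simp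
      also have "\<dots> = cY v * aY v - cZ v * aZ v" using d by (auto simp: mat_eq_iff)
      finally show ?thesis .
    qed
    have gg: "g v * g' v = cY v * ivl_hom (a + 1) (b + 1) a (b + 1) v"
      unfolding g'_def using gi1[OF v, of "ivl_hom (a + 1) (b + 1) a (b + 1) v" "0\<^sub>m (vdim ?Z v) 0"] by simp
    consider "v = a" | "a + 1 \<le> v" "v \<le> b" | "v = b + 1" | "v < a \<or> b + 1 < v" by linarith
    hence "f' v * f v = 1\<^sub>m (vdim ?A v) \<and> g v * g' v = 1\<^sub>m (vdim ?C v) \<and>
      g v * f v = 0\<^sub>m (vdim ?C v) (vdim ?A v) \<and> f v * f' v + g' v * g v = 1\<^sub>m (vdim ?B v)"
    proof cases
      case 1
      have D: "vdim ?A v = 1" "vdim ?C v = 0" "vdim ?Y v = 1" "vdim ?Z v = 0" using 1 ab by (auto simp: vdim_ivl)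
      have e: "aY v = 1\<^sub>m 1" "ivl_hom a (b + 1) a b v = (1\<^sub>m 1 :: 'k mat)" using 1 ab by (auto simp: aY_def ivl_hom_one)
      have "f' v = ivl_hom a (b + 1) a b v * p1 v" using 1 by (simp only: f'_def simp_thms if_True)
      hence f'v: "f' v = p1 v" unfolding e(2) using d(5) D(3) by simp
      have z: "i2 v * aZ v = 0\<^sub>m 1 1" using d D mat_mult_inner_zero[of "i2 v" "aZ v"] by simp
      have fv: "f v = i1 v" unfolding f_def e(1) z using d(1,2) D(3,4) by simp
      have "i2 v * p2 v = 0\<^sub>m 1 1" using d D mat_mult_inner_zero[of "i2 v" "p2 v"] by simp
      hence ip: "i1 v * p1 v = 1\<^sub>m 1" using b2(5)[OF v] d D by simp
      have "g' v * g v = 0\<^sub>m 1 1" using d D rep_homD(2,3)[OF gh v] Bd mat_mult_inner_zero[of "g' v" "g v"] by (simp add: g'_def)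
      hence "f v * f' v + g' v * g v = 1\<^sub>m (vdim ?B v)" using ip D d Bd by (simp add: f'v fv)
      moreover have "f' v * f v = 1\<^sub>m (vdim ?A v)" using p1f[OF v] e D by (simp add: f'v)
      moreover have "g v * g' v = 1\<^sub>m (vdim ?C v)" "g v * f v = 0\<^sub>m (vdim ?C v) (vdim ?A v)"
        using D d by (auto intro!: mat_eq_no_rows simp: gg gf)
      ultimately show ?thesis by blast
    next
      case 2
      have D: "vdim ?A v = 1" "vdim ?C v = 1" "vdim ?Y v = 1" "vdim ?Z v = 1" using 2 ab by (auto simp: vdim_ivl)
      have e: "aY v = 1\<^sub>m 1" "aZ v = 1\<^sub>m 1" "cY v = 1\<^sub>m 1" "cZ v = 1\<^sub>m 1"
        "ivl_hom (a + 1) b a b v = (1\<^sub>m 1 :: 'k mat)" "ivl_hom (a + 1) (b + 1) a (b + 1) v = (1\<^sub>m 1 :: 'k mat)"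
        using 2 by (auto simp: aY_def aZ_def cY_def cZ_def ivl_hom_one)
      note dn = dims[OF v, unfolded D]
      have "f' v = ivl_hom (a + 1) b a b v * p2 v" using 2 by (simp add: f'_def)
      hence f'v: "f' v = p2 v" unfolding e using dn by simp
      have g'v: "g' v = i1 v" unfolding g'_def e using dn by simp
      have fv: "f v = i1 v + i2 v" unfolding f_def e using dn by simp
      have gv: "g v = p1 v - p2 v" unfolding g_def e using dn by simp
      have "f v * f' v + g' v * g v = (i1 v * p2 v + i2 v * p2 v) + (i1 v * p1 v - i1 v * p2 v)"
        unfolding fv f'v gv g'v using dn by (simp add: mat_distrib_right mat_diff_distrib_left)
      also have "\<dots> = i1 v * p1 v + i2 v * p2 v"
        by (rule eq_matI) (use dn in \<open>simp_all del: index_mult_mat(1)\<close>)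
      also have "\<dots> = 1\<^sub>m (vdim ?B v)" using b2(5)[OF v] Bd by simp
      finally have "f v * f' v + g' v * g v = 1\<^sub>m (vdim ?B v)" .
      moreover have "f' v * f v = 1\<^sub>m (vdim ?A v)" using p2f[OF v] e D by (simp add: f'v)
      moreover have "g v * g' v = 1\<^sub>m (vdim ?C v)" unfolding gg e D by simp
      moreover have "g v * f v = 0\<^sub>m (vdim ?C v) (vdim ?A v)" unfolding gf e D by (auto simp: mat_eq_iff)
      ultimately show ?thesis by blast
    next
      case 3
      have D: "vdim ?A v = 0" "vdim ?C v = 1" "vdim ?Y v = 1" "vdim ?Z v = 0" using 3 ab by (auto simp: vdim_ivl)
      have e: "cY v = 1\<^sub>m 1" "ivl_hom (a + 1) (b + 1) a (b + 1) v = (1\<^sub>m 1 :: 'k mat)"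
        using 3 ab by (auto simp: cY_def ivl_hom_one)
      note dn = dims[OF v, unfolded D]
      have g'v: "g' v = i1 v" unfolding g'_def e using dn by simp
      have "cZ v * p2 v = 0\<^sub>m 1 1" using d D mat_mult_inner_zero[of "cZ v" "p2 v"] by simp
      hence gv: "g v = p1 v" unfolding g_def e using dn by (simp add: mat_diff_zero)
      have fd: "dim_row (f v) = 1" "dim_col (f v) = 0" using rep_homD(2,3)[OF fh v] Bd D by auto
      have f'd: "dim_row (f' v) = 0" "dim_col (f' v) = 1" using d D by (auto simp: f'_def)
      have "f v * f' v = 0\<^sub>m 1 1" using mat_mult_inner_zero[of "f v" "f' v"] fd f'd by simp
      moreover have "i2 v * p2 v = 0\<^sub>m 1 1" using d D mat_mult_inner_zero[of "i2 v" "p2 v"] by simp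
      hence "i1 v * p1 v = 1\<^sub>m 1" using b2(5)[OF v] d D by simp
      ultimately have "f v * f' v + g' v * g v = 1\<^sub>m (vdim ?B v)" using D Bd by (simp add: gv g'v)
      moreover have "f' v * f v = 1\<^sub>m (vdim ?A v)" using fd f'd D by (intro mat_eq_no_rows) simp_all
      moreover have "g v * g' v = 1\<^sub>m (vdim ?C v)" unfolding gg e D by simp
      moreover have "g v * f v = 0\<^sub>m (vdim ?C v) (vdim ?A v)"
        by (rule mat_eq_no_cols) (use D d in \<open>simp_all add: gf\<close>)
      ultimately show ?thesis by blast
    next
      case 4
      have D: "vdim ?A v = 0" "vdim ?C v = 0" "vdim ?Y v = 0" "vdim ?Z v = 0" using 4 ab by (auto simp: vdim_ivl)
      have fd: "dim_row (f v) = 0" "dim_col (f v) = 0" "dim_row (g v) = 0" "dim_col (g v) = 0"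
        using rep_homD(2,3)[OF fh v] rep_homD(2,3)[OF gh v] Bd D by auto
      have "dim_row (f' v) = 0" "dim_col (f' v) = 0" "dim_row (g' v) = 0" "dim_col (g' v) = 0"
        using d D by (auto simp: f'_def g'_def)
      thus ?thesis using fd D Bd by (auto intro!: mat_eq_no_rows)
    qed
    thus "f' v * f v = 1\<^sub>m (vdim ?A v)" "g v * g' v = 1\<^sub>m (vdim ?C v)"
      "g v * f v = 0\<^sub>m (vdim ?C v) (vdim ?A v)" "f v * f' v + g' v * g v = 1\<^sub>m (vdim ?B v)" by auto
  qed
  have "left_almost_split ?Q ?A ?B f" unfolding left_almost_split_def
  proof (intro conjI allI impI fh)
    show "\<not> split_mono ?Q ?A ?B f"
    proof
      assume "split_mono ?Q ?A ?B f"
      then obtain r where r: "r \<in> rep_hom ?Q ?B ?A" and rf: "\<And>v. v \<in> verts ?Q \<Longrightarrow> r v * f v = 1\<^sub>m (vdim ?A v)"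
        unfolding split_mono_def by blast
      have av: "a \<in> verts ?Q" "1 \<le> a" "a \<le> n" using ab by auto
      \<comment> \<open>A retraction would be nonzero at \<open>a\<close>. But
        \<open>ivl (a + 1) b\<close> vanishes there, and morphisms from \<open>ivl a (b + 1)\<close>
        to \<open>ivl a b\<close> are zero.\<close>
      have "(\<lambda>v. r v * i1 v) \<in> rep_hom ?Q ?Y ?A" by (rule lq.rep_hom_comp[OF Y B is_rep_ivl b(1) r])
      from ivl_hom_zero[OF this _ _ _ av(2,3)] have z: "r a * i1 a = 0\<^sub>m 1 1" using ab by (simp add: vdim_ivl)
      note d = dims[OF av(1)] adims[of a] rep_homD(2,3)[OF r av(1)] Bd[of a]
      have D: "vdim ?A a = 1" "vdim ?Y a = 1" "vdim ?Z a = 0" using ab by (auto simp: vdim_ivl)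
      have "r a * f a = (r a * i1 a) * aY a + (r a * i2 a) * aZ a"
        using d by (simp add: f_def mat_distrib_left mat_assoc)
      also have "\<dots> = 0\<^sub>m 1 1" using z d D mat_mult_inner_zero[of "r a * i2 a" "aZ a"] by simp
      finally show False using rf[OF av(1)] D one_mat_neq_zero[of 1, where ?'a = 'k] by simp
    qed
  next
    fix X h assume X: "is_rep ?Q X" and h: "h \<in> rep_hom ?Q ?A X" and ns: "\<not> split_mono ?Q ?A X h"
    obtain h1 h2 where h1: "h1 \<in> rep_hom ?Q ?Y X" and h2: "h2 \<in> rep_hom ?Q ?Z X"
      and hh: "\<And>v. v \<in> verts ?Q \<Longrightarrow> h v = h1 v * aY v + h2 v * aZ v"
      using not_split_mono_from_ivl_factor[OF X h ab ns] unfolding aY_def aZ_def by blast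
    have hom: "(\<lambda>v. h1 v * p1 v + h2 v * p2 v) \<in> rep_hom ?Q ?B X"
      by (rule lq.rep_hom_add[OF B X lq.rep_hom_comp[OF B Y X b(3) h1] lq.rep_hom_comp[OF B Z X b(4) h2]])
    have "h v = (h1 v * p1 v + h2 v * p2 v) * f v" if v: "v \<in> verts ?Q" for v
      using dims[OF v] adims[of v] rep_homD(2,3)[OF h1 v] rep_homD(2,3)[OF h2 v] rep_homD(2,3)[OF fh v] Bd[of v] p1f[OF v] p2f[OF v] hh[OF v]
      by (simp add: mat_distrib_right mat_assoc)
    thus "\<exists>h'\<in>rep_hom ?Q ?B X. \<forall>v\<in>verts ?Q. h v = h' v * f v" by (intro bexI[OF _ hom] ballI)
  qed
  moreover have "right_almost_split ?Q ?B ?C g" unfolding right_almost_split_def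
  proof (intro conjI allI impI gh)
    show "\<not> split_epi ?Q ?B ?C g"
    proof
      assume "split_epi ?Q ?B ?C g"
      then obtain r where r: "r \<in> rep_hom ?Q ?C ?B" and gr: "\<And>v. v \<in> verts ?Q \<Longrightarrow> g v * r v = 1\<^sub>m (vdim ?C v)"
        unfolding split_epi_def by blast
      let ?e = "b + 1"
      have ev: "?e \<in> verts ?Q" "1 \<le> ?e" "?e \<le> n" using ab by auto
      have "(\<lambda>v. p1 v * r v) \<in> rep_hom ?Q ?C ?Y" by (rule lq.rep_hom_comp[OF is_rep_ivl B Y r b(3)])
      from ivl_hom_zero[OF this _ _ _ ev(2,3)] have z: "p1 ?e * r ?e = 0\<^sub>m 1 1" using ab by (simp add: vdim_ivl)
      note d = dims[OF ev(1)] adims[of ?e] rep_homD(2,3)[OF r ev(1)] Bd[of ?e]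
      have D: "vdim ?C ?e = 1" "vdim ?Y ?e = 1" "vdim ?Z ?e = 0" using ab by (auto simp: vdim_ivl)
      have "g ?e * r ?e = cY ?e * (p1 ?e * r ?e) - cZ ?e * (p2 ?e * r ?e)"
        using d by (simp add: g_def mat_diff_distrib_right mat_assoc)
      also have "\<dots> = 0\<^sub>m 1 1" unfolding z using d D mat_mult_inner_zero[of "cZ ?e" "p2 ?e * r ?e"] by (auto simp: mat_eq_iff)
      finally show False using gr[OF ev(1)] D one_mat_neq_zero[of 1, where ?'a = 'k] by simp
    qed
  next
    fix X h assume X: "is_rep ?Q X" and h: "h \<in> rep_hom ?Q X ?C" and ns: "\<not> split_epi ?Q X ?C h"
    have ab': "1 \<le> a" "a + 1 \<le> b + 1" "b + 1 \<le> n" using ab by auto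
    obtain h1 h2 where h1: "h1 \<in> rep_hom ?Q X ?Y" and h2: "h2 \<in> rep_hom ?Q X ?Z"
      and hh: "\<And>v. v \<in> verts ?Q \<Longrightarrow> h v = cY v * h1 v + cZ v * h2 v"
      using not_split_epi_to_ivl_factor[OF X h ab' ns] unfolding cY_def cZ_def by (auto simp only: add_diff_cancel_right')
    \<comment> \<open>The sign undoes the one in \<open>g\<close>.\<close>
    let ?h = "\<lambda>v. i1 v * h1 v - i2 v * h2 v"
    have hom: "?h \<in> rep_hom ?Q X ?B"
      by (rule lq.rep_hom_diff[OF X B lq.rep_hom_comp[OF X Y B h1 b(1)] lq.rep_hom_comp[OF X Z B h2 b(2)]])
    have "h v = g v * ?h v" if v: "v \<in> verts ?Q" for v
    proof -
      note d = dims[OF v] adims[of v] rep_homD(2,3)[OF h1 v] rep_homD(2,3)[OF h2 v] rep_homD(2,3)[OF gh v] Bd[of v]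
      have "g v * ?h v = g v * (i1 v * h1 v) - g v * (i2 v * h2 v)" using d by (simp add: mat_diff_distrib_left)
      also have "\<dots> = cY v * h1 v - - (cZ v * h2 v)" using gi1[OF v] gi2[OF v] d by simp
      also have "\<dots> = cY v * h1 v + cZ v * h2 v" using d by (auto simp: mat_eq_iff)
      finally show ?thesis using hh[OF v] by simp
    qed
    thus "\<exists>h'\<in>rep_hom ?Q X ?B. \<forall>v\<in>verts ?Q. h v = g v * h' v" by (intro bexI[OF _ hom] ballI)
  qed
  moreover have "indecomposable ?Q ?A" "indecomposable ?Q ?C" using ab by (auto intro!: indecomposable_ivl)
  ultimately show ?thesis unfolding ar_translate_def ivl_class_def using short B by blast
qed

text \<open>
  Lift the generator of \<open>ivl a b\<close> to a vector of \<open>B\<close> at \<open>b\<close>. Its image at \<open>p = a - 1\<close> is a vector \<open>x\<close> of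
  \<open>ivl a' b'\<close> which does not come from \<open>b\<close>, because \<open>g\<close> does not split; this forces \<open>a' \<le> p \<le> b' < b\<close>. The
  opposite inequalities hold since the quotient \<open>ivl (a' + 1) b'\<close> and the subrepresentation
  \<open>ivl a (b - 1)\<close> would otherwise yield maps that extend, respectively lift, and make \<open>x\<close> vanish.
\<close>

lemma almost_split_ivl_imp:
  fixes f g :: "nat \<Rightarrow> 'k::field mat"
  assumes ab: "1 \<le> a" "a \<le> b" "b \<le> n" and ab': "1 \<le> a'" "a' \<le> b'" "b' \<le> n"
    and B: "is_rep (linear_quiver n) B"
    and ex: "\<And>v. 1 \<le> v \<Longrightarrow> v \<le> n \<Longrightarrow>
      mat_exact (vdim (ivl a' b' :: (nat, nat, 'k) qrep) v) (vdim B v) (vdim (ivl a b :: (nat, nat, 'k) qrep) v) (f v) (g v)"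
    and las: "left_almost_split (linear_quiver n) (ivl a' b') B f"
    and ras: "right_almost_split (linear_quiver n) B (ivl a b) g"
  shows "a = a' + 1 \<and> b = b' + 1"
proof -
  let ?Q = "linear_quiver n"
  let ?A = "ivl a' b' :: (nat, nat, 'k) qrep" and ?C = "ivl a b :: (nat, nat, 'k) qrep"
  have f: "f \<in> rep_hom ?Q ?A B" and g: "g \<in> rep_hom ?Q B ?C" and nse: "\<not> split_epi ?Q B ?C g"
    using las ras unfolding left_almost_split_def right_almost_split_def by blast+
  have gf: "g v * f v = 0\<^sub>m (vdim ?C v) (vdim ?A v)"
    and inj: "\<And>x. x \<in> carrier_mat (vdim ?A v) 1 \<Longrightarrow> f v * x = 0\<^sub>m (vdim B v) 1 \<Longrightarrow> x = 0\<^sub>m (vdim ?A v) 1"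
    and mid: "\<And>y. y \<in> carrier_mat (vdim B v) 1 \<Longrightarrow> g v * y = 0\<^sub>m (vdim ?C v) 1 \<Longrightarrow> \<exists>x\<in>carrier_mat (vdim ?A v) 1. y = f v * x"
    and sur: "\<And>z. z \<in> carrier_mat (vdim ?C v) 1 \<Longrightarrow> \<exists>y\<in>carrier_mat (vdim B v) 1. g v * y = z"
    if "1 \<le> v" "v \<le> n" for v
    using ex[OF that] unfolding mat_exact_def by blast+
  have bv: "1 \<le> b" "b \<le> n" using ab by auto
  have Cb: "vdim ?C b = 1" using ab by (simp add: vdim_ivl)
  obtain v where v: "v \<in> carrier_mat (vdim B b) 1" "g b * v = 1\<^sub>m 1"
    using sur[OF bv, of "1\<^sub>m 1"] Cb by auto
  \<comment> \<open>For \<open>a = 1\<close> the lifted generator is subject to no relation and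
    defines a section.\<close>
  have a1: "1 < a"
  proof (rule ccontr)
    assume "\<not> 1 < a"
    hence "split_epi ?Q B ?C g" by (intro split_epi_to_ivl[OF B g ab v(1) _ v(2)]) simp
    thus False using nse by simp
  qed
  define p where "p = a - 1"
  have p: "1 \<le> p" "p \<le> n" "p \<le> b" "p < a" "a = p + 1" using a1 ab by (auto simp: p_def)
  have Cp: "vdim ?C p = 0" using p by (simp add: vdim_ivl)
  note gp = rep_homD(2,3)[OF g, of p] and fd = rep_homD(2,3)[OF f]
  have pm: "path_map B p b \<in> carrier_mat (vdim B p) (vdim B b)" by (rule path_map_carrier[OF B]) (use p ab in auto)
  have "g p * (path_map B p b * v) = 0\<^sub>m (vdim ?C p) 1"
    by (rule mat_eq_no_rows) (use lq_rep_homD(2)[OF g p(1,2)] Cp v in auto)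
  then obtain x where x: "x \<in> carrier_mat (vdim ?A p) 1" "path_map B p b * v = f p * x"
    using mid[OF p(1,2), of "path_map B p b * v"] pm v by auto
  have no_lift: "path_map ?A p b * y \<noteq> x" if y: "y \<in> carrier_mat (vdim ?A b) 1" for y
  proof
    assume yx: "path_map ?A p b * y = x"
    \<comment> \<open>This lift of the generator would die at \<open>p\<close> and define a section
      of \<open>g\<close>.\<close>
    let ?w = "v - f b * y"
    have dd: "dim_row (f b) = vdim B b" "dim_col (f b) = vdim ?A b" "dim_row (g b) = 1" "dim_col (g b) = vdim B b"
      "dim_row (f p) = vdim B p" "dim_col (f p) = vdim ?A p"
      using lq_rep_homD(2,3)[OF f bv] lq_rep_homD(2,3)[OF g bv] lq_rep_homD(2,3)[OF f p(1,2)] Cb by auto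
    have pA: "dim_row (path_map ?A p b) = vdim ?A p" "dim_col (path_map ?A p b) = vdim ?A b"
      using path_map_ivl_dim[OF p(1,3)] by auto
    have w: "?w \<in> carrier_mat (vdim B b) 1" using v y dd by (intro minus_carrier_mat) auto
    have "g b * ?w = g b * v - (g b * f b) * y" using dd v y by (simp add: mat_diff_distrib_left mat_assoc)
    also have "\<dots> = 1\<^sub>m 1" unfolding gf[OF bv] v(2) using y Cb by (auto simp: mat_eq_iff)
    finally have one: "g b * ?w = 1\<^sub>m 1" .
    have "path_map B p b * ?w = path_map B p b * v - (path_map B p b * f b) * y"
      using dd v y pm by (simp add: mat_diff_distrib_left mat_assoc)
    also have "path_map B p b * f b = f p * path_map ?A p b"
      by (rule path_map_hom[OF is_rep_ivl B f, symmetric]) (use p ab in auto)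
    also have "f p * path_map ?A p b * y = f p * x" using dd pA y yx by (simp add: mat_assoc)
    also have "path_map B p b * v - f p * x = 0\<^sub>m (vdim B p) 1"
      unfolding x(2) using dd x(1) by (auto simp: mat_eq_iff)
    finally have "path_map B (a - 1) b * ?w = 0\<^sub>m (vdim B (a - 1)) 1" using p by simp
    hence "split_epi ?Q B ?C g" by (intro split_epi_to_ivl[OF B g ab w _ one])
    thus False using nse by simp
  qed
  have Ab: "vdim ?A b \<noteq> 0 \<longrightarrow> a' \<le> b \<and> b \<le> b'" "vdim ?A p \<noteq> 0 \<longrightarrow> a' \<le> p \<and> p \<le> b'" by (auto simp: vdim_ivl)
  have x0: "x \<noteq> 0\<^sub>m (vdim ?A p) 1"
    using no_lift[of "0\<^sub>m (vdim ?A b) 1"] path_map_ivl_dim[OF p(1,3), of a' b', where ?'k = 'k] by auto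
  have Ap: "vdim ?A p \<noteq> 0"
    using x0 x(1) mat_eq_no_rows[of x "0\<^sub>m 0 1"] by auto
  hence ap: "a' \<le> p" "p \<le> b'" using Ab by auto
  have Ap1: "vdim ?A p = 1" using ap by (simp add: vdim_ivl)
  have bb: "b' < b"
  proof (rule ccontr)
    assume le: "\<not> b' < b"
    have "path_map ?A p b = 1\<^sub>m 1" by (rule path_map_ivl) (use ap p le in auto)
    moreover have "vdim ?A b = 1" using ap p le by (simp add: vdim_ivl)
    ultimately show False using no_lift[of x] x(1) Ap1 by simp
  qed
  have "p \<le> a'"
  proof (rule ccontr)
    assume lt: "\<not> p \<le> a'"
    \<comment> \<open>The projection to this quotient is the identity at \<open>p\<close> and
      extends to \<open>B\<close>. It recovers \<open>x\<close> from the image of \<open>v\<close>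
      at \<open>p\<close>; but by naturality that value passes through the space of the quotient at
      \<open>b\<close>, which is zero because \<open>b' < b\<close>.\<close>
    let ?Y = "ivl (a' + 1) b' :: (nat, nat, 'k) qrep"
    have "\<not> split_mono ?Q ?A ?Y (ivl_hom a' b' (a' + 1) b')"
      using split_mono_ivl_hom_imp[of n a' b' "a' + 1" b' "ivl_hom a' b' (a' + 1) b' :: nat \<Rightarrow> 'k mat"] ab' by auto
    then obtain h where h: "h \<in> rep_hom ?Q B ?Y" "\<And>v. v \<in> verts ?Q \<Longrightarrow> ivl_hom a' b' (a' + 1) b' v = h v * f v"
      using las ivl_hom_in_rep_hom[of a' "a' + 1" b' b' n, where ?'a = 'k] is_rep_ivl unfolding left_almost_split_def by force
    have o: "ivl_hom a' b' (a' + 1) b' p = (1\<^sub>m 1 :: 'k mat)" by (rule ivl_hom_one) (use ap lt in auto)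
    have d: "dim_row (f p) = vdim B p" "dim_col (f p) = 1" "dim_col (h p) = vdim B p" "dim_row (h b) = 0" "dim_col (h b) = vdim B b"
      "dim_row (h p) = 1"
      using lq_rep_homD(2,3)[OF f p(1,2)] lq_rep_homD(2,3)[OF h(1) p(1,2)] lq_rep_homD(2,3)[OF h(1) bv] Ap1 bb ap lt
      by (auto simp: vdim_ivl)
    have "x = (h p * f p) * x" using h(2)[of p] o x(1) Ap1 p by simp
    also have "\<dots> = h p * (path_map B p b * v)" using d x Ap1 by (simp add: mat_assoc)
    also have "\<dots> = (h p * path_map B p b) * v" using d pm v by (simp add: mat_assoc)
    also have "h p * path_map B p b = path_map ?Y p b * h b"
      by (rule path_map_hom[OF B is_rep_ivl h(1)]) (use p ab in auto)
    also have "\<dots> = 0\<^sub>m 1 (vdim B b)"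
      using mat_mult_inner_zero[of "path_map ?Y p b" "h b"] path_map_ivl_dim[OF p(1,3), of "a' + 1" b', where ?'k = 'k] d bb ap lt
      by (simp add: vdim_ivl)
    also have "\<dots> * v = 0\<^sub>m 1 1" using v(1) by simp
    finally show False using x0 Ap1 by simp
  qed
  moreover have "b - 1 \<le> b'"
  proof (rule ccontr)
    assume lt: "\<not> b - 1 \<le> b'"
    define q where "q = b - 1"
    have q: "1 \<le> q" "q \<le> n" "q \<le> b" "p \<le> q" "a \<le> q" "b' < q" "q < b" using lt ap p ab by (auto simp: q_def)
    \<comment> \<open>The inclusion of \<open>ivl a q\<close> lifts to \<open>B\<close>. At
      \<open>q\<close> the lifted generator and the image of \<open>v\<close> agree in
      \<open>ivl a b\<close>, and \<open>ivl a' b'\<close> has no space there, so they are equal;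
      but the lifted generator dies at \<open>p\<close>.\<close>
    let ?X = "ivl a q :: (nat, nat, 'k) qrep"
    have "\<not> split_epi ?Q ?X ?C (ivl_hom a q a b)"
      using split_epi_ivl_hom_imp[of n a q a b "ivl_hom a q a b :: nat \<Rightarrow> 'k mat"] ab q by auto
    then obtain h where h: "h \<in> rep_hom ?Q ?X B" "\<And>v. v \<in> verts ?Q \<Longrightarrow> ivl_hom a q a b v = g v * h v"
      using ras ivl_hom_in_rep_hom[of a a q b n, where ?'a = 'k] is_rep_ivl q unfolding right_almost_split_def by force
    have Aq: "vdim ?A q = 0" "vdim ?C q = 1" using q by (auto simp: vdim_ivl)
    have o: "ivl_hom a q a b q = (1\<^sub>m 1 :: 'k mat)" by (rule ivl_hom_one) (use q in auto)
    have hq: "h q \<in> carrier_mat (vdim B q) 1" using lq_rep_homD(1)[OF h(1) q(1,2)] q by (simp add: vdim_ivl)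
    have gq: "dim_row (g q) = 1" "dim_col (g q) = vdim B q" using lq_rep_homD(2,3)[OF g q(1,2)] Aq by auto
    have fq: "dim_row (f q) = vdim B q" "dim_col (f q) = 0" using lq_rep_homD(2,3)[OF f q(1,2)] Aq by auto
    have pq: "path_map B q b \<in> carrier_mat (vdim B q) (vdim B b)" by (rule path_map_carrier[OF B]) (use q ab in auto)
    have pp: "path_map B p q \<in> carrier_mat (vdim B p) (vdim B q)" by (rule path_map_carrier[OF B]) (use p q in auto)
    have g1: "g q * h q = 1\<^sub>m 1" using h(2)[of q] o q by simp
    have "g q * (path_map B q b * v) = (g q * path_map B q b) * v" using gq pq v by (simp add: mat_assoc)
    also have "g q * path_map B q b = path_map ?C q b * g b"
      by (rule path_map_hom[OF B is_rep_ivl g]) (use q ab in auto)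
    also have "path_map ?C q b = 1\<^sub>m 1" by (rule path_map_ivl) (use q in auto)
    also have "1\<^sub>m 1 * g b = g b" using lq_rep_homD(2)[OF g bv] Cb by simp
    finally have g2: "g q * (path_map B q b * v) = 1\<^sub>m 1" using v(2) by simp
    have zc: "path_map B q b * v \<in> carrier_mat (vdim B q) 1" using pq v by auto
    have dz: "h q - path_map B q b * v \<in> carrier_mat (vdim B q) 1" using hq zc by (intro minus_carrier_mat)
    have "g q * (h q - path_map B q b * v) = g q * h q - g q * (path_map B q b * v)"
      using gq hq pq v by (simp add: mat_diff_distrib_left)
    also have "\<dots> = 0\<^sub>m 1 1" unfolding g1 g2 by (auto simp: mat_eq_iff)
    finally obtain y where y: "y \<in> carrier_mat (vdim ?A q) 1" "h q - path_map B q b * v = f q * y"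
      using mid[OF q(1,2) dz] Aq by auto
    have "f q * y = 0\<^sub>m (vdim B q) 1" using mat_mult_inner_zero[of "f q" y] fq y Aq by simp
    hence "h q - path_map B q b * v = 0\<^sub>m (vdim B q) 1" using y by simp
    hence hz: "h q = path_map B q b * v" using hq zc by (auto simp: mat_eq_iff)
    have "f p * x = path_map B p q * (path_map B q b * v)"
      using path_map_trans[OF B p(1), of q b] q ab x(2) pp pq v by (simp add: mat_assoc[symmetric])
    also have "\<dots> = path_map B p q * h q" using hz by simp
    also have "\<dots> = 0\<^sub>m (vdim B p) 1"
      using rep_hom_from_ivlD(2)[OF B h(1) ab(1) q(5,2) a1] p by simp
    finally show False using inj[OF p(1,2) x(1)] x0 by simp
  qed
  ultimately show ?thesis using ap bb p by auto
qed

section \<open>The Hillman--Grassl insertion, column by column\<close>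

text \<open>South steps have priority, so a path fills a run of equal entries in each column. The
  row \<open>s (c - 1)\<close> in which it leaves column \<open>c\<close> is the one in which it
  enters column \<open>c - 1\<close>; \<open>s (j - 1)\<close> is the row in which it ends.\<close>

lemma hg_path_columns:
  fixes \<pi> :: "cell \<Rightarrow> nat"
  assumes r: "1 \<le> r" "r \<le> R" and j: "1 \<le> j" "j \<le> m"
  shows "\<exists>s :: nat \<Rightarrow> nat. s m = r \<and>
    (\<forall>c. j \<le> c \<longrightarrow> c \<le> m \<longrightarrow> s c \<le> s (c - 1) \<and> s (c - 1) \<le> R \<and>
      (\<forall>i. s c \<le> i \<longrightarrow> i \<le> s (c - 1) \<longrightarrow> \<pi> (i, c) = \<pi> (s c, c)) \<and>
      (s (c - 1) < R \<longrightarrow> \<pi> (s (c - 1) + 1, c) \<noteq> \<pi> (s c, c))) \<and>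
    hg_path R m \<pi> (r, j) = {(i, c). j \<le> c \<and> c \<le> m \<and> s c \<le> i \<and> i \<le> s (c - 1)}"
proof -
  define P where "P c i k \<longleftrightarrow> i \<le> k \<and> k \<le> R \<and> (\<forall>l. i \<le> l \<longrightarrow> l \<le> k \<longrightarrow> \<pi> (l, c) = \<pi> (i, c))" for c i k
  \<comment> \<open>The last row of the run of entries equal to \<open>\<pi> (i, c)\<close> that
    starts in row \<open>i\<close>.\<close>
  define be where "be c i = (GREATEST k. P c i k)" for c i
  have be: "P c i (be c i) \<and> (be c i < R \<longrightarrow> \<pi> (be c i + 1, c) \<noteq> \<pi> (i, c))" if "i \<le> R" for c i
  proof -
    have 0: "P c i i" using that by (auto simp: P_def)
    have bnd: "\<And>k. P c i k \<Longrightarrow> k \<le> R" by (auto simp: P_def)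
    have 1: "P c i (be c i)" unfolding be_def by (rule GreatestI_nat[of "P c i", OF 0 bnd])
    have 2: "k \<le> be c i" if "P c i k" for k
      unfolding be_def by (rule Greatest_le_nat[of "P c i", OF that bnd])
    have 3: "\<pi> (be c i + 1, c) \<noteq> \<pi> (i, c)" if lt: "be c i < R"
    proof
      assume "\<pi> (be c i + 1, c) = \<pi> (i, c)"
      with 1 lt have "P c i (be c i + 1)" unfolding P_def by (metis add.commute le_SucE nat_less_le plus_1_eq_Suc le_add1 le_trans Suc_leI)
      from 2[OF this] show False by simp
    qed
    show ?thesis using 1 3 by simp
  qed
  \<comment> \<open>Columns are met from right to left: \<open>ent d\<close> is the entry row after
    \<open>d\<close> steps to the west, that is, in column \<open>m - d\<close>.\<close>
  define ent where "ent = rec_nat r (\<lambda>d i. be (m - d) i)"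
  have ent0: "ent 0 = r" and entS: "\<And>d. ent (Suc d) = be (m - d) (ent d)" by (simp_all add: ent_def)
  have entR: "ent d \<le> R" for d
    by (induction d) (use r be in \<open>auto simp: ent0 entS P_def\<close>)
  define s where "s c = ent (m - c)" for c
  have sS: "s (c - 1) = be c (s c)" if "j \<le> c" "c \<le> m" for c
  proof -
    have "m - (c - 1) = Suc (m - c)" using that j by simp
    thus ?thesis using that by (simp add: s_def entS)
  qed
  have sR: "s c \<le> R" for c by (simp add: s_def entR)
  have sm: "s m = r" by (simp add: s_def ent0)
  have s1: "s c \<le> s (c - 1)" and s2: "s c \<le> i \<Longrightarrow> i \<le> s (c - 1) \<Longrightarrow> \<pi> (i, c) = \<pi> (s c, c)"
    and s3: "s (c - 1) < R \<Longrightarrow> \<pi> (s (c - 1) + 1, c) \<noteq> \<pi> (s c, c)"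
    if "j \<le> c" "c \<le> m" for c i
    using be[OF sR[of c], of c] unfolding sS[OF that, symmetric] P_def by blast+
  let ?S = "{(i, c). j \<le> c \<and> c \<le> m \<and> s c \<le> i \<and> i \<le> s (c - 1)}"
  have sub1: "(a, b) \<in> ?S" if "(a, b) \<in> hg_path R m \<pi> (r, j)" for a b
    using that
  proof induction
    case start
    show ?case using s1[of m] j sm by simp
  next
    case (south i c)
    then have c: "j \<le> c" "c \<le> m" "s c \<le> i" "i \<le> s (c - 1)" by auto
    have "i \<noteq> s (c - 1)"
      using s3[OF c(1,2)] s2[OF c] south by auto
    thus ?case using c by auto
  next
    case (west i c)
    then have c: "j \<le> c" "c \<le> m" "s c \<le> i" "i \<le> s (c - 1)" and jc: "j < c" by auto
    have "i = s (c - 1)"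
    proof (rule ccontr)
      assume "i \<noteq> s (c - 1)"
      with c have "i + 1 \<le> s (c - 1)" by simp
      with s2[OF c] s2[OF c(1,2), of "i + 1"] c sR[of "c - 1"] west(2) show False by auto
    qed
    with s1[of "c - 1"] jc c show ?case by auto
  qed
  have col: "(i, c) \<in> hg_path R m \<pi> (r, j)"
    if c: "j \<le> c" "c \<le> m" and e: "(s c, c) \<in> hg_path R m \<pi> (r, j)" and i: "s c \<le> i" "i \<le> s (c - 1)" for c i
    using i
  proof (induction i rule: dec_induct)
    case base thus ?case using e by simp
  next
    case (step i)
    have "(i + 1, c) \<in> hg_path R m \<pi> (r, j)"
    proof (rule hg_path.south)
      show "(i, c) \<in> hg_path R m \<pi> (r, j)" using step by simp
      show "i < R" using step sR[of "c - 1"] by simp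
      show "\<pi> (i + 1, c) = \<pi> (i, c)" using s2[OF c, of i] s2[OF c, of "i + 1"] step by simp
    qed
    thus ?case by simp
  qed
  have ent_in: "(s c, c) \<in> hg_path R m \<pi> (r, j)" if "c \<le> m" "j \<le> c" for c
    using that
  proof (induction c rule: inc_induct)
    case base
    show ?case using hg_path.start[of "(r, j)" m R \<pi>] sm by simp
  next
    case (step c)
    then have c: "j \<le> Suc c" "Suc c \<le> m" by auto
    have e: "(s c, Suc c) \<in> hg_path R m \<pi> (r, j)"
      using col[OF c _ _ order_refl] step s1[OF c] by auto
    have "(s c, Suc c - 1) \<in> hg_path R m \<pi> (r, j)"
    proof (rule hg_path.west[OF e])
      show "snd (r, j) < Suc c" using step by simp
      show "\<not> (s c < R \<and> \<pi> (s c + 1, Suc c) = \<pi> (s c, Suc c))"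
        using s3[OF c] s2[OF c, of "s c"] s1[OF c] by auto
    qed
    thus ?case by simp
  qed
  have sub2: "p \<in> hg_path R m \<pi> (r, j)" if "p \<in> ?S" for p
    using that col ent_in by auto
  have "hg_path R m \<pi> (r, j) = ?S"
  proof (rule Set.set_eqI)
    fix p :: cell
    obtain a b where p: "p = (a, b)" by (cases p)
    show "p \<in> hg_path R m \<pi> (r, j) \<longleftrightarrow> p \<in> ?S"
      unfolding p using sub1[of a b] sub2[of "(a, b)"] by (rule iffI)
  qed
  moreover have "\<forall>c. j \<le> c \<longrightarrow> c \<le> m \<longrightarrow> s c \<le> s (c - 1) \<and> s (c - 1) \<le> R \<and>
      (\<forall>i. s c \<le> i \<longrightarrow> i \<le> s (c - 1) \<longrightarrow> \<pi> (i, c) = \<pi> (s c, c)) \<and>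
      (s (c - 1) < R \<longrightarrow> \<pi> (s (c - 1) + 1, c) \<noteq> \<pi> (s c, c))"
    by (intro allI impI conjI; (rule sR | (rule s1 s2 s3; assumption)))
  ultimately show ?thesis using sm by blast
qed

text \<open>
  The effect on one column \<open>x\<^sub>0\<close> of a sequence of paths entering it in weakly increasing rows:
  \<open>x\<close> is the current column, \<open>N r\<close> and \<open>N' r\<close> count the paths that entered and left it in row \<open>r\<close>.
\<close>

definition column_flow :: "nat \<Rightarrow> (nat \<Rightarrow> nat) \<Rightarrow> (nat \<Rightarrow> nat) \<Rightarrow> (nat \<Rightarrow> nat) \<Rightarrow> (nat \<Rightarrow> nat) \<Rightarrow> bool" where
  "column_flow R x\<^sub>0 x N N' \<longleftrightarrow> (\<forall>r\<in>{1..R}.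
     x r = max (x (r - 1)) (x\<^sub>0 r) + N r \<and>
     N' r + x\<^sub>0 r = (if r < R then min (x r) (x\<^sub>0 (r + 1)) else x r))"

text \<open>Only the run from \<open>s\<close> to \<open>e\<close> grows. Before its last row each
  entry already dominates \<open>x\<^sub>0\<close> of the next row, so the minimum there does not
  change. As no path has entered below \<open>s\<close>, the entry below the run is
  \<open>x\<^sub>0 (e + 1)\<close> and exceeds the run: it is not affected, and the additional unit
  leaves at \<open>e\<close>.\<close>

lemma column_flow_step:
  assumes flow: "column_flow R x\<^sub>0 x N N'"
    and N: "\<And>r. s < r \<Longrightarrow> r \<le> R \<Longrightarrow> N r = 0"
    and s: "1 \<le> s" "s \<le> e" "e \<le> R"
    and const: "\<And>i. s \<le> i \<Longrightarrow> i \<le> e \<Longrightarrow> x i = x s"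
    and stop: "e < R \<Longrightarrow> x (e + 1) \<noteq> x s"
  shows "column_flow R x\<^sub>0 (\<lambda>i. if s \<le> i \<and> i \<le> e then x i + 1 else x i)
    (N(s := N s + 1)) (N'(e := N' e + 1))"
  unfolding column_flow_def
proof (intro ballI conjI)
  fix r assume r: "r \<in> {1..R}"
  note f = flow[unfolded column_flow_def, rule_format]
  have fr: "x r = max (x (r - 1)) (x\<^sub>0 r) + N r"
    "N' r + x\<^sub>0 r = (if r < R then min (x r) (x\<^sub>0 (r + 1)) else x r)" using f[OF r] by auto
  have fr1: "x (r + 1) = max (x r) (x\<^sub>0 (r + 1)) + N (r + 1)" if "r < R"
    using f[of "r + 1"] that by auto
  have cr: "x r = x s" if "s \<le> r" "r \<le> e" using const that by blast
  have cr': "x (r - 1) = x s" if "s < r" "r \<le> e + 1" using const[of "r - 1"] that by auto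
  have e1: "x (r - 1) < x r" if "r = e + 1"
    using stop const[of e] s r that fr by auto
  let ?x = "\<lambda>i. if s \<le> i \<and> i \<le> e then x i + 1 else x i"
  consider "r < s" | "r = s" | "s < r" "r \<le> e" | "r = e + 1" "s < r" | "e + 1 < r" using s by linarith
  then show "?x r = max (?x (r - 1)) (x\<^sub>0 r) + (N(s := N s + 1)) r"
  proof cases
    case 1 thus ?thesis using fr by auto
  next
    case 2 thus ?thesis using fr s by auto
  next
    case 3 thus ?thesis using fr cr cr' N[of r] r by auto
  next
    case 4 thus ?thesis using fr e1 N[of r] r s by auto
  next
    case 5 thus ?thesis using fr s by auto
  qed
  show "(N'(e := N' e + 1)) r + x\<^sub>0 r = (if r < R then min (?x r) (x\<^sub>0 (r + 1)) else ?x r)"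
  proof (cases "s \<le> r \<and> r \<le> e")
    case False
    thus ?thesis using fr s by auto
  next
    case in1: True
    show ?thesis
    proof (cases "r = e")
      case True
      show ?thesis
      proof (cases "r < R")
        case lt: True
        have "x r < x (r + 1)" using stop lt True cr in1 fr1 by fastforce
        hence "x r < x\<^sub>0 (r + 1)" using fr1[OF lt] N[of "r + 1"] lt in1 by auto
        thus ?thesis using fr True lt in1 by auto
      next
        case False
        thus ?thesis using fr True in1 by auto
      qed
    next
      case False
      hence re: "r < e" using in1 by simp
      hence lt: "r < R" using s by simp
      have "x (r + 1) = x r" using const[of "r + 1"] cr in1 re by auto
      hence "x\<^sub>0 (r + 1) \<le> x r" using fr1[OF lt] by auto
      thus ?thesis using fr False in1 lt by auto
    qed
  qed
qed

text \<open>Here \<open>s c\<close> is the row in which the latest path entered column \<open>c\<close>.\<close>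

definition hg_flow ::
  "nat \<Rightarrow> nat \<Rightarrow> nat \<Rightarrow> (cell \<Rightarrow> nat) \<Rightarrow> (cell \<Rightarrow> nat) \<Rightarrow> (nat \<Rightarrow> nat \<Rightarrow> nat) \<Rightarrow> (nat \<Rightarrow> nat) \<Rightarrow> bool" where
  "hg_flow R m j \<pi>\<^sub>0 \<pi> N s \<longleftrightarrow>
     (\<forall>c. j \<le> c \<longrightarrow> c \<le> m \<longrightarrow>
        column_flow R (\<lambda>r. \<pi>\<^sub>0 (r, c)) (\<lambda>r. \<pi> (r, c)) (N c) (N (c - 1)) \<and>
        (\<forall>r. s c < r \<longrightarrow> r \<le> R \<longrightarrow> N c r = 0) \<and>
        1 \<le> s c \<and> s c \<le> s (c - 1) \<and> s (c - 1) \<le> R \<and>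
        (\<forall>r. s c \<le> r \<longrightarrow> r \<le> s (c - 1) \<longrightarrow> \<pi> (r, c) = \<pi> (s c, c))) \<and>
     (\<forall>r c. c < j \<or> r = 0 \<longrightarrow> \<pi> (r, c) = \<pi>\<^sub>0 (r, c))"

text \<open>The new path starts weakly below the previous one and stays so in every column. Hence no
  earlier path entered below it, as \<open>column_flow_step\<close> demands in each column, and the
  counts of column \<open>c - 1\<close> serve as the outflow of column \<open>c\<close>.\<close>

lemma hg_flow_insert:
  assumes flow: "hg_flow R m j \<pi>\<^sub>0 \<pi> N s" and j: "1 \<le> j" "j \<le> m"
    and r: "s m \<le> r" "r \<le> R"
  obtains N' s' where "hg_flow R m j \<pi>\<^sub>0 (hg_insert R m (r, j) \<pi>) N' s'" "s' m = r"
    "N' m = (N m)(r := N m r + 1)"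
proof -
  note f = flow[unfolded hg_flow_def, THEN conjunct1, rule_format]
  have r1: "1 \<le> r" using f[of m] j r by simp
  from hg_path_columns[OF r1 r(2) j, of \<pi>] obtain t where tm: "t m = r"
    and t: "\<forall>c. j \<le> c \<longrightarrow> c \<le> m \<longrightarrow> t c \<le> t (c - 1) \<and> t (c - 1) \<le> R \<and>
      (\<forall>i. t c \<le> i \<longrightarrow> i \<le> t (c - 1) \<longrightarrow> \<pi> (i, c) = \<pi> (t c, c)) \<and>
      (t (c - 1) < R \<longrightarrow> \<pi> (t (c - 1) + 1, c) \<noteq> \<pi> (t c, c))"
    and path: "hg_path R m \<pi> (r, j) = {(i, c). j \<le> c \<and> c \<le> m \<and> t c \<le> i \<and> i \<le> t (c - 1)}"
    by (elim exE conjE)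
  have t1: "\<And>c. j \<le> c \<Longrightarrow> c \<le> m \<Longrightarrow> t c \<le> t (c - 1) \<and> t (c - 1) \<le> R"
    and t2: "\<And>c i. j \<le> c \<Longrightarrow> c \<le> m \<Longrightarrow> t c \<le> i \<Longrightarrow> i \<le> t (c - 1) \<Longrightarrow> \<pi> (i, c) = \<pi> (t c, c)"
    and t3: "\<And>c. j \<le> c \<Longrightarrow> c \<le> m \<Longrightarrow> t (c - 1) < R \<Longrightarrow> \<pi> (t (c - 1) + 1, c) \<noteq> \<pi> (t c, c)"
    using t by blast+
  have st: "s c \<le> t c" if "c \<le> m" "j \<le> c + 1" for c
    using that
  proof (induction c rule: inc_induct)
    case base thus ?case using r tm by simp
  next
    case (step c)
    then have c: "j \<le> Suc c" "Suc c \<le> m" by auto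
    have IH: "s (Suc c) \<le> t (Suc c)" using step by simp
    show ?case
    proof (rule ccontr)
      assume "\<not> s c \<le> t c"
      hence lt: "t c < s c" by simp
      \<comment> \<open>The previous path left the entries of its run equal, so a path that enters
        this run cannot leave it before its end.\<close>
      have const: "\<pi> (i, Suc c) = \<pi> (s (Suc c), Suc c)" if "s (Suc c) \<le> i" "i \<le> s c" for i
        using f[OF c, THEN conjunct2, THEN conjunct2, THEN conjunct2, THEN conjunct2, THEN conjunct2] that
        by (metis diff_Suc_1)
      have "s c \<le> R" and "t (Suc c) \<le> t c" using f[OF c] t1[OF c] by auto
      thus False
        using t3[OF c] const[of "t c + 1"] const[of "t (Suc c)"] lt IH by auto
    qed
  qed
  define N' where "N' c = (N c)(t c := N c (t c) + 1)" for c
  have ins: "hg_insert R m (r, j) \<pi> (i, c) =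
      (if j \<le> c \<and> c \<le> m \<and> t c \<le> i \<and> i \<le> t (c - 1) then \<pi> (i, c) + 1 else \<pi> (i, c))" for i c
    unfolding hg_insert_def path by simp
  have t0: "1 \<le> t c" if "j \<le> c" "c \<le> m" for c using st[of c] f[OF that] that by simp
  have "hg_flow R m j \<pi>\<^sub>0 (hg_insert R m (r, j) \<pi>) N' t"
    unfolding hg_flow_def
  proof (intro conjI allI impI)
    fix c assume c: "j \<le> c" "c \<le> m"
    have "column_flow R (\<lambda>r. \<pi>\<^sub>0 (r, c))
        (\<lambda>i. if t c \<le> i \<and> i \<le> t (c - 1) then \<pi> (i, c) + 1 else \<pi> (i, c))
        ((N c)(t c := N c (t c) + 1)) ((N (c - 1))(t (c - 1) := N (c - 1) (t (c - 1)) + 1))"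
    proof (rule column_flow_step)
      show "N c r = 0" if "t c < r" "r \<le> R" for r
        using f[OF c] st[of c] c that by simp
      show "\<pi> (i, c) = \<pi> (t c, c)" if "t c \<le> i" "i \<le> t (c - 1)" for i
        using t2[OF c] that by blast
    qed (use f[OF c] t0[OF c] t1[OF c] t3[OF c] in auto)
    thus "column_flow R (\<lambda>r. \<pi>\<^sub>0 (r, c)) (\<lambda>i. hg_insert R m (r, j) \<pi> (i, c)) (N' c) (N' (c - 1))"
      using c by (simp add: ins N'_def)
    show "N' c i = 0" if "t c < i" "i \<le> R" for i
      using f[OF c] st[of c] c that by (simp add: N'_def)
    show "hg_insert R m (r, j) \<pi> (i, c) = hg_insert R m (r, j) \<pi> (t c, c)"
      if "t c \<le> i" "i \<le> t (c - 1)" for i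
      using t2[OF c that] that c t1[OF c] by (simp add: ins)
  next
    fix i c :: nat assume "c < j \<or> i = 0"
    thus "hg_insert R m (r, j) \<pi> (i, c) = \<pi>\<^sub>0 (i, c)"
      using flow t0 by (force simp: ins hg_flow_def)
  qed (use t0 t1 in auto)
  moreover have "N' m = (N m)(r := N m r + 1)" by (simp add: N'_def tm)
  ultimately show thesis using that tm by blast
qed

lemma hg_flow_insert_funpow:
  assumes "hg_flow R m j \<pi>\<^sub>0 \<pi> N s" and "1 \<le> j" "j \<le> m" and "s m \<le> r" "r \<le> R"
  shows "\<exists>N' s'. hg_flow R m j \<pi>\<^sub>0 ((hg_insert R m (r, j) ^^ k) \<pi>) N' s' \<and> s' m \<le> r \<and>
    N' m = (N m)(r := N m r + k)"
proof (induction k)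
  case 0
  show ?case using assms by (intro exI[of _ N] exI[of _ s]) auto
next
  case (Suc k)
  then obtain N1 s1 where 1: "hg_flow R m j \<pi>\<^sub>0 ((hg_insert R m (r, j) ^^ k) \<pi>) N1 s1" "s1 m \<le> r"
    "N1 m = (N m)(r := N m r + k)" by blast
  from hg_flow_insert[OF 1(1) assms(2,3) 1(2) assms(5)] obtain N2 s2 where
    "hg_flow R m j \<pi>\<^sub>0 (hg_insert R m (r, j) ((hg_insert R m (r, j) ^^ k) \<pi>)) N2 s2" "s2 m = r"
    "N2 m = (N1 m)(r := N1 m r + 1)" by blast
  thus ?case using 1(3) by (intro exI[of _ N2] exI[of _ s2]) auto
qed

text \<open>Before the first path the flow equations say just that the columns of
  \<open>\<pi>\<close> increase weakly downwards, which is the hypothesis. The bound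
  \<open>max 1 k\<close> allows for the initial choice of \<open>1\<close> for all entry
  rows.\<close>

lemma hg_flow_column:
  assumes \<pi>: "\<And>r c. 1 \<le> r \<Longrightarrow> r \<le> R \<Longrightarrow> \<pi> (r - 1, c) \<le> \<pi> (r, c)"
    and "1 \<le> R" "1 \<le> j" "j \<le> m" "k \<le> R"
  shows "\<exists>N s. hg_flow R m j \<pi> (fold (\<lambda>r. hg_insert R m (r, j) ^^ A (r, j)) [1..<k + 1] \<pi>) N s \<and>
    s m \<le> max 1 k \<and> N m = (\<lambda>r. if 1 \<le> r \<and> r \<le> k then A (r, j) else 0)"
  using \<open>k \<le> R\<close>
proof (induction k)
  case 0
  have "hg_flow R m j \<pi> \<pi> (\<lambda>_ _. 0) (\<lambda>_. 1)"
    unfolding hg_flow_def column_flow_def using assms \<pi>[of "_ + 1"] by (auto simp: max_def min_def)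
  thus ?case by (intro exI[of _ "\<lambda>_ _. 0"] exI[of _ "\<lambda>_. 1"]) auto
next
  case (Suc k)
  then obtain N s where 1: "hg_flow R m j \<pi> (fold (\<lambda>r. hg_insert R m (r, j) ^^ A (r, j)) [1..<k + 1] \<pi>) N s"
    "s m \<le> max 1 k" "N m = (\<lambda>r. if 1 \<le> r \<and> r \<le> k then A (r, j) else 0)" by auto
  from hg_flow_insert_funpow[OF 1(1) assms(3,4), of "Suc k" "A (Suc k, j)"] 1(2) Suc.prems
  have "\<exists>N' s'. hg_flow R m j \<pi> ((hg_insert R m (Suc k, j) ^^ A (Suc k, j))
      (fold (\<lambda>r. hg_insert R m (r, j) ^^ A (r, j)) [1..<k + 1] \<pi>)) N' s' \<and> s' m \<le> Suc k \<and>
    N' m = (N m)(Suc k := N m (Suc k) + A (Suc k, j))" by (simp del: upt_Suc)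
  then obtain N' s' where 2: "hg_flow R m j \<pi> ((hg_insert R m (Suc k, j) ^^ A (Suc k, j))
      (fold (\<lambda>r. hg_insert R m (r, j) ^^ A (r, j)) [1..<k + 1] \<pi>)) N' s'" "s' m \<le> Suc k"
    "N' m = (N m)(Suc k := N m (Suc k) + A (Suc k, j))" by blast
  have "[1..<Suc k + 1] = [1..<k + 1] @ [Suc k]" by simp
  thus ?case
    by (intro exI[of _ N'] exI[of _ s'])
      (use 2 in \<open>auto simp: 1(3) fun_eq_iff le_Suc_eq simp del: upt_Suc\<close>)
qed

text \<open>This is the filling \<open>H\<^sub>j\<close>: the fold over the initial segment of
  \<open>hg_order\<close> formed by the columns from \<open>j\<close> on.\<close>

definition hg_state :: "nat \<Rightarrow> nat \<Rightarrow> (cell \<Rightarrow> nat) \<Rightarrow> nat \<Rightarrow> cell \<Rightarrow> nat" where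
  "hg_state R m A j =
     fold (\<lambda>u. hg_insert R m u ^^ A u) [(r, c). c \<leftarrow> rev [j..<m + 1], r \<leftarrow> [1..<R + 1]] (\<lambda>_. 0)"

lemma hillman_grassl_eq_hg_state: "hillman_grassl R m A = hg_state R m A 1"
  by (simp add: hillman_grassl_def hg_state_def hg_order_def)

lemma hg_state_beyond: "m < j \<Longrightarrow> hg_state R m A j = (\<lambda>_. 0)"
  by (simp add: hg_state_def)

lemma hg_state_step:
  assumes "j \<le> m"
  shows "hg_state R m A j =
    fold (\<lambda>r. hg_insert R m (r, j) ^^ A (r, j)) [1..<R + 1] (hg_state R m A (j + 1))"
proof -
  have "[j..<m + 1] = j # [j + 1..<m + 1]" using assms by (simp add: upt_conv_Cons del: upt_Suc)
  thus ?thesis by (simp add: hg_state_def fold_map o_def del: upt_Suc)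
qed

lemma hg_state_flow:
  assumes "1 \<le> R" "1 \<le> j" "j \<le> m"
    and "\<And>r c. 1 \<le> r \<Longrightarrow> r \<le> R \<Longrightarrow> hg_state R m A (j + 1) (r - 1, c) \<le> hg_state R m A (j + 1) (r, c)"
  shows "\<exists>N s. hg_flow R m j (hg_state R m A (j + 1)) (hg_state R m A j) N s \<and>
    N m = (\<lambda>r. if 1 \<le> r \<and> r \<le> R then A (r, j) else 0)"
proof -
  have "\<exists>N s. hg_flow R m j (hg_state R m A (j + 1))
      (fold (\<lambda>r. hg_insert R m (r, j) ^^ A (r, j)) [1..<R + 1] (hg_state R m A (j + 1))) N s \<and>
    s m \<le> max 1 R \<and> N m = (\<lambda>r. if 1 \<le> r \<and> r \<le> R then A (r, j) else 0)"
    by (rule hg_flow_column[OF _ assms(1-3) order_refl]) (rule assms(4))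
  thus ?thesis unfolding hg_state_step[OF assms(3), symmetric] by blast
qed

text \<open>Monotone columns for \<open>j + 1\<close> start the flow for \<open>j\<close>, whose
  equations return monotone columns. Row \<open>0\<close> and the columns left of \<open>j\<close>
  stay zero; these zeros later stand for missing successors in the poset.\<close>

lemma hg_state_column_mono:
  assumes "1 \<le> R" "1 \<le> j"
  shows "(1 \<le> r \<longrightarrow> r \<le> R \<longrightarrow> hg_state R m A j (r - 1, c) \<le> hg_state R m A j (r, c)) \<and>
    hg_state R m A j (0, c) = 0 \<and> (c < j \<longrightarrow> hg_state R m A j (r, c) = 0)"
proof (cases "j \<le> m + 1")
  case False
  thus ?thesis by (simp add: hg_state_beyond)
next
  case True
  from this assms(2) show ?thesis
  proof (induction j arbitrary: r c rule: inc_induct)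
    case base
    show ?case by (simp add: hg_state_beyond)
  next
    case (step j)
    have IH: "1 \<le> r \<Longrightarrow> r \<le> R \<Longrightarrow> hg_state R m A (j + 1) (r - 1, c) \<le> hg_state R m A (j + 1) (r, c)"
      "hg_state R m A (j + 1) (0, c) = 0" "c < j + 1 \<Longrightarrow> hg_state R m A (j + 1) (r, c) = 0" for r c
      using step.IH[of r c] step by auto
    obtain N s where fl: "hg_flow R m j (hg_state R m A (j + 1)) (hg_state R m A j) N s"
      using hg_state_flow[OF assms(1) _ _ IH(1)] step by force
    have old: "c < j \<or> r = 0 \<Longrightarrow> hg_state R m A j (r, c) = hg_state R m A (j + 1) (r, c)" for r c
      using fl by (auto simp: hg_flow_def)
    have "hg_state R m A j (r - 1, c) \<le> hg_state R m A j (r, c)" if r: "1 \<le> r" "r \<le> R"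
    proof -
      consider "c < j" | "j \<le> c" "c \<le> m" | "m < c" by linarith
      thus ?thesis
      proof cases
        case 1 thus ?thesis using old IH r by simp
      next
        case 2
        hence "column_flow R (\<lambda>r. hg_state R m A (j + 1) (r, c)) (\<lambda>r. hg_state R m A j (r, c)) (N c) (N (c - 1))"
          using fl by (auto simp: hg_flow_def)
        thus ?thesis using r unfolding column_flow_def by force
      next
        case 3
        \<comment> \<open>Paths start in column \<open>m\<close> and move only south and west, so
          they never meet a column to the right of the diagram.\<close>
        have "b \<le> m" if "(a, b) \<in> hg_path R m \<pi> (i, j)" for a b \<pi> i
          using that by induction auto
        hence "hg_insert R m (i, j) \<pi> (q, c) = \<pi> (q, c)" for \<pi> i q
          using 3 by (fastforce simp: hg_insert_def)
        hence "(hg_insert R m (i, j) ^^ k) \<pi> (q, c) = \<pi> (q, c)" for \<pi> i q k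
          by (induction k) auto
        hence "fold (\<lambda>r. hg_insert R m (r, j) ^^ A (r, j)) xs \<pi> (q, c) = \<pi> (q, c)" for xs \<pi> q
          by (induction xs arbitrary: \<pi>) auto
        hence "hg_state R m A j (q, c) = hg_state R m A (j + 1) (q, c)" for q
          using hg_state_step[of j m R A] step by simp
        thus ?thesis using IH r by simp
      qed
    qed
    thus ?case using old IH by auto
  qed
qed

text \<open>Eliminating the flow counts between adjacent columns leaves the toggle rule.\<close>

lemma hg_state_rec:
  assumes "1 \<le> R" "1 \<le> j" "j \<le> m" "1 \<le> r" "r \<le> R"
  shows "hg_state R m A j (r, m) =
      max (hg_state R m A j (r - 1, m)) (hg_state R m A (j + 1) (r, m)) + A (r, j)"
    and "j \<le> c \<Longrightarrow> c < m \<Longrightarrow> hg_state R m A j (r, c) + hg_state R m A (j + 1) (r, c + 1) =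
      max (hg_state R m A j (r - 1, c)) (hg_state R m A (j + 1) (r, c)) +
      (if r < R then min (hg_state R m A j (r, c + 1)) (hg_state R m A (j + 1) (r + 1, c + 1))
       else hg_state R m A j (r, c + 1))"
proof -
  have mono: "hg_state R m A (j + 1) (i - 1, d) \<le> hg_state R m A (j + 1) (i, d)" if "1 \<le> i" "i \<le> R" for i d
    using hg_state_column_mono[OF assms(1), of "j + 1" i m A d] that by simp
  have "\<exists>N s. hg_flow R m j (hg_state R m A (j + 1)) (hg_state R m A j) N s \<and>
    N m = (\<lambda>r. if 1 \<le> r \<and> r \<le> R then A (r, j) else 0)"
    by (rule hg_state_flow[OF assms(1-3)]) (rule mono)
  then obtain N s where fl: "hg_flow R m j (hg_state R m A (j + 1)) (hg_state R m A j) N s"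
    and N: "N m = (\<lambda>r. if 1 \<le> r \<and> r \<le> R then A (r, j) else 0)"
    by (elim exE conjE)
  have "column_flow R (\<lambda>r. hg_state R m A (j + 1) (r, c)) (\<lambda>r. hg_state R m A j (r, c)) (N c) (N (c - 1))"
    if "j \<le> c" "c \<le> m" for c using fl that by (auto simp: hg_flow_def)
  hence cf: "hg_state R m A j (r, c) = max (hg_state R m A j (r - 1, c)) (hg_state R m A (j + 1) (r, c)) + N c r"
    "N (c - 1) r + hg_state R m A (j + 1) (r, c) =
      (if r < R then min (hg_state R m A j (r, c)) (hg_state R m A (j + 1) (r + 1, c)) else hg_state R m A j (r, c))"
    if "j \<le> c" "c \<le> m" for c
    using that assms(4,5) by (simp_all add: column_flow_def del: One_nat_def)
  show "hg_state R m A j (r, m) =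
      max (hg_state R m A j (r - 1, m)) (hg_state R m A (j + 1) (r, m)) + A (r, j)"
    using cf(1)[of m] assms by (simp add: N)
  show "hg_state R m A j (r, c) + hg_state R m A (j + 1) (r, c + 1) =
      max (hg_state R m A j (r - 1, c)) (hg_state R m A (j + 1) (r, c)) +
      (if r < R then min (hg_state R m A j (r, c + 1)) (hg_state R m A (j + 1) (r + 1, c + 1))
       else hg_state R m A j (r, c + 1))" if c: "j \<le> c" "c < m"
    using cf(1)[of c] cf(2)[of "c + 1"] c by simp
qed

section \<open>The poset and the cells of the rectangle\<close>

lemma ivl_class_inject:
  assumes "ivl_class n a b = (ivl_class n a' b' :: (nat, nat, 'k::field) qrep set)"
    and "1 \<le> a" "a \<le> b" "b \<le> n" "1 \<le> a'" "a' \<le> b'" "b' \<le> n"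
  shows "a = a' \<and> b = b'"
  by (rule rep_iso_ivl_eq[OF iffD1[OF lq.iso_class_eq_iff[OF is_rep_ivl is_rep_ivl] assms(1)[unfolded ivl_class_def]] assms(2-)])

lemma iso_class_eq_ivl_class:
  assumes X: "indecomposable (linear_quiver n) X"
  obtains a b where "1 \<le> a" "a \<le> b" "b \<le> n" "iso_class (linear_quiver n) X = ivl_class n a b"
    "rep_iso (linear_quiver n) X (ivl a b)"
proof -
  obtain a b where ab: "1 \<le> a" "a \<le> b" "b \<le> n" and iso: "rep_iso (linear_quiver n) X (ivl a b)"
    using indecomposable_iso_ivl[OF X] by blast
  have Xr: "is_rep (linear_quiver n) X" using X by (simp add: indecomposable_def)
  have "iso_class (linear_quiver n) X = ivl_class n a b"
    unfolding ivl_class_def by (rule iffD2[OF lq.iso_class_eq_iff[OF Xr is_rep_ivl] iso])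
  thus thesis using that[OF ab] iso by blast
qed


lemma indec_classes_linear:
  "indec_classes (linear_quiver n) = {ivl_class n a b :: (nat, nat, 'k::field) qrep set | a b. 1 \<le> a \<and> a \<le> b \<and> b \<le> n}"
proof (intro equalityI subsetI)
  fix x :: "(nat, nat, 'k) qrep set" assume "x \<in> indec_classes (linear_quiver n)"
  then obtain X where X: "indecomposable (linear_quiver n) X" "x = iso_class (linear_quiver n) X"
    by (auto simp: indec_classes_def)
  obtain a b where "1 \<le> a" "a \<le> b" "b \<le> n" "iso_class (linear_quiver n) X = ivl_class n a b"
    by (rule iso_class_eq_ivl_class[OF X(1)])
  thus "x \<in> {ivl_class n a b | a b. 1 \<le> a \<and> a \<le> b \<and> b \<le> n}" using X by blast
next
  fix x :: "(nat, nat, 'k) qrep set" assume "x \<in> {ivl_class n a b | a b. 1 \<le> a \<and> a \<le> b \<and> b \<le> n}"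
  thus "x \<in> indec_classes (linear_quiver n)" using indecomposable_ivl by (fastforce simp: indec_classes_def ivl_class_def)
qed

lemma minuscule_poset_linear:
  assumes m: "1 \<le> m" "m \<le> n"
  shows "minuscule_poset (linear_quiver n) m = {ivl_class n a b :: (nat, nat, 'k::field) qrep set | a b. 1 \<le> a \<and> a \<le> m \<and> m \<le> b \<and> b \<le> n}"
proof (intro equalityI subsetI)
  fix x :: "(nat, nat, 'k) qrep set" assume "x \<in> minuscule_poset (linear_quiver n) m"
  then obtain X where X: "indecomposable (linear_quiver n) X" "x = iso_class (linear_quiver n) X" "vdim X m \<noteq> 0"
    by (auto simp: minuscule_poset_def)
  obtain a b where ab: "1 \<le> a" "a \<le> b" "b \<le> n" "iso_class (linear_quiver n) X = ivl_class n a b"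
    and iso: "rep_iso (linear_quiver n) X (ivl a b)"
    by (rule iso_class_eq_ivl_class[OF X(1)])
  have "a \<le> m \<and> m \<le> b" using rep_iso_ivl_vdim[OF iso m] X(3) by (auto simp: vdim_ivl split: if_splits)
  thus "x \<in> {ivl_class n a b | a b. 1 \<le> a \<and> a \<le> m \<and> m \<le> b \<and> b \<le> n}" using ab X by auto
next
  fix x :: "(nat, nat, 'k) qrep set" assume "x \<in> {ivl_class n a b | a b. 1 \<le> a \<and> a \<le> m \<and> m \<le> b \<and> b \<le> n}"
  then obtain a b where "x = ivl_class n a b" "1 \<le> a" "a \<le> m" "m \<le> b" "b \<le> n" by auto
  moreover from this have "indecomposable (linear_quiver n) (ivl a b :: (nat, nat, 'k) qrep)"
    by (intro indecomposable_ivl) auto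
  ultimately show "x \<in> minuscule_poset (linear_quiver n) m"
    by (auto simp: minuscule_poset_def ivl_class_def vdim_ivl intro!: exI[of _ "ivl a b"])
qed

lemma ar_arrow_linear:
  "ar_arrow (linear_quiver n) =
    {(ivl_class n a b, ivl_class n a' b' :: (nat, nat, 'k::field) qrep set) | a b a' b'.
      1 \<le> a \<and> a \<le> b \<and> 1 \<le> a' \<and> a' \<le> b' \<and> b \<le> n \<and> b' \<le> n \<and>
      (a' = a + 1 \<and> b' = b \<or> a' = a \<and> b' = b + 1)}" (is "_ = ?S")
proof (intro equalityI subsetI)
  let ?Q = "linear_quiver n"
  fix p :: "(nat, nat, 'k) qrep set \<times> (nat, nat, 'k) qrep set" assume "p \<in> ar_arrow ?Q"
  then obtain X Y f where p: "p = (iso_class ?Q X, iso_class ?Q Y)" and X: "indecomposable ?Q X"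
    and Y: "indecomposable ?Q Y" and f: "irreducible_hom ?Q X Y f" by (auto simp: ar_arrow_def)
  obtain a b where ab: "1 \<le> a" "a \<le> b" "b \<le> n" "iso_class ?Q X = ivl_class n a b" and iX: "rep_iso ?Q X (ivl a b)"
    by (rule iso_class_eq_ivl_class[OF X])
  obtain a' b' where ab': "1 \<le> a'" "a' \<le> b'" "b' \<le> n" "iso_class ?Q Y = ivl_class n a' b'" and iY: "rep_iso ?Q Y (ivl a' b')"
    by (rule iso_class_eq_ivl_class[OF Y])
  obtain \<alpha> \<alpha>' where \<alpha>: "rep_inverse ?Q (ivl a b) X \<alpha> \<alpha>'" using lq.rep_iso_sym[OF iX] by (auto simp: rep_iso_inverse)
  obtain \<beta> \<beta>' where \<beta>: "rep_inverse ?Q Y (ivl a' b') \<beta> \<beta>'" using iY by (auto simp: rep_iso_inverse)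
  have r: "is_rep ?Q X" "is_rep ?Q Y" using X Y by (auto simp: indecomposable_def)
  have "a' = a + 1 \<and> b' = b \<or> a' = a \<and> b' = b + 1"
    by (rule irreducible_ivl_imp[OF lq.irreducible_hom_iso[OF r(1) is_rep_ivl r(2) is_rep_ivl \<alpha> \<beta> f] ab(1-3) ab'(1-3)])
  thus "p \<in> ?S" using ab ab' p by blast
next
  let ?Q = "linear_quiver n"
  fix p :: "(nat, nat, 'k) qrep set \<times> (nat, nat, 'k) qrep set" assume "p \<in> ?S"
  then obtain a b a' b' where p: "p = (ivl_class n a b, ivl_class n a' b')"
    and ab: "1 \<le> a" "a \<le> b" "1 \<le> a'" "a' \<le> b'" "b \<le> n" "b' \<le> n"
      "a' = a + 1 \<and> b' = b \<or> a' = a \<and> b' = b + 1" by blast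
  have "irreducible_hom ?Q (ivl a b) (ivl a' b' :: (nat, nat, 'k) qrep) (ivl_hom a b a' b')"
    using ab(7)
  proof
    assume "a' = a + 1 \<and> b' = b"
    thus ?thesis using irreducible_ivl_proj[of a b n] ab by auto
  next
    assume "a' = a \<and> b' = b + 1"
    thus ?thesis using irreducible_ivl_incl[of a b n] ab by auto
  qed
  moreover have "indecomposable ?Q (ivl a b :: (nat, nat, 'k) qrep)" "indecomposable ?Q (ivl a' b' :: (nat, nat, 'k) qrep)"
    using ab by (auto intro!: indecomposable_ivl)
  ultimately show "p \<in> ar_arrow ?Q" unfolding p ar_arrow_def ivl_class_def by blast
qed

lemma ar_translate_linear:
  "ar_translate (linear_quiver n) =
    {(ivl_class n a b, ivl_class n (a + 1) (b + 1) :: (nat, nat, 'k::field) qrep set) | a b.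
      1 \<le> a \<and> a \<le> b \<and> b < n}" (is "_ = ?S")
proof (intro equalityI subsetI)
  let ?Q = "linear_quiver n"
  fix p :: "(nat, nat, 'k) qrep set \<times> (nat, nat, 'k) qrep set" assume "p \<in> ar_translate ?Q"
  then obtain A B C f g where p: "p = (iso_class ?Q A, iso_class ?Q C)" and A: "indecomposable ?Q A"
    and C: "indecomposable ?Q C" and B: "is_rep ?Q B" and se: "short_exact ?Q A B C f g"
    and las: "left_almost_split ?Q A B f" and ras: "right_almost_split ?Q B C g"
    by (auto simp: ar_translate_def)
  obtain a b where ab: "1 \<le> a" "a \<le> b" "b \<le> n" "iso_class ?Q A = ivl_class n a b" and iA: "rep_iso ?Q A (ivl a b)"
    by (rule iso_class_eq_ivl_class[OF A])
  obtain a' b' where ab': "1 \<le> a'" "a' \<le> b'" "b' \<le> n" "iso_class ?Q C = ivl_class n a' b'" and iC: "rep_iso ?Q C (ivl a' b')"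
    by (rule iso_class_eq_ivl_class[OF C])
  obtain \<alpha> \<alpha>' where \<alpha>: "rep_inverse ?Q (ivl a b) A \<alpha> \<alpha>'" using lq.rep_iso_sym[OF iA] by (auto simp: rep_iso_inverse)
  obtain \<gamma> \<gamma>' where \<gamma>: "rep_inverse ?Q C (ivl a' b') \<gamma> \<gamma>'" using iC by (auto simp: rep_iso_inverse)
  have r: "is_rep ?Q A" "is_rep ?Q C" using A C by (auto simp: indecomposable_def)
  have "mat_exact (vdim (ivl a b :: (nat, nat, 'k) qrep) v) (vdim B v) (vdim (ivl a' b' :: (nat, nat, 'k) qrep) v)
      (f v * \<alpha> v) (\<gamma> v * g v)" if "1 \<le> v" "v \<le> n" for v
  proof -
    have v: "v \<in> verts ?Q" using that by simp
    show ?thesis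
      by (rule mat_exact_iso[OF short_exact_mat[OF se v] rep_homD(1)[OF rep_inverseD(1)[OF \<alpha>] v]
          rep_homD(1)[OF rep_inverseD(2)[OF \<alpha>] v] rep_inverseD(3)[OF \<alpha> v] rep_inverseD(4)[OF \<alpha> v]
          rep_homD(1)[OF rep_inverseD(1)[OF \<gamma>] v] rep_homD(1)[OF rep_inverseD(2)[OF \<gamma>] v]
          rep_inverseD(3)[OF \<gamma> v] rep_inverseD(4)[OF \<gamma> v]])
  qed
  hence "a' = a + 1 \<and> b' = b + 1"
    by (intro almost_split_ivl_imp[OF ab'(1-3) ab(1-3) B _
        lq.left_almost_split_iso[OF r(1) is_rep_ivl B \<alpha> las] lq.right_almost_split_iso[OF r(2) is_rep_ivl B \<gamma> ras]])
  moreover from this have "b < n" using ab' by simp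
  ultimately show "p \<in> ?S" using ab ab' p by blast
next
  fix p :: "(nat, nat, 'k) qrep set \<times> (nat, nat, 'k) qrep set" assume "p \<in> ?S"
  thus "p \<in> ar_translate (linear_quiver n)" using ivl_ar_sequence by blast
qed

text \<open>So the elements toggled when \<open>ivl a b\<close> is processed are those above it on
  its diagonal.\<close>

lemma ar_translate_trancl:
  assumes ab: "1 \<le> a" "a \<le> b" "b \<le> n"
  shows "(ivl_class n a b, x) \<in> (ar_translate (linear_quiver n))\<^sup>+ \<longleftrightarrow>
    (\<exists>l\<ge>1. b + l \<le> n \<and> x = (ivl_class n (a + l) (b + l) :: (nat, nat, 'k::field) qrep set))"
proof
  assume "(ivl_class n a b, x) \<in> (ar_translate (linear_quiver n))\<^sup>+"
  thus "\<exists>l\<ge>1. b + l \<le> n \<and> x = ivl_class n (a + l) (b + l)"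
  proof (induction rule: trancl_induct)
    case (base y)
    then obtain a' b' where "ivl_class n a b = (ivl_class n a' b' :: (nat, nat, 'k) qrep set)" "y = ivl_class n (a' + 1) (b' + 1)"
      "1 \<le> a'" "a' \<le> b'" "b' < n" by (auto simp: ar_translate_linear)
    thus ?case using ivl_class_inject[of n a b a' b', where ?'k = 'k] ab by (intro exI[of _ 1]) auto
  next
    case (step y z)
    then obtain l where l: "l \<ge> 1" "b + l \<le> n" "y = ivl_class n (a + l) (b + l)" by blast
    from step obtain a' b' where "y = ivl_class n a' b'" "z = ivl_class n (a' + 1) (b' + 1)"
      "1 \<le> a'" "a' \<le> b'" "b' < n" by (auto simp: ar_translate_linear)
    thus ?case using ivl_class_inject[of n "a + l" "b + l" a' b', where ?'k = 'k] ab l by (intro exI[of _ "l + 1"]) auto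
  qed
next
  assume "\<exists>l\<ge>1. b + l \<le> n \<and> x = ivl_class n (a + l) (b + l)"
  then obtain l where l: "1 \<le> l" "b + l \<le> n" "x = ivl_class n (a + l) (b + l)" by blast
  have "(ivl_class n a b, ivl_class n (a + l) (b + l) :: (nat, nat, 'k) qrep set) \<in> (ar_translate (linear_quiver n))\<^sup>+"
    using l(1,2)
  proof (induction l rule: nat_induct_at_least)
    case base
    show ?case using ivl_ar_sequence[of a b n] ab base by auto
  next
    case (Suc l)
    have "(ivl_class n (a + l) (b + l), ivl_class n (a + Suc l) (b + Suc l) :: (nat, nat, 'k) qrep set) \<in> ar_translate (linear_quiver n)"
      using ivl_ar_sequence[of "a + l" "b + l" n] Suc.prems ab by simp
    thus ?case using Suc by (meson Suc_leD add_leD1 trancl.trancl_into_trancl le_trans add_le_mono order_refl le_SucI)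
  qed
  thus "(ivl_class n a b, x) \<in> (ar_translate (linear_quiver n))\<^sup>+" using l by simp
qed

section \<open>Covers and cells for a fixed vertex\<close>

context
  fixes n m :: nat
  assumes m: "1 \<le> m" "m \<le> n"
begin

text \<open>Every arrow raises \<open>a + b\<close> by one, so no arrow is a composite of two strict
  relations, and the covers are exactly the arrows.\<close>

lemma covered_by_linear:
  "covered_by (linear_quiver n) m x y \<longleftrightarrow>
    (\<exists>a b a' b'. x = (ivl_class n a b :: (nat, nat, 'k::field) qrep set) \<and> y = ivl_class n a' b' \<and>
      1 \<le> a \<and> a' \<le> m \<and> m \<le> b \<and> b' \<le> n \<and> (a' = a + 1 \<and> b' = b \<or> a' = a \<and> b' = b + 1))"
proof -
  define S where "S = (ar_arrow (linear_quiver n) \<inter> minuscule_poset (linear_quiver n) m \<times> minuscule_poset (linear_quiver n) m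
      :: ((nat, nat, 'k) qrep set \<times> (nat, nat, 'k) qrep set) set)"
  have S: "(x, y) \<in> S \<longleftrightarrow> (\<exists>a b a' b'. x = ivl_class n a b \<and> y = ivl_class n a' b' \<and>
      1 \<le> a \<and> a' \<le> m \<and> m \<le> b \<and> b' \<le> n \<and> (a' = a + 1 \<and> b' = b \<or> a' = a \<and> b' = b + 1))" (is "_ \<longleftrightarrow> ?R x y") for x y
  proof
    assume "(x, y) \<in> S"
    then obtain a b a' b' a1 b1 a2 b2 where *: "x = ivl_class n a b" "y = ivl_class n a' b'"
      "1 \<le> a" "a \<le> b" "1 \<le> a'" "a' \<le> b'" "b \<le> n" "b' \<le> n" "a' = a + 1 \<and> b' = b \<or> a' = a \<and> b' = b + 1"
      "x = ivl_class n a1 b1" "1 \<le> a1" "a1 \<le> m" "m \<le> b1" "b1 \<le> n" "y = ivl_class n a2 b2" "1 \<le> a2" "a2 \<le> m" "m \<le> b2" "b2 \<le> n"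
      unfolding S_def ar_arrow_linear minuscule_poset_linear[OF m] by blast
    have "a = a1 \<and> b = b1" "a' = a2 \<and> b' = b2"
      using ivl_class_inject[of n a b a1 b1, where ?'k = 'k] ivl_class_inject[of n a' b' a2 b2, where ?'k = 'k] * by auto
    thus "?R x y" using * by blast
  next
    assume "?R x y"
    then obtain a b a' b' where *: "x = ivl_class n a b" "y = ivl_class n a' b'"
      "1 \<le> a" "a' \<le> m" "m \<le> b" "b' \<le> n" "a' = a + 1 \<and> b' = b \<or> a' = a \<and> b' = b + 1" by blast
    hence c: "1 \<le> a" "a \<le> b" "1 \<le> a'" "a' \<le> b'" "b \<le> n" "b' \<le> n" "a \<le> m" "m \<le> b'" by auto
    show "(x, y) \<in> S" unfolding S_def ar_arrow_linear minuscule_poset_linear[OF m] using * c by blast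
  qed
  have grow: "\<exists>a b a' b'. x = ivl_class n a b \<and> y = ivl_class n a' b' \<and> 1 \<le> a \<and> a \<le> m \<and> m \<le> b \<and> b \<le> n \<and>
      1 \<le> a' \<and> a' \<le> m \<and> m \<le> b' \<and> b' \<le> n \<and> a + b < a' + b'" if "(x, y) \<in> S\<^sup>+" for x y
    using that
  proof (induction rule: trancl_induct)
    case (base y)
    then obtain a b a' b' where *: "x = ivl_class n a b" "y = ivl_class n a' b'"
      "1 \<le> a" "a' \<le> m" "m \<le> b" "b' \<le> n" "a' = a + 1 \<and> b' = b \<or> a' = a \<and> b' = b + 1" unfolding S by blast
    hence "a \<le> m" "b \<le> n" "1 \<le> a'" "m \<le> b'" "a + b < a' + b'" by auto
    thus ?case using * by blast
  next
    case (step y z)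
    then obtain a b a' b' where 1: "x = ivl_class n a b" "y = ivl_class n a' b'" "1 \<le> a" "a \<le> m" "m \<le> b" "b \<le> n"
      "1 \<le> a'" "a' \<le> m" "m \<le> b'" "b' \<le> n" "a + b < a' + b'" by blast
    from step(2) obtain c d c' d' where *: "y = ivl_class n c d" "z = ivl_class n c' d'"
      "1 \<le> c" "c' \<le> m" "m \<le> d" "d' \<le> n" "c' = c + 1 \<and> d' = d \<or> c' = c \<and> d' = d + 1" unfolding S by blast
    have "a' = c \<and> b' = d" using ivl_class_inject[of n a' b' c d, where ?'k = 'k] 1 * by auto
    hence "1 \<le> c'" "m \<le> d'" "a + b < c' + d'" using 1 * by auto
    thus ?case using 1 * by blast
  qed
  have "covered_by (linear_quiver n) m x y \<longleftrightarrow> (x, y) \<in> S"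
  proof
    assume cov: "covered_by (linear_quiver n) m x y"
    hence "(x, y) \<in> S\<^sup>+" and no: "\<not> (\<exists>z. (x, z) \<in> S\<^sup>+ \<and> (z, y) \<in> S\<^sup>+)"
      by (simp_all add: covered_by_def poset_less_def S_def)
    then obtain z where z: "(x, z) \<in> S" "(z, y) \<in> S\<^sup>*" by (meson tranclD)
    thus "(x, y) \<in> S" using no by (metis r_into_trancl rtranclD)
  next
    assume xy: "(x, y) \<in> S"
    have "\<not> (\<exists>z. (x, z) \<in> S\<^sup>+ \<and> (z, y) \<in> S\<^sup>+)"
    proof
      assume "\<exists>z. (x, z) \<in> S\<^sup>+ \<and> (z, y) \<in> S\<^sup>+"
      then obtain z where z: "(x, z) \<in> S\<^sup>+" "(z, y) \<in> S\<^sup>+" by blast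
      from xy obtain a b a' b' where *: "x = ivl_class n a b" "y = ivl_class n a' b'"
        "1 \<le> a" "a' \<le> m" "m \<le> b" "b' \<le> n" "a' = a + 1 \<and> b' = b \<or> a' = a \<and> b' = b + 1" unfolding S by blast
      from grow[OF z(1)] obtain a1 b1 c d where 1: "x = ivl_class n a1 b1" "z = ivl_class n c d" "1 \<le> a1" "a1 \<le> m" "m \<le> b1" "b1 \<le> n"
        "1 \<le> c" "c \<le> m" "m \<le> d" "d \<le> n" "a1 + b1 < c + d" by blast
      from grow[OF z(2)] obtain c' d' a2 b2 where 2: "z = ivl_class n c' d'" "y = ivl_class n a2 b2" "1 \<le> c'" "c' \<le> m" "m \<le> d'" "d' \<le> n"
        "1 \<le> a2" "a2 \<le> m" "m \<le> b2" "b2 \<le> n" "c' + d' < a2 + b2" by blast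
      have "a = a1 \<and> b = b1" using ivl_class_inject[of n a b a1 b1, where ?'k = 'k] 1 * by auto
      moreover have "a' = a2 \<and> b' = b2" using ivl_class_inject[of n a' b' a2 b2, where ?'k = 'k] 2 * by auto
      moreover have "c = c' \<and> d = d'" using ivl_class_inject[of n c d c' d', where ?'k = 'k] 1 2 by auto
      ultimately show False using 1 2 * by auto
    qed
    thus "covered_by (linear_quiver n) m x y" using xy by (auto simp: covered_by_def poset_less_def S_def)
  qed
  thus ?thesis unfolding S .
qed

lemma covers_above:
  assumes ab: "1 \<le> a" "a \<le> m" "m \<le> b" "b \<le> n"
  shows "covered_by (linear_quiver n) m (ivl_class n a b) y \<longleftrightarrow>
    a + 1 \<le> m \<and> y = (ivl_class n (a + 1) b :: (nat, nat, 'k::field) qrep set) \<or> b + 1 \<le> n \<and> y = ivl_class n a (b + 1)"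
  (is "?L \<longleftrightarrow> ?R")
proof
  assume ?L
  then obtain c d a' b' where *: "ivl_class n a b = (ivl_class n c d :: (nat, nat, 'k) qrep set)" "y = ivl_class n a' b'"
      "1 \<le> c" "a' \<le> m" "m \<le> d" "b' \<le> n" "a' = c + 1 \<and> b' = d \<or> a' = c \<and> b' = d + 1" unfolding covered_by_linear by blast
  have "a = c \<and> b = d" using ivl_class_inject[of n a b c d, where ?'k = 'k] * ab by auto
  thus ?R using * by auto
next
  assume ?R
  thus ?L unfolding covered_by_linear using ab by auto
qed

lemma covers_below:
  assumes ab: "1 \<le> a" "a \<le> m" "m \<le> b" "b \<le> n"
  shows "covered_by (linear_quiver n) m z (ivl_class n a b) \<longleftrightarrow>
    2 \<le> a \<and> z = (ivl_class n (a - 1) b :: (nat, nat, 'k::field) qrep set) \<or> m < b \<and> z = ivl_class n a (b - 1)"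
  (is "?L \<longleftrightarrow> ?R")
proof
  assume ?L
  then obtain c d a' b' where *: "z = ivl_class n c d" "ivl_class n a b = (ivl_class n a' b' :: (nat, nat, 'k) qrep set)"
      "1 \<le> c" "a' \<le> m" "m \<le> d" "b' \<le> n" "a' = c + 1 \<and> b' = d \<or> a' = c \<and> b' = d + 1" unfolding covered_by_linear by blast
  have "a = a' \<and> b = b'" using ivl_class_inject[of n a b a' b', where ?'k = 'k] * ab by auto
  thus ?R using * by auto
next
  assume ?R
  thus ?L
  proof
    assume "2 \<le> a \<and> z = ivl_class n (a - 1) b"
    thus ?L unfolding covered_by_linear using ab
      by (intro exI[of _ "a - 1"] exI[of _ b] exI[of _ a]) auto
  next
    assume "m < b \<and> z = ivl_class n a (b - 1)"
    thus ?L unfolding covered_by_linear using ab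
      by (intro exI[of _ a] exI[of _ "b - 1"] exI[of _ a] exI[of _ b]) auto
  qed
qed

text \<open>A missing successor is given the value \<open>0\<close>. The values are nonnegative, so
  the maximum does not change, and one formula covers all positions including the top
  element.\<close>

lemma max_above_linear:
  fixes \<rho> :: "(nat, nat, 'k::field) qrep set \<Rightarrow> int"
  assumes ab: "1 \<le> a" "a \<le> m" "m \<le> b" "b \<le> n"
    and u: "a + 1 \<le> m \<Longrightarrow> \<rho> (ivl_class n (a + 1) b) = u" "m < a + 1 \<Longrightarrow> u = 0" "0 \<le> u"
    and w: "b + 1 \<le> n \<Longrightarrow> \<rho> (ivl_class n a (b + 1)) = w" "n < b + 1 \<Longrightarrow> w = 0" "0 \<le> w"
  shows "max_above (linear_quiver n) m \<rho> (ivl_class n a b) = max u w"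
proof -
  have eq: "{\<rho> y | y. covered_by (linear_quiver n) m (ivl_class n a b) y} =
      (if a + 1 \<le> m then {u} else {}) \<union> (if b + 1 \<le> n then {w} else {})"
    unfolding covers_above[OF ab] using u(1) w(1) by auto
  have ex: "(\<exists>y. covered_by (linear_quiver n) m (ivl_class n a b :: (nat, nat, 'k) qrep set) y) \<longleftrightarrow> a + 1 \<le> m \<or> b + 1 \<le> n"
    unfolding covers_above[OF ab] by auto
  show ?thesis unfolding max_above_def ex eq using u w by auto
qed

text \<open>For \<open>a \<ge> 2\<close> the predecessor \<open>(a - 1, b)\<close> exists, so the
  default \<open>N\<close> of the empty minimum is not taken.\<close>

lemma min_below_linear:
  fixes \<rho> :: "(nat, nat, 'k::field) qrep set \<Rightarrow> int"
  assumes ab: "2 \<le> a" "a \<le> m" "m \<le> b" "b \<le> n"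
    and u: "\<rho> (ivl_class n (a - 1) b) = u" and w: "m < b \<Longrightarrow> \<rho> (ivl_class n a (b - 1)) = w"
  shows "min_below (linear_quiver n) m N \<rho> (ivl_class n a b) = (if m < b then min u w else u)"
proof -
  have a1: "1 \<le> a" using ab by simp
  have eq: "{\<rho> z | z. covered_by (linear_quiver n) m z (ivl_class n a b)} = {u} \<union> (if m < b then {w} else {})"
    unfolding covers_below[OF a1 ab(2-4)] using u w ab by auto
  have ex: "\<exists>z. covered_by (linear_quiver n) m z (ivl_class n a b :: (nat, nat, 'k) qrep set)"
    unfolding covers_below[OF a1 ab(2-4)] using ab by auto
  show ?thesis unfolding min_below_def eq using ex by auto
qed

section \<open>Ends of hooks and rim hooks\<close>

lemma southwest_end_unique: "southwest_end S p \<Longrightarrow> southwest_end S q \<Longrightarrow> p = q"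
  unfolding southwest_end_def by (metis order_antisym prod.collapse)

lemma northeast_end_unique: "northeast_end S p \<Longrightarrow> northeast_end S q \<Longrightarrow> p = q"
  unfolding northeast_end_def by (metis order_antisym prod.collapse)

lemma rim_hook_ends:
  assumes ab: "1 \<le> a" "a \<le> m" "m \<le> b" "b \<le> n" and d: "\<And>i. 1 \<le> i \<Longrightarrow> i \<le> n \<Longrightarrow> d i = 1 \<longleftrightarrow> a \<le> i \<and> i \<le> b"
  shows "southwest_end (rim_hook n m d) (n + 1 - m, a)" "northeast_end (rim_hook n m d) (n + 1 - b, m)"
proof -
  have rh: "rim_hook n m d = border_cell n m ` {a..b}" using d ab by (force simp: rim_hook_def)
  have a: "border_cell n m a = (n + 1 - m, a)" and b: "border_cell n m b = (n + 1 - b, m)"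
    using ab by (auto simp: border_cell_def)
  show "southwest_end (rim_hook n m d) (n + 1 - m, a)"
    unfolding southwest_end_def rh
  proof (intro conjI ballI)
    show "(n + 1 - m, a) \<in> border_cell n m ` {a..b}" using a ab by (intro image_eqI[of _ _ a]) auto
  qed (use ab in \<open>auto simp: border_cell_def\<close>)
  show "northeast_end (rim_hook n m d) (n + 1 - b, m)"
    unfolding northeast_end_def rh
  proof (intro conjI ballI)
    show "(n + 1 - b, m) \<in> border_cell n m ` {a..b}" using b ab by (intro image_eqI[of _ _ b]) auto
  qed (use ab in \<open>auto simp: border_cell_def\<close>)
qed

lemma hook_ends:
  assumes "(r, c) \<in> rectangle R m"
  shows "southwest_end (hook (rectangle R m) (r, c)) (R, c)" "northeast_end (hook (rectangle R m) (r, c)) (r, m)"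
  using assms by (auto simp: southwest_end_def northeast_end_def hook_def rectangle_def)

text \<open>The hook of \<open>(r, c)\<close> ends at the foot of its column and at the end of its
  row, the rim hook of \<open>ivl a b\<close> at the border cells \<open>a\<close> and
  \<open>b\<close>. As \<open>a \<le> m \<le> b\<close>, these lie in the bottom row and in the last
  column, so the ends agree only for \<open>a = c\<close> and \<open>b = n + 1 - r\<close>.\<close>

lemma indec_at_linear:
  assumes rc: "(r, c) \<in> rectangle (n + 1 - m) m"
  shows "indec_at n m (r, c) = (ivl_class n c (n + 1 - r) :: (nat, nat, 'k::field) qrep set)"
proof -
  let ?H = "hook (rectangle (n + 1 - m) m) (r, c)"
  have b: "1 \<le> c" "c \<le> m" "m \<le> n + 1 - r" "n + 1 - r \<le> n" "1 \<le> r" "r \<le> n + 1 - m"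
    using rc m by (auto simp: rectangle_def)
  have key: "same_ends (rim_hook n m (vdim X)) ?H \<longleftrightarrow> a = c \<and> b = n + 1 - r"
    if "1 \<le> a" "a \<le> m" "m \<le> b" "b \<le> n" "X \<in> ivl_class n a b" for a b and X :: "(nat, nat, 'k) qrep"
  proof -
    have iso: "rep_iso (linear_quiver n) X (ivl a b)"
      using that(5) lq.rep_iso_sym by (auto simp: ivl_class_def iso_class_def)
    have "vdim X i = 1 \<longleftrightarrow> a \<le> i \<and> i \<le> b" if "1 \<le> i" "i \<le> n" for i
      using rep_iso_ivl_vdim[OF iso that] by (simp add: vdim_ivl)
    note e = rim_hook_ends[OF that(1-4) this] hook_ends[OF rc]
    have "same_ends (rim_hook n m (vdim X)) ?H \<longleftrightarrow> (n + 1 - m, a) = (n + 1 - m, c) \<and> (n + 1 - b, m) = (r, m)"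
      unfolding same_ends_def using e southwest_end_unique northeast_end_unique by metis
    thus ?thesis using that b by auto
  qed
  have mem: "ivl a b \<in> (ivl_class n a b :: (nat, nat, 'k) qrep set)" for a b
    using lq.rep_iso_refl[OF is_rep_ivl] is_rep_ivl by (auto simp: ivl_class_def iso_class_def)
  show ?thesis unfolding indec_at_def
  proof (rule the_equality)
    show "ivl_class n c (n + 1 - r) \<in> minuscule_poset (linear_quiver n) m \<and>
      (\<exists>X\<in>ivl_class n c (n + 1 - r) :: (nat, nat, 'k) qrep set. same_ends (rim_hook n m (vdim X)) ?H)"
      unfolding minuscule_poset_linear[OF m] using b mem key[OF b(1-4) mem] by blast
  next
    fix x :: "(nat, nat, 'k) qrep set"
    assume x: "x \<in> minuscule_poset (linear_quiver n) m \<and> (\<exists>X\<in>x. same_ends (rim_hook n m (vdim X)) ?H)"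
    then obtain a d where ad: "x = ivl_class n a d" "1 \<le> a" "a \<le> m" "m \<le> d" "d \<le> n"
      unfolding minuscule_poset_linear[OF m] by blast
    thus "x = ivl_class n c (n + 1 - r)" using x key[OF ad(2-5)] by blast
  qed
qed

end

text \<open>
  When \<open>(j, e)\<close> is processed, its successors \<open>(j + 1, e)\<close>, \<open>(j, e + 1)\<close> are exactly the latest entries
  processed so far on the two neighbouring diagonals. Hence the value at \<open>(a, b)\<close> is determined by
  the latest entry \<open>(j, j + (b - a))\<close> processed on its own diagonal, and it equals the entry of the
  Hillman--Grassl filling obtained after inserting the columns \<open>\<ge> j\<close>.
\<close>

lemma rho_prefix:
  fixes M :: "(nat, nat, 'k::field) qrep" and Ms :: "(nat, nat, 'k) qrep list"
  assumes m: "1 \<le> m" "m \<le> n" and adm: "admissible_listing (linear_quiver n) Ms"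
  defines "A \<equiv> \<lambda>u. multiplicity_in (linear_quiver n) M (indec_at n m u)"
  defines "H \<equiv> \<lambda>j a b. int (hg_state (n + 1 - m) m A j (n + 1 - b, m + j - a))"
  defines "seen \<equiv> \<lambda>k a b. ivl_class n a b \<in> set (map (iso_class (linear_quiver n)) (take k Ms))"
  assumes k: "k \<le> length Ms" and ab: "1 \<le> a" "a \<le> m" "m \<le> b" "b \<le> n"
  shows "(\<not> seen k a b \<longrightarrow> rho (linear_quiver n) m N (take k Ms) M (ivl_class n a b) = 0) \<and>
    (\<forall>j. 1 \<le> j \<longrightarrow> j \<le> a \<longrightarrow> seen k j (j + (b - a)) \<longrightarrow> j = 1 \<or> \<not> seen k (j - 1) (j - 1 + (b - a)) \<longrightarrow>
      rho (linear_quiver n) m N (take k Ms) M (ivl_class n a b) = H j a b)"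
  using k ab
proof (induction k arbitrary: a b)
  case 0
  thus ?case by (simp add: rho_def seen_def)
next
  case (Suc k)
  let ?Q = "linear_quiver n" and ?R = "n + 1 - m"
  define \<rho> where "\<rho> = rho ?Q m N (take k Ms) M"
  define X where "X = Ms ! k"
  have kl: "k < length Ms" using Suc.prems by simp
  have tk: "take (Suc k) Ms = take k Ms @ [X]" using kl by (simp add: take_Suc_conv_app_nth X_def)
  have step: "rho ?Q m N (take (Suc k) Ms) M = rho_step ?Q m N M X \<rho>" by (simp add: tk rho_def \<rho>_def)
  have Xi: "indecomposable ?Q X" using adm kl by (simp add: admissible_listing_def X_def)
  obtain j0 e where je: "1 \<le> j0" "j0 \<le> e" "e \<le> n" and Xc: "iso_class ?Q X = ivl_class n j0 e"
    by (rule iso_class_eq_ivl_class[OF Xi])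
  have seenS: "seen (Suc k) x y \<longleftrightarrow> seen k x y \<or> x = j0 \<and> y = e" if "1 \<le> x" "x \<le> y" "y \<le> n" for x y
    using ivl_class_inject[of n x y j0 e, where ?'k = 'k] that je by (auto simp: seen_def tk Xc)
  have seen_mono: "seen (Suc k) x y" if "seen k x y" for x y using that by (simp add: seen_def tk)
  have idx: "\<exists>i<length Ms. iso_class ?Q (Ms ! i) = ivl_class n x y" if "1 \<le> x" "x \<le> y" "y \<le> n" for x y
  proof -
    have "(ivl_class n x y :: (nat, nat, 'k) qrep set) \<in> indec_classes ?Q" using that by (auto simp: indec_classes_linear)
    hence "ivl_class n x y \<in> set (map (iso_class ?Q) Ms)" using adm by (simp add: admissible_listing_def)
    thus ?thesis by (auto simp: in_set_conv_nth)
  qed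
  have inj: "i = i'" if "i < length Ms" "i' < length Ms" "iso_class ?Q (Ms ! i) = iso_class ?Q (Ms ! i')" for i i'
  proof -
    have "distinct (map (iso_class ?Q) Ms)" using adm by (simp add: admissible_listing_def)
    thus ?thesis using that nth_eq_iff_index_eq[of "map (iso_class ?Q) Ms" i i'] by simp
  qed
  have seen_iff: "seen q x y \<longleftrightarrow> (\<exists>i<q. iso_class ?Q (Ms ! i) = ivl_class n x y)" if "q \<le> length Ms" for q x y
    by (auto simp: seen_def nth_image[OF that, symmetric] image_iff)
  have ord: "i' < i" if "i < length Ms" "i' < length Ms" "iso_class ?Q (Ms ! i) = ivl_class n x y"
      "iso_class ?Q (Ms ! i') = ivl_class n x' y'" "1 \<le> x" "x \<le> y" "y' \<le> n" "x' \<le> y'"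
      "x' = x + 1 \<and> y' = y \<or> x' = x \<and> y' = y + 1" for i i' x y x' y'
  proof -
    have "1 \<le> x'" "y \<le> n" using that by auto
    hence "(ivl_class n x y, ivl_class n x' y' :: (nat, nat, 'k) qrep set) \<in> ar_arrow ?Q"
      unfolding ar_arrow_linear using that by blast
    thus ?thesis using adm that by (auto simp: admissible_listing_def)
  qed
  \<comment> \<open>The processed elements are closed under arrows, since arrows lead to earlier
    entries of the listing.\<close>
  have up: "seen k x' y'" if sxy: "seen k x y" and xy: "1 \<le> x" "x \<le> y" "y' \<le> n" "x' \<le> y'"
      "x' = x + 1 \<and> y' = y \<or> x' = x \<and> y' = y + 1" for x y x' y'
  proof -
    obtain i where i: "i < k" "iso_class ?Q (Ms ! i) = ivl_class n x y" using sxy seen_iff[of k] kl by auto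
    obtain i' where i': "i' < length Ms" "iso_class ?Q (Ms ! i') = ivl_class n x' y'" using idx[of x' y'] xy by auto
    have "i' < i" by (rule ord[of i i' x y x' y']) (use i i' xy kl in auto)
    hence "i' < k" using i by simp
    thus ?thesis using i' seen_iff[of k] kl by auto
  qed
  have nX: "\<not> seen k j0 e"
  proof
    assume "seen k j0 e"
    then obtain i where i: "i < k" "iso_class ?Q (Ms ! i) = ivl_class n j0 e" using seen_iff[of k] kl by auto
    have "i = k" by (rule inj) (use i kl Xc in \<open>simp_all add: X_def\<close>)
    thus False using i by simp
  qed
  have succ: "seen k x' y'" if xy: "y' \<le> n" "x' \<le> y'" "x' = j0 + 1 \<and> y' = e \<or> x' = j0 \<and> y' = e + 1" for x' y'
  proof -
    obtain i' where i': "i' < length Ms" "iso_class ?Q (Ms ! i') = ivl_class n x' y'" using idx[of x' y'] xy je by auto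
    have "i' < k" by (rule ord[of k i' j0 e x' y']) (use i' xy kl je Xc in \<open>auto simp: X_def\<close>)
    thus ?thesis using i' seen_iff[of k] kl by auto
  qed
  have pred: "\<not> seen k x y" if "1 \<le> x" "x \<le> y" "j0 = x + 1 \<and> e = y \<or> j0 = x \<and> e = y + 1" for x y
    using up[of x y e j0] that nX je by blast
  \<comment> \<open>Two arrows make one step along a diagonal, so on each diagonal the processed
    elements form an upper segment.\<close>
  have diag: "seen k (x + l) (y + l)" if "seen k x y" "1 \<le> x" "x \<le> y" "y + l \<le> n" for x y l
    using that(4)
  proof (induction l)
    case 0 thus ?case using that by simp
  next
    case (Suc l)
    have "seen k (x + l) (y + l + 1)" by (rule up[of "x + l" "y + l"]) (use Suc that in auto)
    from up[OF this, of "y + l + 1" "x + l + 1"] show ?case using Suc that by simp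
  qed
  have diagX: "seen k (j0 + l) (e + l)" if "1 \<le> l" "e + l \<le> n" for l
  proof -
    have "seen k j0 (e + 1)" by (rule succ) (use that je in auto)
    hence "seen k (j0 + 1) (e + 1)" by (rule up) (use that je in auto)
    from diag[OF this, of "l - 1"] show ?thesis using that je by simp
  qed
  note ab = Suc.prems(2-5)
  have IH0: "\<rho> (ivl_class n x y) = 0" if "1 \<le> x" "x \<le> m" "m \<le> y" "y \<le> n" "\<not> seen k x y" for x y
    using Suc.IH[of x y] that kl by (simp add: \<rho>_def)
  have IH: "\<rho> (ivl_class n x y) = H j x y"
    if "1 \<le> x" "x \<le> m" "m \<le> y" "y \<le> n" "1 \<le> j" "j \<le> x" "seen k j (j + (y - x))"
      "j = 1 \<or> \<not> seen k (j - 1) (j - 1 + (y - x))" for x y j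
    unfolding \<rho>_def
    by (rule Suc.IH[OF less_imp_le[OF kl] that(1-4), THEN conjunct2, rule_format, OF that(5-8)])
  show ?case
  proof (cases "j0 \<le> a \<and> b = e + (a - j0)")
    case False
    \<comment> \<open>The step leaves the value at \<open>(a, b)\<close> alone, and the newly
      processed element is none of the entries with \<open>j \<le> a\<close> on its
      diagonal.\<close>
    have ne: "ivl_class n a b \<noteq> (ivl_class n j0 e :: (nat, nat, 'k) qrep set)"
      using ivl_class_inject[of n a b j0 e, where ?'k = 'k] False ab je by auto
    have "\<not> (\<exists>l\<ge>1. e + l \<le> n \<and> (ivl_class n a b :: (nat, nat, 'k) qrep set) = ivl_class n (j0 + l) (e + l))"
    proof
      assume "\<exists>l\<ge>1. e + l \<le> n \<and> (ivl_class n a b :: (nat, nat, 'k) qrep set) = ivl_class n (j0 + l) (e + l)"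
      then obtain l where "l \<ge> 1" "e + l \<le> n" "(ivl_class n a b :: (nat, nat, 'k) qrep set) = ivl_class n (j0 + l) (e + l)" by blast
      thus False using ivl_class_inject[of n a b "j0 + l" "e + l", where ?'k = 'k] False ab je by auto
    qed
    hence same: "rho_step ?Q m N M X \<rho> (ivl_class n a b) = \<rho> (ivl_class n a b)"
      using ne by (auto simp: rho_step_def Xc ar_translate_trancl[OF je])
    show ?thesis unfolding step same
    proof (intro conjI allI impI)
      assume "\<not> seen (Suc k) a b"
      thus "\<rho> (ivl_class n a b) = 0" using IH0[OF ab] seenS[of a b] ab by auto
    next
      fix j assume j: "1 \<le> j" "j \<le> a" "seen (Suc k) j (j + (b - a))"
        "j = 1 \<or> \<not> seen (Suc k) (j - 1) (j - 1 + (b - a))"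
      have "\<not> (j = j0 \<and> j + (b - a) = e)" using False j ab by auto
      hence 1: "seen k j (j + (b - a))" using seenS[of j "j + (b - a)"] j ab by auto
      have 2: "j = 1 \<or> \<not> seen k (j - 1) (j - 1 + (b - a))"
        using j(4) seen_mono by blast
      show "\<rho> (ivl_class n a b) = H j a b" by (rule IH[OF ab j(1,2) 1 2])
    qed
  next
    case aff: True
    define l where "l = a - j0"
    have al: "a = j0 + l" "b = e + l" using aff by (auto simp: l_def)
    have ba: "b - a = e - j0" using al by simp
    have dS: "seen (Suc k) (j0 + i) (e + i)" if "e + i \<le> n" for i
      using diagX[of i] seenS[of "j0 + i" "e + i"] that je by (cases "i = 0") auto
    have jeq: "j = j0" if j: "1 \<le> j" "j \<le> a" "seen (Suc k) j (j + (b - a))"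
        "j = 1 \<or> \<not> seen (Suc k) (j - 1) (j - 1 + (b - a))" for j
    proof (rule ccontr)
      assume "j \<noteq> j0"
      then consider "j < j0" | "j0 < j" by linarith
      thus False
      proof cases
        case 1
        hence "seen k j (j + (b - a))" using j seenS[of j "j + (b - a)"] ab by auto
        have eq: "j + (j0 - j) = j0" "j + (b - a) + (j0 - j) = e" using 1 ba je by auto
        from diag[OF \<open>seen k j (j + (b - a))\<close> j(1) le_add1, of "j0 - j"] show False
          unfolding eq using nX je by simp
      next
        case 2
        have eq: "j0 + (j - 1 - j0) = j - 1" "e + (j - 1 - j0) = j - 1 + (b - a)"
          using 2 ba je by auto
        have "seen (Suc k) (j - 1) (j - 1 + (b - a))"
          using dS[of "j - 1 - j0"] unfolding eq using j ab by simp
        thus False using j(4) 2 je by auto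
      qed
    qed
    have nonneg: "0 \<le> H i x y" for i x y by (simp add: H_def)
    have R1: "1 \<le> ?R" and jm: "j0 \<le> m" and r: "1 \<le> n + 1 - b" "n + 1 - b \<le> ?R" using m ab al by auto
    note mono = hg_state_column_mono[OF R1, of _ _ m A]
    note rc = hg_state_rec[OF R1 je(1) jm r, where A = A]
    \<comment> \<open>The diagonal of \<open>(a + 1, b)\<close> contains the processed successor
      \<open>(j0 + 1, e)\<close> and, next below it, \<open>(j0, e - 1)\<close>, which is not
      processed; so it is at stage \<open>j0 + 1\<close>. Likewise the diagonal of
      \<open>(a, b + 1)\<close> is at stage \<open>j0\<close>.\<close>
    have V1: "\<rho> (ivl_class n (a + 1) b) = H (j0 + 1) (a + 1) b" if "a + 1 \<le> m"
    proof (rule IH)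
      have eq: "j0 + 1 + (b - (a + 1)) = e" "j0 + 1 - 1 + (b - (a + 1)) = e - 1" and je1: "j0 + 1 \<le> e"
        using that ab al by auto
      show "seen k (j0 + 1) (j0 + 1 + (b - (a + 1)))" unfolding eq by (rule succ) (use je1 je in auto)
      show "j0 + 1 = 1 \<or> \<not> seen k (j0 + 1 - 1) (j0 + 1 - 1 + (b - (a + 1)))"
        unfolding eq using pred[of j0 "e - 1"] je je1 by auto
    qed (use that ab al in auto)
    have V2: "\<rho> (ivl_class n a (b + 1)) = H j0 a (b + 1)" if "b + 1 \<le> n"
    proof (rule IH)
      have eq: "j0 + (b + 1 - a) = e + 1" using ab al by auto
      show "seen k j0 (j0 + (b + 1 - a))" unfolding eq by (rule succ) (use that al je in auto)
      show "j0 = 1 \<or> \<not> seen k (j0 - 1) (j0 - 1 + (b + 1 - a))"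
        using pred[of "j0 - 1" e] je al by (cases "j0 = 1") auto
    qed (use that ab al je in auto)
    have top: "max_above ?Q m \<rho> (ivl_class n a b) = max (H (j0 + 1) (a + 1) b) (H j0 a (b + 1))"
    proof (rule max_above_linear[OF m ab])
      \<comment> \<open>A missing successor corresponds to a zero entry: here in column
        \<open>j0\<close>, not yet reached by the filling for \<open>j0 + 1\<close>, and in the next
        case in row \<open>0\<close>.\<close>
      show "H (j0 + 1) (a + 1) b = 0" if "m < a + 1"
      proof -
        have eq: "m + (j0 + 1) - (a + 1) = j0" using that ab by simp
        show ?thesis unfolding H_def eq using mono[of "j0 + 1" "n + 1 - b" j0] by simp
      qed
      show "H j0 a (b + 1) = 0" if "n < b + 1"
      proof -
        have eq: "n + 1 - (b + 1) = 0" using that ab by simp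
        show ?thesis unfolding H_def eq using mono[of j0 0 "m + j0 - a"] je by simp
      qed
    qed (use V1 V2 nonneg in auto)
    have H1: "H (j0 + 1) (a + 1) b = int (hg_state ?R m A (j0 + 1) (n + 1 - b, m + j0 - a))"
      by (simp add: H_def)
    have H2: "H j0 a (b + 1) = int (hg_state ?R m A j0 (n + 1 - b - 1, m + j0 - a))"
      by (simp add: H_def)
    have val: "rho_step ?Q m N M X \<rho> (ivl_class n a b) = H j0 a b"
    proof (cases "l = 0")
      case True
      \<comment> \<open>The processed element itself is read in the last column \<open>m\<close>,
        where the multiplicity enters.\<close>
      hence aj: "a = j0" "b = e" using al by auto
      have "(n + 1 - b, j0) \<in> rectangle ?R m" using r je jm by (auto simp: rectangle_def)
      hence "indec_at n m (n + 1 - b, j0) = (ivl_class n a b :: (nat, nat, 'k) qrep set)"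
        using indec_at_linear[OF m, of "n + 1 - b" j0, where ?'k = 'k] ab aj by simp
      hence "A (n + 1 - b, j0) = multiplicity_in ?Q M (ivl_class n a b)" by (simp add: A_def)
      moreover have "rho_step ?Q m N M X \<rho> (ivl_class n a b) =
          max_above ?Q m \<rho> (ivl_class n a b) + int (multiplicity_in ?Q M (ivl_class n a b))"
        by (simp add: rho_step_def Xc aj)
      ultimately show ?thesis unfolding top H1 H2 using rc(1) aj by (simp add: H_def max.commute of_nat_max)
    next
      case False
      hence l1: "1 \<le> l" by simp
      have ne: "ivl_class n a b \<noteq> (ivl_class n j0 e :: (nat, nat, 'k) qrep set)"
        using ivl_class_inject[of n a b j0 e, where ?'k = 'k] False ab je al by auto
      have "(iso_class ?Q X, ivl_class n a b) \<in> (ar_translate ?Q)\<^sup>+"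
        unfolding Xc ar_translate_trancl[OF je] using l1 ab al by auto
      hence rs: "rho_step ?Q m N M X \<rho> (ivl_class n a b) =
          max_above ?Q m \<rho> (ivl_class n a b) + min_below ?Q m N \<rho> (ivl_class n a b) - \<rho> (ivl_class n a b)"
        using ne by (simp add: rho_step_def Xc toggle_def)
      have V3: "\<rho> (ivl_class n (a - 1) b) = H j0 (a - 1) b"
      proof (rule IH)
        have eq: "j0 + (b - (a - 1)) = e + 1" "j0 - 1 + (b - (a - 1)) = j0 - 1 + (e + 1 - j0)" using ab al l1 je by auto
        show "seen k j0 (j0 + (b - (a - 1)))" unfolding eq by (rule succ) (use l1 al ab je in auto)
        show "j0 = 1 \<or> \<not> seen k (j0 - 1) (j0 - 1 + (b - (a - 1)))"
          unfolding eq using pred[of "j0 - 1" e] je by (cases "j0 = 1") auto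
      qed (use ab al je l1 in auto)
      have V4: "\<rho> (ivl_class n a (b - 1)) = H (j0 + 1) a (b - 1)" if "m < b"
      proof (rule IH)
        have eq: "j0 + 1 + (b - 1 - a) = e" "j0 + 1 - 1 + (b - 1 - a) = e - 1" and je1: "j0 + 1 \<le> e"
          using that ab al by auto
        show "seen k (j0 + 1) (j0 + 1 + (b - 1 - a))" unfolding eq by (rule succ) (use je1 je in auto)
        show "j0 + 1 = 1 \<or> \<not> seen k (j0 + 1 - 1) (j0 + 1 - 1 + (b - 1 - a))"
          unfolding eq using pred[of j0 "e - 1"] je je1 by auto
      qed (use that ab al l1 in auto)
      \<comment> \<open>Before the step the diagonal of \<open>(a, b)\<close> is still at stage
        \<open>j0 + 1\<close>.\<close>
      have V5: "\<rho> (ivl_class n a b) = H (j0 + 1) a b"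
      proof (rule IH)
        have eq: "j0 + 1 + (b - a) = e + 1" "j0 + 1 - 1 + (b - a) = e" using al je by auto
        show "seen k (j0 + 1) (j0 + 1 + (b - a))" unfolding eq using diagX[of 1] l1 al ab by simp
        show "j0 + 1 = 1 \<or> \<not> seen k (j0 + 1 - 1) (j0 + 1 - 1 + (b - a))" unfolding eq using nX by simp
      qed (use ab al l1 in auto)
      have bot: "min_below ?Q m N \<rho> (ivl_class n a b) =
          (if m < b then min (H j0 (a - 1) b) (H (j0 + 1) a (b - 1)) else H j0 (a - 1) b)"
        by (rule min_below_linear[OF m _ ab(2-4) V3 V4]) (use l1 al je in auto)
      \<comment> \<open>This is \<open>l\<close> columns left of the last one. The stages found
        above place both predecessors and the old value in column \<open>c + 1\<close>.\<close>
      define c where "c = m + j0 - a"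
      have c: "j0 \<le> c" "c < m" using al ab l1 by (auto simp: c_def)
      have idx3: "m + j0 - (a - 1) = c + 1" "m + (j0 + 1) - a = c + 1" using al ab l1 by (auto simp: c_def)
      have rR: "n + 1 - b < ?R \<longleftrightarrow> m < b" using ab m by auto
      have r2: "m < b \<Longrightarrow> n + 1 - (b - 1) = n + 1 - b + 1" using ab by auto
      have H3: "H j0 (a - 1) b = int (hg_state ?R m A j0 (n + 1 - b, c + 1))"
        and H5: "H (j0 + 1) a b = int (hg_state ?R m A (j0 + 1) (n + 1 - b, c + 1))"
        unfolding H_def idx3 by (rule refl)+
      have H4: "H (j0 + 1) a (b - 1) = int (hg_state ?R m A (j0 + 1) (n + 1 - b + 1, c + 1))" if "m < b"
        unfolding H_def idx3 r2[OF that] by (rule refl)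
      have "rho_step ?Q m N M X \<rho> (ivl_class n a b) =
          max (H (j0 + 1) (a + 1) b) (H j0 a (b + 1)) +
          (if m < b then min (H j0 (a - 1) b) (H (j0 + 1) a (b - 1)) else H j0 (a - 1) b) - H (j0 + 1) a b"
        unfolding rs top bot V5 ..
      also have "\<dots> = int (max (hg_state ?R m A j0 (n + 1 - b - 1, c)) (hg_state ?R m A (j0 + 1) (n + 1 - b, c)) +
          (if n + 1 - b < ?R then min (hg_state ?R m A j0 (n + 1 - b, c + 1)) (hg_state ?R m A (j0 + 1) (n + 1 - b + 1, c + 1))
           else hg_state ?R m A j0 (n + 1 - b, c + 1))) - int (hg_state ?R m A (j0 + 1) (n + 1 - b, c + 1))"
        unfolding H1 H2 H3 H5 rR c_def[symmetric] using H4 by (simp add: max.commute of_nat_max of_nat_min)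
      also have "\<dots> = int (hg_state ?R m A j0 (n + 1 - b, c))"
        unfolding rc(2)[OF c, symmetric] by simp
      finally show ?thesis by (simp add: H_def c_def)
    qed
    have "seen (Suc k) a b" using dS[of l] al ab by simp
    thus ?thesis unfolding step val using jeq by blast
  qed
qed

theorem theorem9:
  fixes n m N :: nat
    and M :: "(nat, nat, 'k::alg_closed_field) qrep"
    and Ms :: "(nat, nat, 'k) qrep list"
  assumes "1 \<le> m" and "m \<le> n"
    and "admissible_listing (linear_quiver n) Ms"
    and "M \<in> minuscule_category (linear_quiver n) m"
  shows "\<forall>u\<in>rectangle (n + 1 - m) m.
    filling_of n m (rho (linear_quiver n) m N Ms M) u = int (HG n m M u)"
proof
  fix u assume u: "u \<in> rectangle (n + 1 - m) m"
  obtain r c where rc: "u = (r, c)" by (cases u)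
  \<comment> \<open>Fillings are read in mirrored columns, so the cell \<open>(r, c)\<close> shows
    the interval with lower end \<open>m + 1 - c\<close>.\<close>
  define a where "a = m + 1 - c"
  define b where "b = n + 1 - r"
  have ab: "1 \<le> a" "a \<le> m" "m \<le> b" "b \<le> n" and rc_eq: "n + 1 - b = r" "m + 1 - a = c"
    using u rc assms(1,2) by (auto simp: rectangle_def a_def b_def)
  \<comment> \<open>After the full listing every diagonal has reached its lowest element, so
    \<open>rho_prefix\<close> applies with \<open>j = 1\<close>.\<close>
  have "(ivl_class n 1 (1 + (b - a)) :: (nat, nat, 'k) qrep set) \<in> indec_classes (linear_quiver n)"
    unfolding indec_classes_linear using ab by (intro CollectI exI[of _ 1] exI[of _ "1 + (b - a)"]) auto
  hence mem: "ivl_class n 1 (1 + (b - a)) \<in> set (map (iso_class (linear_quiver n)) (take (length Ms) Ms))"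
    using assms(3) by (simp add: admissible_listing_def)
  have "rho (linear_quiver n) m N (take (length Ms) Ms) M (ivl_class n a b) =
      int (hg_state (n + 1 - m) m (\<lambda>u. multiplicity_in (linear_quiver n) M (indec_at n m u)) 1 (n + 1 - b, m + 1 - a))"
    by (rule rho_prefix[OF assms(1-3) order_refl ab, THEN conjunct2, rule_format, OF order_refl ab(1) mem disjI1[OF refl]])
  hence "rho (linear_quiver n) m N Ms M (ivl_class n a b) =
      int (hg_state (n + 1 - m) m (\<lambda>u. multiplicity_in (linear_quiver n) M (indec_at n m u)) 1 (r, c))"
    unfolding rc_eq by simp
  moreover have "(r, m + 1 - c) \<in> rectangle (n + 1 - m) m" using u rc by (auto simp: rectangle_def)
  hence "indec_at n m (r, m + 1 - c) = (ivl_class n a b :: (nat, nat, 'k) qrep set)"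
    by (simp add: indec_at_linear[OF assms(1,2)] a_def b_def)
  ultimately show "filling_of n m (rho (linear_quiver n) m N Ms M) u = int (HG n m M u)"
    by (simp add: filling_of_def rc HG_def hillman_grassl_eq_hg_state)
qed

end
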